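(* Let $\mathcal W_1$ and $\mathcal W_2$ be signed graphexes in $L^1\cap L^2$. Then the value $\widetilde\delta_{2\to2}(\mathcal W_1',\mathcal W_2')$, where $\mathcal W_1'$ and $\mathcal W_2'$ are trivial extensions of $\mathcal W_1$ and $\mathcal W_2$ to $\sigma$-finite measure spaces of infinite total mass, does not depend on the choice of the trivial extensions $\mathcal W_1'$ and $\mathcal W_2'$. Denote this value by $\delta_{2\to2}(\mathcal W_1,\mathcal W_2)$. Furthermore, given three signed graphexes $\mathcal W_1,\mathcal W_2,\mathcal W_3$ in $L^1\cap L^2$, $$\delta_{2\to2}(\mathcal W_1,\mathcal W_3)\le\delta_{2\to2}(\mathcal W_1,\mathcal W_2)+\delta_{2\to2}(\mathcal W_2,\mathcal W_3).$$ Therefore, $\delta_{2\to2}$ is a well-defined pseudometric on signed graphexes in $L^1\cap L^2$.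
   Context: A signed graphex $\mathcal W=(W,S,I,\mathbf\Omega)$ consists of a $\sigma$-finite measure space $\mathbf\Omega=(\Omega,\mathcal F,\mu)$, a symmetric measurable $W\colon\Omega\times\Omega\to\mathbb R$, a measurable $S\colon\Omega\to\mathbb R$ and $I\in\mathbb R$, such that (1) $W(\cdot,x)$ is integrable for almost all $x$, and (2) there is a measurable $\Omega'\subseteq\Omega$ with $\mu(\Omega\setminus\Omega')<\infty$ such that $\int_{\Omega'\times\Omega'}|W|+2\int_{\Omega'}|S|+2|I|<\infty$. The marginal is $D_{\mathcal W}(x)=\int_\Omega W(x,y)\,d\mu(y)+S(x)$, and $|\mathcal W|=(|W|,|S|,|I|,\mathbf\Omega)$. $\mathcal W$ is in $L^1\cap L^2$ if both $W$ and $D_{|\mathcal W|}$ are in $L^1\cap L^2$. Put $\rho(\mathcal W)=\int W+2\int S+2I$. Kernel norm: $\|U\|_{2\to2}=\sup\{\int f(x)U(x,y)g(y)\,d\mu(x)\,d\mu(y):\|f\|_2=\|g\|_2=1\}$. For signed graphexes in $L^1\cap L^2$ on the same measure space, $$d_{2\to2}(\mathcal W_1,\mathcal W_2)=\max\Big(\|W_1-W_2\|_{2\to2},\ \sqrt{\|D_{\mathcal W_1}-D_{\mathcal W_2}\|_2},\ \sqrt[3]{|\rho(\mathcal W_1)-\rho(\mathcal W_2)|}\Big).$$ A coupling of measures $\mu_1,\mu_2$ (on $(\Omega_1,\mathcal F_1)$, $(\Omega_2,\mathcal F_2)$) is a measure $\mu$ on $(\Omega_1\times\Omega_2,\mathcal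 F_1\times\mathcal F_2)$ whose marginals are $\mu_1$ and $\mu_2$; it exists iff $\mu_1(\Omega_1)=\mu_2(\Omega_2)$. For $\mathcal W_i$ over $(\Omega_i,\mathcal F_i,\mu_i)$ with $\mu_1(\Omega_1)=\mu_2(\Omega_2)$, set $\widetilde\delta_{2\to2}(\mathcal W_1,\mathcal W_2)=\inf_\mu d_{2\to2}(\mathcal W_1^{\pi_1,\mu},\mathcal W_2^{\pi_2,\mu})$, the infimum over all couplings $\mu$ of $\mu_1,\mu_2$, where $\pi_i$ is the coordinate projection $\Omega_1\times\Omega_2\to\Omega_i$ and $\mathcal W_i^{\pi_i,\mu}=(W_i(\pi_i(\cdot),\pi_i(\cdot)),S_i\circ\pi_i,I_i)$ is the pullback, viewed over $(\Omega_1\times\Omega_2,\mathcal F_1\times\mathcal F_2,\mu)$. A trivial extension of $\mathcal W=(W,S,I,(\Omega,\mathcal F,\mu))$ is $\mathcal W'=(W',S',I,(\Omega',\mathcal F',\mu'))$, where $(\Omega',\mathcal F',\mu')$ is $\sigma$-finite, $\Omega\in\mathcal F'$, $\mathcal F=\{A\in\mathcal F':A\subseteq\Omega\}$, $\mu=\mu'|_{\mathcal F}$, $W'$ extends $W$ by $0$ off $\Omega\times\Omega$, and $S'$ extends $S$ by $0$ off $\Omega$. *)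

theory Defs
  imports "HOL-Analysis.Analysis"
begin

record 'a graphex =
  gspace :: "'a measure"
  gW :: "'a \<Rightarrow> 'a \<Rightarrow> real"
  gS :: "'a \<Rightarrow> real"
  gI :: real

definition signed_graphex :: "'a graphex \<Rightarrow> bool" where
  "signed_graphex G \<longleftrightarrow>
     sigma_finite_measure (gspace G) \<and>
     (\<lambda>(x, y). gW G x y) \<in> borel_measurable (gspace G \<Otimes>\<^sub>M gspace G) \<and>
     (\<forall>x\<in>space (gspace G). \<forall>y\<in>space (gspace G). gW G x y = gW G y x) \<and>
     gS G \<in> borel_measurable (gspace G) \<and>
     (AE x in gspace G. integrable (gspace G) (\<lambda>y. gW G y x)) \<and>
     (\<exists>A\<in>sets (gspace G).
        emeasure (gspace G) (space (gspace G) - A) < \<infinity> \<and>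
        (\<integral>\<^sup>+ z. ennreal \<bar>gW G (fst z) (snd z)\<bar> * indicator (A \<times> A) z
            \<partial>(gspace G \<Otimes>\<^sub>M gspace G))
        + 2 * (\<integral>\<^sup>+ x. ennreal \<bar>gS G x\<bar> * indicator A x \<partial>gspace G)
        + 2 * ennreal \<bar>gI G\<bar> < \<infinity>)"

definition marginal :: "'a graphex \<Rightarrow> 'a \<Rightarrow> real" where
  "marginal G x = (\<integral>y. gW G x y \<partial>gspace G) + gS G x"

definition abs_graphex :: "'a graphex \<Rightarrow> 'a graphex" where
  "abs_graphex G =
     \<lparr>gspace = gspace G, gW = (\<lambda>x y. \<bar>gW G x y\<bar>), gS = (\<lambda>x. \<bar>gS G x\<bar>), gI = \<bar>gI G\<bar>\<rparr>"

definition in_L1_L2 :: "'a measure \<Rightarrow> ('a \<Rightarrow> real) \<Rightarrow> bool" where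
  "in_L1_L2 M f \<longleftrightarrow> integrable M f \<and> integrable M (\<lambda>x. (f x)\<^sup>2)"

definition graphex_L1_L2 :: "'a graphex \<Rightarrow> bool" where
  "graphex_L1_L2 G \<longleftrightarrow>
     in_L1_L2 (gspace G \<Otimes>\<^sub>M gspace G) (\<lambda>(x, y). gW G x y) \<and>
     in_L1_L2 (gspace G) (marginal (abs_graphex G))"

definition rho :: "'a graphex \<Rightarrow> real" where
  "rho G = (\<integral>z. gW G (fst z) (snd z) \<partial>(gspace G \<Otimes>\<^sub>M gspace G))
           + 2 * (\<integral>x. gS G x \<partial>gspace G) + 2 * gI G"

definition L2_norm :: "'a measure \<Rightarrow> ('a \<Rightarrow> real) \<Rightarrow> real" where
  "L2_norm M f = sqrt (\<integral>x. (f x)\<^sup>2 \<partial>M)"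

text \<open>
  The supremum and the infimum below are taken in the extended reals, so that neither a measure
  space of total mass \<open>0\<close> (no test functions) nor an empty set of couplings yields an
  unspecified real number.
\<close>

definition kernel_norm :: "'a measure \<Rightarrow> ('a \<Rightarrow> 'a \<Rightarrow> real) \<Rightarrow> ereal" where
  "kernel_norm M U =
     Sup {ereal (\<integral>z. f (fst z) * U (fst z) (snd z) * g (snd z) \<partial>(M \<Otimes>\<^sub>M M)) | f g.
            f \<in> borel_measurable M \<and> integrable M (\<lambda>x. (f x)\<^sup>2) \<and> L2_norm M f = 1 \<and>
            g \<in> borel_measurable M \<and> integrable M (\<lambda>x. (g x)\<^sup>2) \<and> L2_norm M g = 1}"

text \<open>Meaningful only if both graphexes live on the same measure space.\<close>

definition d22 :: "'a graphex \<Rightarrow> 'a graphex \<Rightarrow> ereal" where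
  "d22 G H =
     max (kernel_norm (gspace G) (\<lambda>x y. gW G x y - gW H x y))
       (max (ereal (sqrt (L2_norm (gspace G) (\<lambda>x. marginal G x - marginal H x))))
            (ereal (root 3 \<bar>rho G - rho H\<bar>)))"

definition couplings :: "'a measure \<Rightarrow> 'b measure \<Rightarrow> ('a \<times> 'b) measure set" where
  "couplings M N = {P. sets P = sets (M \<Otimes>\<^sub>M N) \<and> distr P M fst = M \<and> distr P N snd = N}"

definition pullback :: "('b \<Rightarrow> 'a) \<Rightarrow> 'b measure \<Rightarrow> 'a graphex \<Rightarrow> 'b graphex" where
  "pullback p P G =
     \<lparr>gspace = P, gW = (\<lambda>x y. gW G (p x) (p y)), gS = (\<lambda>x. gS G (p x)), gI = gI G\<rparr>"

definition delta22_tilde :: "'a graphex \<Rightarrow> 'b graphex \<Rightarrow> ereal" where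
  "delta22_tilde G H =
     (INF P\<in>couplings (gspace G) (gspace H). d22 (pullback fst P G) (pullback snd P H))"

text \<open>
  The inclusion of the original space into the larger one is an injection \<open>\<iota>\<close>, since a type
  \<open>'a\<close> may have no room for a larger space; \<open>\<iota> = id\<close> is the literal inclusion of sets.
\<close>

definition trivial_extension :: "('a \<Rightarrow> 'b) \<Rightarrow> 'a graphex \<Rightarrow> 'b graphex \<Rightarrow> bool" where
  "trivial_extension \<iota> G H \<longleftrightarrow>
     sigma_finite_measure (gspace H) \<and>
     inj_on \<iota> (space (gspace G)) \<and>
     \<iota> ` space (gspace G) \<in> sets (gspace H) \<and>
     (\<lambda>A. \<iota> ` A) ` sets (gspace G) = {B \<in> sets (gspace H). B \<subseteq> \<iota> ` space (gspace G)} \<and>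
     (\<forall>A\<in>sets (gspace G). emeasure (gspace G) A = emeasure (gspace H) (\<iota> ` A)) \<and>
     (\<forall>x\<in>space (gspace G). \<forall>y\<in>space (gspace G). gW H (\<iota> x) (\<iota> y) = gW G x y) \<and>
     (\<forall>x\<in>space (gspace H). \<forall>y\<in>space (gspace H).
        x \<notin> \<iota> ` space (gspace G) \<or> y \<notin> \<iota> ` space (gspace G) \<longrightarrow> gW H x y = 0) \<and>
     (\<forall>x\<in>space (gspace G). gS H (\<iota> x) = gS G x) \<and>
     (\<forall>x\<in>space (gspace H). x \<notin> \<iota> ` space (gspace G) \<longrightarrow> gS H x = 0) \<and>
     gI H = gI G"

definition infinite_trivial_extension :: "('a \<Rightarrow> 'b) \<Rightarrow> 'a graphex \<Rightarrow> 'b graphex \<Rightarrow> bool" where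
  "infinite_trivial_extension \<iota> G H \<longleftrightarrow>
     trivial_extension \<iota> G H \<and> emeasure (gspace H) (space (gspace H)) = \<infinity>"

text \<open>
  A definition can only range over extensions on fixed types. The types \<open>'a + nat\<close> and
  \<open>'b + nat\<close> have room for an extension of infinite mass, obtained by adding a countable set of
  unit atoms; that the value is the same for extensions on any types is a matter for a theorem.
\<close>

definition delta22 :: "'a graphex \<Rightarrow> 'b graphex \<Rightarrow> ereal" where
  "delta22 G H =
     (THE d. \<forall>(\<iota> :: 'a \<Rightarrow> 'a + nat) (\<kappa> :: 'b \<Rightarrow> 'b + nat) G' H'.
        infinite_trivial_extension \<iota> G G' \<and> infinite_trivial_extension \<kappa> H H' \<longrightarrow>
        delta22_tilde G' H' = d)"

end

theory Submission
  imports Defs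
begin

text \<open>
  The distance \<open>d22\<close> depends only on the kernel, the marginal and \<open>\<rho>\<close>, so a kernel and a marginal
  may be approximated in \<open>L\<^sup>2\<close> independently by functions of countably many cells, with all cells but
  one of finite mass.  Two \<open>\<sigma>\<close>-finite spaces with the same cell masses have a coupling that
  preserves cells (products of normalised restrictions; on cells of infinite mass, a sum of products
  of probability measures), and under it two graphexes close to the same step function are close.

  Applied to two infinite trivial extensions of one graphex, with the added mass in the infinite
  cell, this gives distance \<open>0\<close>.  Applied to two couplings of the first with the second and of the
  second with the third space, with the cells of the second space, it glues them; the kernel norm
  does not increase under pullback, because test functions may be replaced by their conditional
  expectations.  This yields the triangle inequality, and with it the independence of the extension.
\<close>

section \<open>Square integrable functions\<close>

text \<open>The roots in \<open>d22\<close> cause no trouble: \<open>d22 \<le> c\<close> asks for a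
  bound \<open>c\<close> on the kernel, \<open>c^2\<close> on the marginal and \<open>c^3\<close> on
  the difference of the \<open>rho\<close>, and since squares and cubes are superadditive on
  nonnegative reals, the bounds for successive differences add up. Approximation in L2 suffices
  because the L2 norm of a kernel dominates its kernel norm (Hilbert-Schmidt). The numbers
  \<open>rho\<close> need no approximation: pullbacks and trivial extensions leave them unchanged. A
  glued measure space carries more test functions than the couplings it was made from. That these do
  not raise the kernel norm rests on conditional expectation being a contraction of L2. The
  approximants vanish outside a set of finite mass. Hence all mass that an extension adds can be put
  into a single cell, and two infinite extensions of one graphex have the same cell masses, however
  different they are otherwise.\<close>

definition sqint :: "'a measure \<Rightarrow> ('a \<Rightarrow> real) \<Rightarrow> bool" where
  "sqint M f \<longleftrightarrow> f \<in> borel_measurable M \<and> integrable M (\<lambda>x. (f x)\<^sup>2)"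

lemma sqint_measurable[measurable_dest]: "sqint M f \<Longrightarrow> f \<in> borel_measurable M"
  and sqint_integrable: "sqint M f \<Longrightarrow> integrable M (\<lambda>x. (f x)\<^sup>2)"
  by (auto simp: sqint_def)

lemma L2_norm_nonneg[simp]: "0 \<le> L2_norm M f"
  by (simp add: L2_norm_def)

lemma L2_norm_power2: "(L2_norm M f)\<^sup>2 = (\<integral>x. (f x)\<^sup>2 \<partial>M)"
  by (simp add: L2_norm_def)

lemma L2_norm_le_iff: "0 \<le> c \<Longrightarrow> L2_norm M f \<le> c \<longleftrightarrow> (\<integral>x. (f x)\<^sup>2 \<partial>M) \<le> c\<^sup>2"
  unfolding L2_norm_def by (metis real_sqrt_abs real_sqrt_le_iff abs_of_nonneg)

lemma sqint_bound:
  assumes "sqint M f" "g \<in> borel_measurable M" "AE x in M. \<bar>g x\<bar> \<le> \<bar>f x\<bar>"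
  shows "sqint M g" "L2_norm M g \<le> L2_norm M f"
proof -
  have le: "AE x in M. (g x)\<^sup>2 \<le> (f x)\<^sup>2"
    using assms(3) by (auto simp: abs_le_square_iff)
  have i: "integrable M (\<lambda>x. (g x)\<^sup>2)"
    by (rule Bochner_Integration.integrable_bound[OF sqint_integrable[OF assms(1)]])
       (use assms le in auto)
  with assms show "sqint M g" by (simp add: sqint_def)
  show "L2_norm M g \<le> L2_norm M f"
    unfolding L2_norm_def by (intro real_sqrt_le_mono integral_mono_AE i sqint_integrable assms le)
qed

lemma sqint_cong:
  assumes "\<And>x. x \<in> space M \<Longrightarrow> f x = g x"
  shows "sqint M f \<longleftrightarrow> sqint M g" "L2_norm M f = L2_norm M g"
proof -
  have "integrable M (\<lambda>x. (f x)\<^sup>2) \<longleftrightarrow> integrable M (\<lambda>x. (g x)\<^sup>2)"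
    by (rule Bochner_Integration.integrable_cong) (simp_all add: assms)
  moreover have "f \<in> borel_measurable M \<longleftrightarrow> g \<in> borel_measurable M"
    by (rule measurable_cong) (rule assms)
  ultimately show "sqint M f \<longleftrightarrow> sqint M g"
    by (simp add: sqint_def)
  show "L2_norm M f = L2_norm M g"
    unfolding L2_norm_def by (rule arg_cong[where f=sqrt], rule Bochner_Integration.integral_cong) (simp_all add: assms)
qed

lemma L2_norm_cong_AE:
  assumes "f \<in> borel_measurable M" "g \<in> borel_measurable M" "AE x in M. f x = g x"
  shows "L2_norm M f = L2_norm M g"
  unfolding L2_norm_def using assms by (intro arg_cong[where f=sqrt] integral_cong_AE) auto

lemma sqint_mult_integrable:
  assumes "sqint M f" "sqint M g"
  shows "integrable M (\<lambda>x. f x * g x)"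
proof (rule Bochner_Integration.integrable_bound)
  show "integrable M (\<lambda>x. (f x)\<^sup>2 + (g x)\<^sup>2)"
    using assms by (simp add: sqint_def)
  show "(\<lambda>x. f x * g x) \<in> borel_measurable M"
    using assms by (auto simp: sqint_def)
  have "\<bar>a * b\<bar> \<le> a\<^sup>2 + b\<^sup>2" for a b :: real
  proof -
    have "2 * (\<bar>a\<bar> * \<bar>b\<bar>) \<le> a\<^sup>2 + b\<^sup>2"
      using sum_squares_bound[of "\<bar>a\<bar>" "\<bar>b\<bar>"] by simp
    moreover have "0 \<le> \<bar>a\<bar> * \<bar>b\<bar>" by simp
    ultimately show ?thesis unfolding abs_mult by linarith
  qed
  then show "AE x in M. norm (f x * g x) \<le> norm ((f x)\<^sup>2 + (g x)\<^sup>2)"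
    by (auto simp: abs_mult)
qed

lemma sqint_zero[simp]: "sqint M (\<lambda>x. 0)"
  by (simp add: sqint_def)

lemma sqint_cmult: "sqint M f \<Longrightarrow> sqint M (\<lambda>x. c * f x)"
  by (auto simp: sqint_def power_mult_distrib)

lemma L2_norm_cmult: "L2_norm M (\<lambda>x. c * f x) = \<bar>c\<bar> * L2_norm M f"
  by (simp add: L2_norm_def power_mult_distrib real_sqrt_mult)

lemma sqint_uminus: "sqint M f \<Longrightarrow> sqint M (\<lambda>x. - f x)"
  by (simp add: sqint_def)

lemma sqint_add:
  assumes "sqint M f" "sqint M g"
  shows "sqint M (\<lambda>x. f x + g x)"
  using assms sqint_mult_integrable[OF assms] by (auto simp: sqint_def power2_sum mult.assoc)

lemma sqint_diff:
  assumes "sqint M f" "sqint M g"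
  shows "sqint M (\<lambda>x. f x - g x)"
  using sqint_add[OF assms(1) sqint_uminus[OF assms(2)]] by simp

lemma L2_norm_eq_0D:
  assumes "sqint M f" "L2_norm M f = 0"
  shows "AE x in M. f x = 0"
proof -
  have "(\<integral>x. (f x)\<^sup>2 \<partial>M) = 0"
    using assms(2) by (simp add: L2_norm_def)
  then have "AE x in M. (f x)\<^sup>2 = 0"
    using integral_nonneg_eq_0_iff_AE[OF sqint_integrable[OF assms(1)]] by auto
  then show ?thesis by auto
qed

lemma L2_cauchy_schwarz_abs:
  assumes f: "sqint M f" and g: "sqint M g"
  shows "(\<integral>x. \<bar>f x * g x\<bar> \<partial>M) \<le> L2_norm M f * L2_norm M g"
proof (cases "L2_norm M f = 0 \<or> L2_norm M g = 0")
  case True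
  then have "AE x in M. \<bar>f x * g x\<bar> = 0"
  proof
    assume "L2_norm M f = 0"
    with L2_norm_eq_0D[OF f] show ?thesis by auto
  next
    assume "L2_norm M g = 0"
    with L2_norm_eq_0D[OF g] show ?thesis by auto
  qed
  then have "(\<integral>x. \<bar>f x * g x\<bar> \<partial>M) = 0"
    by (rule integral_eq_zero_AE)
  then show ?thesis by simp
next
  case False
  define a b where "a = L2_norm M f" "b = L2_norm M g"
  have pos: "a > 0" "b > 0"
    using False L2_norm_nonneg[of M f] L2_norm_nonneg[of M g] unfolding a_b_def by linarith+
  \<comment> \<open>Arithmetic-geometric mean inequality with weights chosen so that both terms on
    the right integrate to \<open>a * b\<close>.\<close>
  have le: "\<bar>f x * g x\<bar> \<le> (b / a * (f x)\<^sup>2 + a / b * (g x)\<^sup>2) / 2" for x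
  proof -
    have "0 \<le> (b * \<bar>f x\<bar> - a * \<bar>g x\<bar>)\<^sup>2" by simp
    also have "(b * \<bar>f x\<bar> - a * \<bar>g x\<bar>)\<^sup>2 = b\<^sup>2 * (f x)\<^sup>2 + a\<^sup>2 * (g x)\<^sup>2 - 2 * (a * b) * \<bar>f x * g x\<bar>"
      by (simp add: power2_diff power_mult_distrib abs_mult)
    finally show ?thesis
      using pos by (simp add: field_simps power2_eq_square)
  qed
  have "(\<integral>x. \<bar>f x * g x\<bar> \<partial>M) \<le> (\<integral>x. (b / a * (f x)\<^sup>2 + a / b * (g x)\<^sup>2) / 2 \<partial>M)"
    using f g le sqint_mult_integrable[OF f g] by (intro integral_mono) (auto simp: sqint_def)
  also have "\<dots> = (b / a * a\<^sup>2 + a / b * b\<^sup>2) / 2"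
    using f g by (simp add: sqint_def a_b_def L2_norm_power2)
  also have "\<dots> = a * b"
    using pos by (simp add: power2_eq_square)
  finally show ?thesis by (simp add: a_b_def)
qed

lemma L2_cauchy_schwarz:
  assumes f: "sqint M f" and g: "sqint M g"
  shows "\<bar>\<integral>x. f x * g x \<partial>M\<bar> \<le> L2_norm M f * L2_norm M g"
  using integral_abs_bound[of M "\<lambda>x. f x * g x"] L2_cauchy_schwarz_abs[OF assms] by linarith

lemma L2_norm_add_le:
  assumes f: "sqint M f" and g: "sqint M g"
  shows "L2_norm M (\<lambda>x. f x + g x) \<le> L2_norm M f + L2_norm M g"
proof -
  have "(\<integral>x. (f x + g x)\<^sup>2 \<partial>M) = (\<integral>x. (f x)\<^sup>2 \<partial>M) + (\<integral>x. (g x)\<^sup>2 \<partial>M) + 2 * (\<integral>x. f x * g x \<partial>M)"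
    using f g sqint_mult_integrable[OF f g] by (simp add: sqint_def power2_sum mult.assoc)
  also have "\<dots> \<le> (L2_norm M f + L2_norm M g)\<^sup>2"
    using L2_cauchy_schwarz[OF f g] by (simp add: power2_sum L2_norm_power2)
  finally show ?thesis
    by (subst L2_norm_le_iff) auto
qed

lemma L2_norm_diff_le:
  assumes f: "sqint M f" and g: "sqint M g"
  shows "L2_norm M (\<lambda>x. f x - g x) \<le> L2_norm M f + L2_norm M g"
  using L2_norm_add_le[OF f sqint_uminus[OF g]] by (simp add: L2_norm_def)

lemma sqint_distr:
  assumes [measurable]: "T \<in> measurable M N" "f \<in> borel_measurable N"
  shows "sqint M (\<lambda>x. f (T x)) \<longleftrightarrow> sqint (distr M N T) f"
    and "L2_norm M (\<lambda>x. f (T x)) = L2_norm (distr M N T) f"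
  by (simp_all add: sqint_def L2_norm_def integrable_distr_eq integral_distr)

lemma sqint_indicator: "A \<in> sets M \<Longrightarrow> emeasure M A < \<infinity> \<Longrightarrow> sqint M (indicator A)"
proof -
  assume A: "A \<in> sets M" "emeasure M A < \<infinity>"
  have "(\<lambda>x. (indicator A x :: real)\<^sup>2) = indicator A"
    by (auto simp: indicator_def)
  with A show ?thesis by (simp add: sqint_def less_top[symmetric])
qed

text \<open>The squared differences are dominated by \<open>(2 * g x)\<^sup>2\<close>. This serves
  both limits below: simple functions tending to a function, and sets increasing to a union.\<close>

lemma L2_dominated_convergence:
  assumes F: "\<And>i. F i \<in> borel_measurable M" and f: "f \<in> borel_measurable M" and g: "sqint M g"
    and bnd: "\<And>i x. x \<in> space M \<Longrightarrow> \<bar>F i x\<bar> \<le> g x"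
    and lim: "\<And>x. x \<in> space M \<Longrightarrow> (\<lambda>i. F i x) \<longlonglongrightarrow> f x"
  shows "(\<lambda>i. L2_norm M (\<lambda>x. f x - F i x)) \<longlonglongrightarrow> 0" and "\<And>i. sqint M (\<lambda>x. f x - F i x)"
proof -
  note [measurable] = F f g[THEN sqint_measurable]
  have fb: "\<bar>f x\<bar> \<le> g x" if "x \<in> space M" for x
    using lim[OF that] by (intro LIMSEQ_le_const2[OF tendsto_rabs]) (auto intro: bnd that)
  have b: "\<bar>f x - F i x\<bar> \<le> 2 * g x" if "x \<in> space M" for i x
    using fb[OF that] bnd[OF that, of i] by linarith
  have b2: "(f x - F i x)\<^sup>2 \<le> (2 * g x)\<^sup>2" if "x \<in> space M" for i x
    using power_mono[OF b[OF that, of i], of 2] by simp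
  have i: "integrable M (\<lambda>x. (2 * g x)\<^sup>2)"
    by (intro sqint_integrable sqint_cmult g)
  have "(\<lambda>i. \<integral>x. (f x - F i x)\<^sup>2 \<partial>M) \<longlonglongrightarrow> (\<integral>x. 0 \<partial>M)"
  proof (rule integral_dominated_convergence[OF _ _ i])
    show "AE x in M. (\<lambda>i. (f x - F i x)\<^sup>2) \<longlonglongrightarrow> 0"
    proof (rule AE_I2)
      fix x assume "x \<in> space M"
      from tendsto_power[OF tendsto_diff[OF tendsto_const[of "f x"] lim[OF this]], of 2]
      show "(\<lambda>i. (f x - F i x)\<^sup>2) \<longlonglongrightarrow> 0" by simp
    qed
    show "AE x in M. norm ((f x - F i x)\<^sup>2) \<le> (2 * g x)\<^sup>2" for i
      using b2 by (auto intro!: AE_I2)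
  qed measurable
  from tendsto_real_sqrt[OF this]
  show "(\<lambda>i. L2_norm M (\<lambda>x. f x - F i x)) \<longlonglongrightarrow> 0"
    by (simp add: L2_norm_def)
  show "sqint M (\<lambda>x. f x - F i x)" for i
  proof (rule sqint_bound(1)[OF sqint_cmult[OF g, of 2]])
    have "0 \<le> g x" if "x \<in> space M" for x
      using fb[OF that] by linarith
    then show "AE x in M. \<bar>f x - F i x\<bar> \<le> \<bar>2 * g x\<bar>"
      using b by (intro AE_I2) fastforce
  qed measurable
qed

lemma sqint_pair_mult:
  assumes M: "sigma_finite_measure M" and f: "sqint M f" and g: "sqint M g"
  shows "sqint (M \<Otimes>\<^sub>M M) (\<lambda>z. f (fst z) * g (snd z))"
    and "L2_norm (M \<Otimes>\<^sub>M M) (\<lambda>z. f (fst z) * g (snd z)) = L2_norm M f * L2_norm M g"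
proof -
  interpret sigma_finite_measure M by fact
  interpret pair_sigma_finite M M ..
  note [measurable] = f[THEN sqint_measurable] g[THEN sqint_measurable]
  have i: "integrable (M \<Otimes>\<^sub>M M) (\<lambda>z. (f (fst z))\<^sup>2 * (g (snd z))\<^sup>2)"
    by (rule Fubini_integrable)
       (auto simp: sqint_integrable[OF f] sqint_integrable[OF g])
  then show "sqint (M \<Otimes>\<^sub>M M) (\<lambda>z. f (fst z) * g (snd z))"
    by (auto simp: sqint_def power_mult_distrib)
  have "(\<integral>z. (f (fst z))\<^sup>2 * (g (snd z))\<^sup>2 \<partial>(M \<Otimes>\<^sub>M M)) = (\<integral>x. (f x)\<^sup>2 \<partial>M) * (\<integral>x. (g x)\<^sup>2 \<partial>M)"
    by (subst integral_fst'[OF i, symmetric]) simp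
  then show "L2_norm (M \<Otimes>\<^sub>M M) (\<lambda>z. f (fst z) * g (snd z)) = L2_norm M f * L2_norm M g"
    by (simp add: L2_norm_def power_mult_distrib real_sqrt_mult)
qed

section \<open>Approximation by step functions\<close>

text \<open>Square integrability is asked of the difference alone, so a step function with arbitrary
  values can stand on the right without a summability condition of its own.\<close>

definition L2_close :: "'a measure \<Rightarrow> real \<Rightarrow> ('a \<Rightarrow> real) \<Rightarrow> ('a \<Rightarrow> real) \<Rightarrow> bool" where
  "L2_close M \<epsilon> f g \<longleftrightarrow> sqint M (\<lambda>x. f x - g x) \<and> L2_norm M (\<lambda>x. f x - g x) \<le> \<epsilon>"

lemma L2_close_add:
  assumes "L2_close M a f f'" "L2_close M b g g'"
  shows "L2_close M (a + b) (\<lambda>x. f x + g x) (\<lambda>x. f' x + g' x)"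
proof -
  have *: "(\<lambda>x. f x + g x - (f' x + g' x)) = (\<lambda>x. (f x - f' x) + (g x - g' x))"
    by (auto simp: algebra_simps)
  show ?thesis
    using assms sqint_add[of M "\<lambda>x. f x - f' x" "\<lambda>x. g x - g' x"]
      L2_norm_add_le[of M "\<lambda>x. f x - f' x" "\<lambda>x. g x - g' x"]
    unfolding L2_close_def * by auto
qed

text \<open>Adding the two hypotheses compares \<open>f + g\<close> with \<open>g + h\<close>, and
  \<open>g\<close> cancels in the difference.\<close>

lemma L2_close_trans:
  assumes "L2_close M a f g" "L2_close M b g h"
  shows "L2_close M (a + b) f h"
  using L2_close_add[OF assms] by (simp add: L2_close_def algebra_simps)

lemma L2_close_cmult:
  assumes "L2_close M a f g"
  shows "L2_close M (\<bar>c\<bar> * a) (\<lambda>x. c * f x) (\<lambda>x. c * g x)"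
proof -
  have *: "(\<lambda>x. c * f x - c * g x) = (\<lambda>x. c * (f x - g x))"
    by (auto simp: algebra_simps)
  show ?thesis
    using assms unfolding L2_close_def *
    by (auto simp: sqint_cmult L2_norm_cmult intro: mult_left_mono)
qed

text \<open>An induction principle in which \<open>V\<close> plays the part of an L2-closed linear
  space of functions. Simple functions bounded by twice the modulus of \<open>f\<close> are finite
  combinations of indicators of finite mass, and they converge to \<open>f\<close> in L2.\<close>

lemma L2_dense:
  fixes V :: "('a \<Rightarrow> real) \<Rightarrow> bool"
  assumes f: "sqint M f"
    and ind: "\<And>A. A \<in> sets M \<Longrightarrow> emeasure M A < \<infinity> \<Longrightarrow> V (indicator A)"
    and add: "\<And>f g. V f \<Longrightarrow> V g \<Longrightarrow> V (\<lambda>x. f x + g x)"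
    and cmult: "\<And>c f. V f \<Longrightarrow> V (\<lambda>x. c * f x)"
    and lim: "\<And>f. (\<And>\<epsilon>. \<epsilon> > 0 \<Longrightarrow> \<exists>g. V g \<and> L2_close M \<epsilon> f g) \<Longrightarrow> V f"
  shows "V f"
proof -
  have fm: "f \<in> borel_measurable M" using f by (rule sqint_measurable)
  from borel_measurable_implies_sequence_metric[OF fm, of 0] obtain s where
    s: "\<And>i. simple_function M (s i)" and
    s_lim: "\<And>x. x \<in> space M \<Longrightarrow> (\<lambda>i. s i x) \<longlonglongrightarrow> f x" and
    s_bnd: "\<And>i x. x \<in> space M \<Longrightarrow> \<bar>s i x\<bar> \<le> 2 * \<bar>f x\<bar>"
    unfolding dist_real_def diff_0_right by blast
  have V0: "V (\<lambda>x. 0)"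
    using cmult[OF ind[of "{}"], of 0] by simp
  have g: "sqint M (\<lambda>x. 2 * \<bar>f x\<bar>)"
    using f by (intro sqint_cmult) (auto simp: sqint_def)
  have sm: "s i \<in> borel_measurable M" for i
    using s by (rule borel_measurable_simple_function)
  have ssq: "sqint M (s i)" for i
    by (rule sqint_bound(1)[OF g sm]) (use s_bnd in auto)
  \<comment> \<open>\<open>V\<close> speaks of functions on the whole type, while \<open>s i\<close>
    is controlled on \<open>space M\<close> only; hence a representative \<open>g\<close> that
    agrees with it there.\<close>
  have Vs: "\<exists>g. V g \<and> (\<forall>x\<in>space M. g x = s i x)" for i
  proof -
    define A where "A y = {x\<in>space M. s i x = y}" for y
    have Am: "A y \<in> sets M" for y
      unfolding A_def using sm by measurable
    have fin: "finite (s i ` space M - {0})"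
      using s[of i] by (simp add: simple_function_def)
    \<comment> \<open>Chebyshev: on the level set of a nonzero value \<open>y\<close>, the square
      integrable function \<open>s i / y\<close> is 1, so the set has finite mass. The level set of
      0 may have infinite mass and is left out of the sum.\<close>
    have level: "V (\<lambda>x. y * indicator (A y) x)" if "y \<noteq> 0" for y
    proof (rule cmult, rule ind[OF Am])
      have "sqint M (indicator (A y))"
      proof (rule sqint_bound(1)[OF sqint_cmult[OF ssq[of i], of "1 / y"]])
        show "AE x in M. \<bar>indicator (A y) x\<bar> \<le> \<bar>1 / y * s i x\<bar>"
          using that by (auto simp: A_def indicator_def)
      qed (use Am in auto)
      then have "integrable M (\<lambda>x. (indicator (A y) x :: real)\<^sup>2)"
        by (rule sqint_integrable)
      moreover have "(\<lambda>x. (indicator (A y) x :: real)\<^sup>2) = indicator (A y)"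
        by (auto simp: indicator_def)
      ultimately show "emeasure M (A y) < \<infinity>"
        using Am integrable_indicator_iff[of M "A y"] by (auto simp: less_top)
    qed
    have "V (\<lambda>x. \<Sum>y\<in>s i ` space M - {0}. y * indicator (A y) x)"
      using fin
    proof (rule finite_subset_induct[where F="s i ` space M - {0}" and A="- {0}"])
      fix a F assume "finite F" "a \<in> - {0}" "a \<notin> F" and IH: "V (\<lambda>x. \<Sum>y\<in>F. y * indicator (A y) x)"
      then have "a \<noteq> 0" by simp
      with \<open>finite F\<close> \<open>a \<notin> F\<close> show "V (\<lambda>x. \<Sum>y\<in>insert a F. y * indicator (A y) x)"
        using add[OF level[of a] IH] by (simp only: sum.insert not_False_eq_True ComplD singleton_iff simp_thms)
    qed (use V0 in auto)
    moreover have "(\<Sum>y\<in>s i ` space M - {0}. y * indicator (A y) x) = s i x" if "x \<in> space M" for x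
    proof -
      have "(\<Sum>y\<in>s i ` space M - {0}. y * indicator (A y) x)
          = (\<Sum>y\<in>s i ` space M - {0}. if y = s i x then y else 0)"
        using that by (intro sum.cong) (auto simp: A_def)
      then show ?thesis
        using that fin by (simp add: sum.delta)
    qed
    ultimately show ?thesis by blast
  qed
  show ?thesis
  proof (rule lim)
    fix \<epsilon> :: real assume "\<epsilon> > 0"
    note conv = L2_dominated_convergence[OF sm fm g s_bnd s_lim]
    obtain i where i: "L2_norm M (\<lambda>x. f x - s i x) < \<epsilon>"
      using order_tendstoD(2)[OF conv(1) \<open>\<epsilon> > 0\<close>] by (auto simp: eventually_sequentially)
    obtain g where g: "V g" "\<And>x. x \<in> space M \<Longrightarrow> g x = s i x"
      using Vs by blast
    have "L2_close M \<epsilon> f g"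
      unfolding L2_close_def
      using i conv(2)[of i] sqint_cong[of M "\<lambda>x. f x - g x" "\<lambda>x. f x - s i x"] g(2) by simp
    with g(1) show "\<exists>g. V g \<and> L2_close M \<epsilon> f g" by blast
  qed
qed

text \<open>
  Cell \<open>0\<close> collects the part of the space on which step functions vanish; this is the only cell
  that may have infinite mass.
\<close>

definition cell_map :: "'a measure \<Rightarrow> ('a \<Rightarrow> nat) \<Rightarrow> bool" where
  "cell_map M \<kappa> \<longleftrightarrow> \<kappa> \<in> measurable M (count_space UNIV) \<and> emeasure M {x\<in>space M. \<kappa> x \<noteq> 0} < \<infinity>"

lemma cell_map_measurable[measurable_dest]: "cell_map M \<kappa> \<Longrightarrow> \<kappa> \<in> measurable M (count_space UNIV)"
  by (simp add: cell_map_def)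

definition steppable :: "'a measure \<Rightarrow> ('a \<Rightarrow> real) \<Rightarrow> bool" where
  "steppable M f \<longleftrightarrow> (\<forall>\<epsilon>>0. \<exists>\<kappa> V. cell_map M \<kappa> \<and> V 0 = 0 \<and> L2_close M \<epsilon> f (\<lambda>x. V (\<kappa> x)))"

text \<open>The same cells are used in both coordinates, because a coupling moves both coordinates
  in the same way. The vanishing of \<open>U\<close> at index 0 in either place makes the step
  function compatible with an extension of the kernel by 0.\<close>

definition steppable2 :: "'a measure \<Rightarrow> ('a \<times> 'a \<Rightarrow> real) \<Rightarrow> bool" where
  "steppable2 M F \<longleftrightarrow> (\<forall>\<epsilon>>0. \<exists>\<kappa> U. cell_map M \<kappa> \<and> (\<forall>k. U 0 k = 0 \<and> U k 0 = 0) \<and>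
     L2_close (M \<Otimes>\<^sub>M M) \<epsilon> F (\<lambda>z. U (\<kappa> (fst z)) (\<kappa> (snd z))))"

section \<open>Step functions are dense in L2\<close>

lemma prod_decode_0: "prod_decode 0 = (0, 0)"
  by (metis prod_decode_def prod_decode_aux.simps le_numeral_extra(3) diff_self_eq_0)

text \<open>Common refinement of two cell maps. The pairing sends \<open>(0, 0)\<close> to 0, so the
  new cell 0 is the intersection of the old ones, and its complement is a union of two sets of
  finite mass.\<close>

lemma cell_map_pair:
  assumes "cell_map M \<kappa>" "cell_map M \<kappa>'"
  shows "cell_map M (\<lambda>x. prod_encode (\<kappa> x, \<kappa>' x))"
proof -
  note [measurable] = assms[THEN cell_map_measurable]
  have zero: "0 < prod_encode p \<longleftrightarrow> p \<noteq> (0, 0)" for p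
  proof -
    have "prod_encode (0, 0) = 0" by (simp add: prod_encode_def)
    then show ?thesis by (metis prod_encode_eq neq0_conv)
  qed
  have "emeasure M {x\<in>space M. prod_encode (\<kappa> x, \<kappa>' x) \<noteq> 0}
      \<le> emeasure M ({x\<in>space M. \<kappa> x \<noteq> 0} \<union> {x\<in>space M. \<kappa>' x \<noteq> 0})"
    by (rule emeasure_mono) (auto simp: zero)
  also have "\<dots> \<le> emeasure M {x\<in>space M. \<kappa> x \<noteq> 0} + emeasure M {x\<in>space M. \<kappa>' x \<noteq> 0}"
    by (rule emeasure_subadditive) auto
  also have "\<dots> < \<infinity>"
    using assms by (auto simp: cell_map_def)
  finally show ?thesis
    unfolding cell_map_def by simp
qed

lemma steppable_add:
  assumes "steppable M f" "steppable M g"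
  shows "steppable M (\<lambda>x. f x + g x)"
  unfolding steppable_def
proof safe
  fix \<epsilon> :: real assume "\<epsilon> > 0"
  then have e: "\<epsilon> / 2 > 0" by simp
  from assms(1)[unfolded steppable_def, rule_format, OF e] obtain \<kappa> V where
    1: "cell_map M \<kappa>" "V 0 = 0" "L2_close M (\<epsilon> / 2) f (\<lambda>x. V (\<kappa> x))" by blast
  from assms(2)[unfolded steppable_def, rule_format, OF e] obtain \<kappa>' V' where
    2: "cell_map M \<kappa>'" "V' 0 = 0" "L2_close M (\<epsilon> / 2) g (\<lambda>x. V' (\<kappa>' x))" by blast
  show "\<exists>\<kappa> V. cell_map M \<kappa> \<and> V 0 = 0 \<and> L2_close M \<epsilon> (\<lambda>x. f x + g x) (\<lambda>x. V (\<kappa> x))"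
    using cell_map_pair[OF 1(1) 2(1)] L2_close_add[OF 1(3) 2(3)] prod_decode_0 1(2) 2(2)
    by (intro exI[of _ "\<lambda>x. prod_encode (\<kappa> x, \<kappa>' x)"]
        exI[of _ "\<lambda>k. V (fst (prod_decode k)) + V' (snd (prod_decode k))"]) auto
qed

lemma steppable2_add:
  assumes "steppable2 M f" "steppable2 M g"
  shows "steppable2 M (\<lambda>x. f x + g x)"
  unfolding steppable2_def
proof safe
  fix \<epsilon> :: real assume "\<epsilon> > 0"
  then have e: "\<epsilon> / 2 > 0" by simp
  from assms(1)[unfolded steppable2_def, rule_format, OF e] obtain \<kappa> U where
    1: "cell_map M \<kappa>" "\<And>k. U 0 k = 0 \<and> U k 0 = 0" 
       "L2_close (M \<Otimes>\<^sub>M M) (\<epsilon> / 2) f (\<lambda>z. U (\<kappa> (fst z)) (\<kappa> (snd z)))" by blast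
  from assms(2)[unfolded steppable2_def, rule_format, OF e] obtain \<kappa>' U' where
    2: "cell_map M \<kappa>'" "\<And>k. U' 0 k = 0 \<and> U' k 0 = 0" 
       "L2_close (M \<Otimes>\<^sub>M M) (\<epsilon> / 2) g (\<lambda>z. U' (\<kappa>' (fst z)) (\<kappa>' (snd z)))" by blast
  show "\<exists>\<kappa> U. cell_map M \<kappa> \<and> (\<forall>k. U 0 k = 0 \<and> U k 0 = 0) \<and>
      L2_close (M \<Otimes>\<^sub>M M) \<epsilon> (\<lambda>x. f x + g x) (\<lambda>z. U (\<kappa> (fst z)) (\<kappa> (snd z)))"
    using cell_map_pair[OF 1(1) 2(1)] L2_close_add[OF 1(3) 2(3)] prod_decode_0 1(2) 2(2)
    by (intro exI[of _ "\<lambda>x. prod_encode (\<kappa> x, \<kappa>' x)"]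
        exI[of _ "\<lambda>k l. U (fst (prod_decode k)) (fst (prod_decode l)) + U' (snd (prod_decode k)) (snd (prod_decode l))"]) auto
qed

lemma steppable_cmult:
  assumes "steppable M f"
  shows "steppable M (\<lambda>x. c * f x)"
  unfolding steppable_def
proof safe
  fix \<epsilon> :: real assume "\<epsilon> > 0"
  \<comment> \<open>The summand 1 covers \<open>c = 0\<close>.\<close>
  then have "\<epsilon> / (\<bar>c\<bar> + 1) > 0" by simp
  from assms[unfolded steppable_def, rule_format, OF this] obtain \<kappa> V where
    1: "cell_map M \<kappa>" "V 0 = 0" "L2_close M (\<epsilon> / (\<bar>c\<bar> + 1)) f (\<lambda>x. V (\<kappa> x))" by blast
  have "\<bar>c\<bar> * (\<epsilon> / (\<bar>c\<bar> + 1)) \<le> \<epsilon>"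
    using \<open>\<epsilon> > 0\<close> by (simp add: field_simps)
  with L2_close_cmult[OF 1(3), of c] have "L2_close M \<epsilon> (\<lambda>x. c * f x) (\<lambda>x. c * V (\<kappa> x))"
    by (auto simp: L2_close_def)
  with 1 show "\<exists>\<kappa> V. cell_map M \<kappa> \<and> V 0 = 0 \<and> L2_close M \<epsilon> (\<lambda>x. c * f x) (\<lambda>x. V (\<kappa> x))"
    by (intro exI[of _ \<kappa>] exI[of _ "\<lambda>k. c * V k"]) auto
qed

lemma steppable2_cmult:
  assumes "steppable2 M f"
  shows "steppable2 M (\<lambda>x. c * f x)"
  unfolding steppable2_def
proof safe
  fix \<epsilon> :: real assume "\<epsilon> > 0"
  then have "\<epsilon> / (\<bar>c\<bar> + 1) > 0" by simp
  from assms[unfolded steppable2_def, rule_format, OF this] obtain \<kappa> U where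
    1: "cell_map M \<kappa>" "\<And>k. U 0 k = 0 \<and> U k 0 = 0"
      "L2_close (M \<Otimes>\<^sub>M M) (\<epsilon> / (\<bar>c\<bar> + 1)) f (\<lambda>z. U (\<kappa> (fst z)) (\<kappa> (snd z)))" by blast
  have "\<bar>c\<bar> * (\<epsilon> / (\<bar>c\<bar> + 1)) \<le> \<epsilon>"
    using \<open>\<epsilon> > 0\<close> by (simp add: field_simps)
  with L2_close_cmult[OF 1(3), of c]
  have "L2_close (M \<Otimes>\<^sub>M M) \<epsilon> (\<lambda>x. c * f x) (\<lambda>z. c * U (\<kappa> (fst z)) (\<kappa> (snd z)))"
    by (auto simp: L2_close_def)
  with 1 show "\<exists>\<kappa> U. cell_map M \<kappa> \<and> (\<forall>k. U 0 k = 0 \<and> U k 0 = 0) \<and>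
      L2_close (M \<Otimes>\<^sub>M M) \<epsilon> (\<lambda>x. c * f x) (\<lambda>z. U (\<kappa> (fst z)) (\<kappa> (snd z)))"
    by (intro exI[of _ \<kappa>] exI[of _ "\<lambda>k l. c * U k l"]) auto
qed

lemma steppable_lim:
  assumes "\<And>\<epsilon>. \<epsilon> > 0 \<Longrightarrow> \<exists>g. steppable M g \<and> L2_close M \<epsilon> f g"
  shows "steppable M f"
  unfolding steppable_def
proof safe
  fix \<epsilon> :: real assume "\<epsilon> > 0"
  then have e: "\<epsilon> / 2 > 0" by simp
  from assms[OF e] obtain g where g: "steppable M g" "L2_close M (\<epsilon> / 2) f g" by blast
  from g(1)[unfolded steppable_def, rule_format, OF e] obtain \<kappa> V where
    1: "cell_map M \<kappa>" "V 0 = 0" "L2_close M (\<epsilon> / 2) g (\<lambda>x. V (\<kappa> x))" by blast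
  then show "\<exists>\<kappa> V. cell_map M \<kappa> \<and> V 0 = 0 \<and> L2_close M \<epsilon> f (\<lambda>x. V (\<kappa> x))"
    using L2_close_trans[OF g(2) 1(3)] by auto
qed

lemma steppable2_lim:
  assumes "\<And>\<epsilon>. \<epsilon> > 0 \<Longrightarrow> \<exists>g. steppable2 M g \<and> L2_close (M \<Otimes>\<^sub>M M) \<epsilon> f g"
  shows "steppable2 M f"
  unfolding steppable2_def
proof safe
  fix \<epsilon> :: real assume "\<epsilon> > 0"
  then have e: "\<epsilon> / 2 > 0" by simp
  from assms[OF e] obtain g where g: "steppable2 M g" "L2_close (M \<Otimes>\<^sub>M M) (\<epsilon> / 2) f g" by blast
  from g(1)[unfolded steppable2_def, rule_format, OF e] obtain \<kappa> U where
    1: "cell_map M \<kappa>" "\<And>k. U 0 k = 0 \<and> U k 0 = 0"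
      "L2_close (M \<Otimes>\<^sub>M M) (\<epsilon> / 2) g (\<lambda>z. U (\<kappa> (fst z)) (\<kappa> (snd z)))" by blast
  then show "\<exists>\<kappa> U. cell_map M \<kappa> \<and> (\<forall>k. U 0 k = 0 \<and> U k 0 = 0) \<and>
      L2_close (M \<Otimes>\<^sub>M M) \<epsilon> f (\<lambda>z. U (\<kappa> (fst z)) (\<kappa> (snd z)))"
    using L2_close_trans[OF g(2) 1(3)] by (intro exI[of _ \<kappa>] exI[of _ U]) auto
qed

lemma steppable_indicator:
  assumes "A \<in> sets M" "emeasure M A < \<infinity>"
  shows "steppable M (indicator A)"
  unfolding steppable_def
proof safe
  fix \<epsilon> :: real assume "\<epsilon> > 0"
  have "{x \<in> space M. (if x \<in> A then 1 else 0 :: nat) \<noteq> 0} = A"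
    using sets.sets_into_space[OF assms(1)] by auto
  with assms have "cell_map M (\<lambda>x. if x \<in> A then 1 else 0)"
    by (simp add: cell_map_def)
  moreover have "L2_close M \<epsilon> (indicator A) (\<lambda>x. real (if x \<in> A then 1 else 0))"
  proof -
    have *: "indicator A x - real (if x \<in> A then 1 else 0) = 0" for x by auto
    show ?thesis using \<open>\<epsilon> > 0\<close> unfolding L2_close_def * by (simp add: L2_norm_def)
  qed
  ultimately show "\<exists>\<kappa> V. cell_map M \<kappa> \<and> V 0 = 0 \<and> L2_close M \<epsilon> (indicator A) (\<lambda>x. V (\<kappa> x))"
    by (intro exI[of _ "\<lambda>x. if x \<in> A then 1 else 0"] exI[of _ real]) auto
qed

lemma steppable2_indicator_Times:
  assumes A: "A \<in> sets M" "emeasure M A < \<infinity>" and B: "B \<in> sets M" "emeasure M B < \<infinity>"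
  shows "steppable2 M (indicator (A \<times> B))"
  unfolding steppable2_def
proof safe
  fix \<epsilon> :: real assume "\<epsilon> > 0"
  \<comment> \<open>The two binary digits of the cell number record membership in \<open>A\<close>
    and in \<open>B\<close>: odd means in \<open>A\<close>, at least 2 means in \<open>B\<close>,
    and cell 0 is the outside of both.\<close>
  define \<kappa> :: "_ \<Rightarrow> nat" where "\<kappa> = (\<lambda>x. (if x \<in> A then 1 else 0) + (if x \<in> B then 2 else 0))"
  define U :: "nat \<Rightarrow> nat \<Rightarrow> real" where "U = (\<lambda>k l. if odd k \<and> l \<ge> 2 then 1 else 0)"
  have [measurable]: "\<kappa> \<in> measurable M (count_space UNIV)"
    unfolding \<kappa>_def using A B by measurable
  have "{x \<in> space M. \<kappa> x \<noteq> 0} \<subseteq> A \<union> B"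
    by (auto simp: \<kappa>_def split: if_splits)
  then have "emeasure M {x \<in> space M. \<kappa> x \<noteq> 0} \<le> emeasure M (A \<union> B)"
    using A B by (intro emeasure_mono) auto
  also have "\<dots> \<le> emeasure M A + emeasure M B"
    using A B by (intro emeasure_subadditive)
  also have "\<dots> < \<infinity>" using A B by auto
  finally have "cell_map M \<kappa>"
    by (simp add: cell_map_def)
  moreover have "U 0 k = 0" "U k 0 = 0" for k by (auto simp: U_def)
  moreover have "L2_close (M \<Otimes>\<^sub>M M) \<epsilon> (indicator (A \<times> B)) (\<lambda>z. U (\<kappa> (fst z)) (\<kappa> (snd z)))"
  proof -
    have *: "indicator (A \<times> B) z - U (\<kappa> (fst z)) (\<kappa> (snd z)) = 0" for z
      by (cases z) (auto simp: U_def \<kappa>_def)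
    show ?thesis using \<open>\<epsilon> > 0\<close> unfolding L2_close_def * by (simp add: L2_norm_def)
  qed
  ultimately show "\<exists>\<kappa> U. cell_map M \<kappa> \<and> (\<forall>k. U 0 k = 0 \<and> U k 0 = 0) \<and>
      L2_close (M \<Otimes>\<^sub>M M) \<epsilon> (indicator (A \<times> B)) (\<lambda>z. U (\<kappa> (fst z)) (\<kappa> (snd z)))"
    by blast
qed

text \<open>The set \<open>F\<close> of finite mass supplies the square integrable majorant for
  dominated convergence.\<close>

lemma steppable2_lim_indicator:
  assumes E: "\<And>i::nat. E i \<in> sets (M \<Otimes>\<^sub>M M)" "\<And>i. E i \<subseteq> F" and F: "F \<in> sets (M \<Otimes>\<^sub>M M)" "emeasure (M \<Otimes>\<^sub>M M) F < \<infinity>"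
    and inc: "incseq E" and st: "\<And>i. steppable2 M (indicator (E i))"
  shows "steppable2 M (indicator (\<Union>i. E i))"
proof (rule steppable2_lim)
  fix \<epsilon> :: real assume "\<epsilon> > 0"
  have m: "indicator (E i) \<in> borel_measurable (M \<Otimes>\<^sub>M M)" for i
    using E(1) by simp
  have m': "indicator (\<Union>i. E i) \<in> borel_measurable (M \<Otimes>\<^sub>M M)"
    using E(1) by auto
  have bnd: "\<bar>indicator (E i) x :: real\<bar> \<le> indicator F x" for i x
    using E(2)[of i] by (auto simp: indicator_def)
  note conv = L2_dominated_convergence[OF m m' sqint_indicator[OF F] bnd LIMSEQ_indicator_incseq[OF inc]]
  obtain i where "L2_norm (M \<Otimes>\<^sub>M M) (\<lambda>x. indicator (\<Union>i. E i) x - indicator (E i) x) < \<epsilon>"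
    using order_tendstoD(2)[OF conv(1) \<open>\<epsilon> > 0\<close>] by (auto simp: eventually_sequentially)
  then have "L2_close (M \<Otimes>\<^sub>M M) \<epsilon> (indicator (\<Union>i. E i)) (indicator (E i))"
    using conv(2) by (simp add: L2_close_def)
  with st show "\<exists>g. steppable2 M g \<and> L2_close (M \<Otimes>\<^sub>M M) \<epsilon> (indicator (\<Union>i. E i)) g"
    by blast
qed

text \<open>Complements usually have infinite mass, so the Dynkin argument runs inside a square
  \<open>C \<times> C\<close> of finite mass, where a complement becomes a difference of two
  indicators. Squares over an increasing exhaustion of the space then cover
  \<open>E\<close>.\<close>

lemma steppable2_indicator:
  assumes M: "sigma_finite_measure M" and E: "E \<in> sets (M \<Otimes>\<^sub>M M)" "emeasure (M \<Otimes>\<^sub>M M) E < \<infinity>"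
  shows "steppable2 M (indicator E)"
proof -
  interpret sigma_finite_measure M by fact
  let ?G = "{a \<times> b | a b. a \<in> sets M \<and> b \<in> sets M}"
  have gen: "sigma_sets (space M \<times> space M) ?G = sets (M \<Otimes>\<^sub>M M)"
    by (simp add: sets_pair_measure)
  have box: "steppable2 M (indicator (X \<inter> C \<times> C))"
    if C: "C \<in> sets M" "emeasure M C < \<infinity>" and X: "X \<in> sets (M \<Otimes>\<^sub>M M)" for C X
  proof -
    have CC: "C \<times> C \<in> sets (M \<Otimes>\<^sub>M M)" "emeasure (M \<Otimes>\<^sub>M M) (C \<times> C) < \<infinity>"
      using C by (auto simp: emeasure_pair_measure_Times ennreal_mult_less_top)
    have st0: "steppable2 M (indicator {})"
      using steppable2_indicator_Times[of "{}" M "{}"] by simp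
    have add: "steppable2 M (indicator (S \<union> T))"
      if "S \<inter> T = {}" "steppable2 M (indicator S)" "steppable2 M (indicator T)" for S T
    proof -
      have "(\<lambda>x. indicator S x + indicator T x :: real) = indicator (S \<union> T)"
        using that(1) by (auto simp: indicator_def fun_eq_iff)
      with steppable2_add[OF that(2,3)] show ?thesis by simp
    qed
    from X have "X \<in> sigma_sets (space M \<times> space M) ?G"
      by (simp add: gen)
    then show ?thesis
    proof (induction rule: sigma_sets_induct_disjoint[OF Int_stable_pair_measure_generator pair_measure_closed, consumes 1, case_names basic empty compl union])
      case (basic X)
      then obtain a b where X: "X = a \<times> b" and ab: "a \<in> sets M" "b \<in> sets M" by auto
      have "emeasure M (a \<inter> C) \<le> emeasure M C" "emeasure M (b \<inter> C) \<le> emeasure M C"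
        using C ab by (auto intro!: emeasure_mono)
      then have "emeasure M (a \<inter> C) < \<infinity>" "emeasure M (b \<inter> C) < \<infinity>"
        using C(2) by (auto elim: le_less_trans)
      then show ?case
        using steppable2_indicator_Times[of "a \<inter> C" M "b \<inter> C"] ab C(1) by (simp add: X Times_Int_Times)
    next
      case empty
      show ?case using st0 by (simp only: Int_empty_left)
    next
      case (compl X)
      have "C \<subseteq> space M" using C(1) by (rule sets.sets_into_space)
      then have "(\<lambda>x. indicator (C \<times> C) x + (-1) * indicator (X \<inter> C \<times> C) x :: real)
          = indicator ((space M \<times> space M - X) \<inter> C \<times> C)"
        by (auto simp: indicator_def fun_eq_iff)
      with steppable2_add[OF steppable2_indicator_Times[OF C C] steppable2_cmult[OF compl.IH, of "-1"]]
      show ?case by simp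
    next
      case (union A)
      have Am: "A i \<in> sets (M \<Otimes>\<^sub>M M)" for i
        using union by (auto simp: gen)
      \<comment> \<open>Partial unions turn the disjoint family into an increasing one; each step
        adds a set disjoint from the previous union.\<close>
      define E where "E n = (\<Union>i<n. A i) \<inter> C \<times> C" for n
      have "steppable2 M (indicator (E n))" for n
      proof (induction n)
        case 0
        have "E 0 = {}" by (simp add: E_def)
        then show ?case using st0 by (simp only:)
      next
        case (Suc n)
        have eq: "E (Suc n) = E n \<union> A n \<inter> C \<times> C"
          by (auto simp: E_def lessThan_Suc)
        have "E n \<inter> (A n \<inter> C \<times> C) = {}"
        proof -
          have "A i \<inter> A n = {}" if "i < n" for i
            using union(1) that by (auto simp: disjoint_family_on_def)
          then show ?thesis by (auto simp: E_def)
        qed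
        from add[OF this Suc union(3)[of n]] show ?case
          unfolding eq .
      qed
      moreover have "incseq E"
        by (force simp: incseq_def E_def)
      moreover have "E n \<in> sets (M \<Otimes>\<^sub>M M)" for n
        using Am CC by (auto simp: E_def)
      moreover have "E n \<subseteq> C \<times> C" for n by (auto simp: E_def)
      ultimately have "steppable2 M (indicator (\<Union>n. E n))"
        using CC by (intro steppable2_lim_indicator[where F="C \<times> C"])
      moreover have "(\<Union>n. E n) = (\<Union>i. A i) \<inter> C \<times> C"
        by (auto simp: E_def)
      ultimately show ?case by simp
    qed
  qed
  obtain C :: "nat \<Rightarrow> 'a set" where C: "range C \<subseteq> sets M" "(\<Union>i. C i) = space M"
    "\<And>i. emeasure M (C i) \<noteq> \<infinity>" "incseq C"
    using sigma_finite_incseq by blast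
  have "steppable2 M (indicator (\<Union>i. E \<inter> C i \<times> C i))"
  proof (rule steppable2_lim_indicator[where F=E])
    show "incseq (\<lambda>i. E \<inter> C i \<times> C i)"
      using C(4) by (force simp: incseq_def)
    show "steppable2 M (indicator (E \<inter> C i \<times> C i))" for i
      using C(1,3) E by (intro box) (auto simp: less_top)
    have "C i \<in> sets M" for i using C(1) by auto
    then show "E \<inter> C i \<times> C i \<in> sets (M \<Otimes>\<^sub>M M)" for i
      using E by auto
  qed (use E in auto)
  moreover have "(\<Union>i. E \<inter> C i \<times> C i) = E"
  proof -
    have "\<exists>i. z \<in> C i \<times> C i" if "z \<in> E" for z
    proof -
      have "fst z \<in> space M" "snd z \<in> space M"
        using that sets.sets_into_space[OF E(1)] by (auto simp: space_pair_measure)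
      then obtain i j where "fst z \<in> C i" "snd z \<in> C j"
        unfolding C(2)[symmetric] by blast
      \<comment> \<open>One square has to contain both coordinates; since \<open>C\<close>
        increases, the larger index works.\<close>
      then have "z \<in> C (max i j) \<times> C (max i j)"
        using C(4) incseqD[OF C(4), of i "max i j"] incseqD[OF C(4), of j "max i j"]
        by (auto simp: mem_Times_iff)
      then show ?thesis by blast
    qed
    then show ?thesis by auto
  qed
  ultimately show ?thesis by simp
qed

text \<open>Kernel and marginal must share one cell map, as a single coupling has to serve both. Two
  separate approximations are therefore put on the common refinement of their cells.\<close>

lemma step_approximation:
  assumes M: "sigma_finite_measure M" and W: "sqint (M \<Otimes>\<^sub>M M) (\<lambda>z. W (fst z) (snd z))" and D: "sqint M D"
    and "\<epsilon> > 0"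
  obtains \<kappa> U V where "cell_map M \<kappa>" "\<And>k. U 0 k = 0" "\<And>k. U k 0 = 0" "V 0 = 0"
    "L2_close (M \<Otimes>\<^sub>M M) \<epsilon> (\<lambda>z. W (fst z) (snd z)) (\<lambda>z. U (\<kappa> (fst z)) (\<kappa> (snd z)))"
    "L2_close M \<epsilon> D (\<lambda>x. V (\<kappa> x))"
proof -
  have "steppable M D"
    by (rule L2_dense[OF D steppable_indicator steppable_add steppable_cmult steppable_lim])
  then obtain \<kappa>1 V where 1: "cell_map M \<kappa>1" "V 0 = 0" "L2_close M \<epsilon> D (\<lambda>x. V (\<kappa>1 x))"
    using \<open>\<epsilon> > 0\<close> by (auto simp: steppable_def)
  have "steppable2 M (\<lambda>z. W (fst z) (snd z))"
    by (rule L2_dense[OF W steppable2_indicator[OF M] steppable2_add steppable2_cmult steppable2_lim])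
  then obtain \<kappa>2 U where 2: "cell_map M \<kappa>2" "\<And>k. U 0 k = 0 \<and> U k 0 = 0"
    "L2_close (M \<Otimes>\<^sub>M M) \<epsilon> (\<lambda>z. W (fst z) (snd z)) (\<lambda>z. U (\<kappa>2 (fst z)) (\<kappa>2 (snd z)))"
    using \<open>\<epsilon> > 0\<close> unfolding steppable2_def by blast
  show thesis
    by (rule that[OF cell_map_pair[OF 1(1) 2(1)],
          of "\<lambda>k l. U (snd (prod_decode k)) (snd (prod_decode l))" "\<lambda>k. V (fst (prod_decode k))"])
       (use prod_decode_0 1(2,3) 2(2,3) in simp_all)
qed

section \<open>Bilinear forms and conditional expectation\<close>

definition kbound :: "'a measure \<Rightarrow> ('a \<Rightarrow> 'a \<Rightarrow> real) \<Rightarrow> real \<Rightarrow> bool" where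
  "kbound M U c \<longleftrightarrow> (\<forall>f g. sqint M f \<longrightarrow> sqint M g \<longrightarrow>
     \<bar>\<integral>z. f (fst z) * U (fst z) (snd z) * g (snd z) \<partial>(M \<Otimes>\<^sub>M M)\<bar> \<le> c * (L2_norm M f * L2_norm M g))"

abbreviation sqker :: "'a measure \<Rightarrow> ('a \<Rightarrow> 'a \<Rightarrow> real) \<Rightarrow> bool" where
  "sqker M U \<equiv> sqint (M \<Otimes>\<^sub>M M) (\<lambda>z. U (fst z) (snd z))"

lemma kform_integrable:
  assumes "sigma_finite_measure M" "sqker M U" "sqint M f" "sqint M g"
  shows "integrable (M \<Otimes>\<^sub>M M) (\<lambda>z. f (fst z) * U (fst z) (snd z) * g (snd z))"
  using sqint_mult_integrable[OF assms(2) sqint_pair_mult(1)[OF assms(1,3,4)]]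
  by (simp add: ac_simps)

text \<open>Cauchy-Schwarz on the product space, with the tensor product of \<open>f\<close> and
  \<open>g\<close> as second factor.\<close>

lemma kbound_L2:
  assumes "sigma_finite_measure M" "sqker M U" "L2_norm (M \<Otimes>\<^sub>M M) (\<lambda>z. U (fst z) (snd z)) \<le> c"
  shows "kbound M U c"
  unfolding kbound_def
proof (intro allI impI)
  fix f g assume fg: "sqint M f" "sqint M g"
  note p = sqint_pair_mult[OF assms(1) fg]
  have "\<bar>\<integral>z. f (fst z) * U (fst z) (snd z) * g (snd z) \<partial>(M \<Otimes>\<^sub>M M)\<bar>
      = \<bar>\<integral>z. U (fst z) (snd z) * (f (fst z) * g (snd z)) \<partial>(M \<Otimes>\<^sub>M M)\<bar>"
    by (simp add: ac_simps)
  also have "\<dots> \<le> L2_norm (M \<Otimes>\<^sub>M M) (\<lambda>z. U (fst z) (snd z)) * (L2_norm M f * L2_norm M g)"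
    using L2_cauchy_schwarz[OF assms(2) p(1)] p(2) by simp
  also have "\<dots> \<le> c * (L2_norm M f * L2_norm M g)"
    by (intro mult_right_mono assms) auto
  finally show "\<bar>\<integral>z. f (fst z) * U (fst z) (snd z) * g (snd z) \<partial>(M \<Otimes>\<^sub>M M)\<bar>
      \<le> c * (L2_norm M f * L2_norm M g)" .
qed

lemma kbound_add:
  assumes M: "sigma_finite_measure M" and U: "sqker M U" "sqker M U'" and b: "kbound M U c" "kbound M U' c'"
  shows "kbound M (\<lambda>x y. U x y + U' x y) (c + c')"
  unfolding kbound_def
proof (intro allI impI)
  fix f g assume fg: "sqint M f" "sqint M g"
  have "(\<integral>z. f (fst z) * (U (fst z) (snd z) + U' (fst z) (snd z)) * g (snd z) \<partial>(M \<Otimes>\<^sub>M M))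
      = (\<integral>z. f (fst z) * U (fst z) (snd z) * g (snd z) \<partial>(M \<Otimes>\<^sub>M M))
        + (\<integral>z. f (fst z) * U' (fst z) (snd z) * g (snd z) \<partial>(M \<Otimes>\<^sub>M M))"
    using kform_integrable[OF M U(1) fg] kform_integrable[OF M U(2) fg]
    by (simp add: distrib_left distrib_right)
  moreover note abs_triangle_ineq[of "\<integral>z. f (fst z) * U (fst z) (snd z) * g (snd z) \<partial>(M \<Otimes>\<^sub>M M)"
      "\<integral>z. f (fst z) * U' (fst z) (snd z) * g (snd z) \<partial>(M \<Otimes>\<^sub>M M)"]
  moreover note b(1)[unfolded kbound_def, rule_format, OF fg] b(2)[unfolded kbound_def, rule_format, OF fg]
  ultimately show "\<bar>\<integral>z. f (fst z) * (U (fst z) (snd z) + U' (fst z) (snd z)) * g (snd z) \<partial>(M \<Otimes>\<^sub>M M)\<bar>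
      \<le> (c + c') * (L2_norm M f * L2_norm M g)"
    by (simp only: distrib_right)
qed

lemma kbound_uminus: "kbound M U c \<Longrightarrow> kbound M (\<lambda>x y. - U x y) c"
  by (simp add: kbound_def)

text \<open>Scaling passes from unit test functions to all others, and a change of sign of
  \<open>f\<close> supplies the absolute value. A space without unit test functions, where
  \<open>kernel_norm\<close> is minus infinity, needs no separate treatment.\<close>

lemma kernel_norm_le_iff:
  assumes M: "sigma_finite_measure M" and U: "sqker M U" and "0 \<le> c"
  shows "kernel_norm M U \<le> ereal c \<longleftrightarrow> kbound M U c"
proof
  assume k: "kernel_norm M U \<le> ereal c"
  let ?I = "\<lambda>f g. \<integral>z. f (fst z) * U (fst z) (snd z) * g (snd z) \<partial>(M \<Otimes>\<^sub>M M)"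
  have unit: "?I f g \<le> c" if "sqint M f" "sqint M g" "L2_norm M f = 1" "L2_norm M g = 1" for f g
  proof -
    have "ereal (?I f g) \<le> kernel_norm M U"
      unfolding kernel_norm_def using that by (intro Sup_upper) (auto simp: sqint_def)
    with k show ?thesis by (meson ereal_less_eq(3) order_trans)
  qed
  show "kbound M U c"
    unfolding kbound_def
  proof (intro allI impI)
    fix f g assume fg: "sqint M f" "sqint M g"
    have scale: "?I (\<lambda>x. a * f x) (\<lambda>x. b * g x) = a * b * ?I f g" for a b
    proof -
      have "?I (\<lambda>x. a * f x) (\<lambda>x. b * g x)
          = (\<integral>z. (a * b) * (f (fst z) * U (fst z) (snd z) * g (snd z)) \<partial>(M \<Otimes>\<^sub>M M))"
        by (simp add: ac_simps)
      then show ?thesis by simp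
    qed
    show "\<bar>?I f g\<bar> \<le> c * (L2_norm M f * L2_norm M g)"
    proof (cases "L2_norm M f = 0 \<or> L2_norm M g = 0")
      case True
      \<comment> \<open>A function of norm 0 cannot be normalised, but then the tensor product has
        norm 0 and Cauchy-Schwarz makes the form vanish.\<close>
      note p = sqint_pair_mult[OF M fg]
      have "L2_norm (M \<Otimes>\<^sub>M M) (\<lambda>z. f (fst z) * g (snd z)) = 0"
        using p(2) True by auto
      with L2_cauchy_schwarz[OF U p(1)]
      have "\<bar>\<integral>z. U (fst z) (snd z) * (f (fst z) * g (snd z)) \<partial>(M \<Otimes>\<^sub>M M)\<bar> \<le> 0" by simp
      then show ?thesis
        using True by (auto simp: ac_simps)
    next
      case False
      then have pos: "L2_norm M f > 0" "L2_norm M g > 0"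
        using L2_norm_nonneg[of M f] L2_norm_nonneg[of M g] by linarith+
      \<comment> \<open>The sign \<open>s\<close> is used with both values, which bounds the form
        from above and from below.\<close>
      have "s * (1 / L2_norm M f) * (1 / L2_norm M g) * ?I f g \<le> c" if "\<bar>s\<bar> = 1" for s
      proof -
        have "L2_norm M (\<lambda>x. (s * (1 / L2_norm M f)) * f x) = 1" "L2_norm M (\<lambda>x. (1 / L2_norm M g) * g x) = 1"
          using pos that by (simp_all only: L2_norm_cmult) (simp_all add: abs_mult)
        then show ?thesis
          by (subst scale[symmetric], intro unit sqint_cmult fg)
      qed
      from this[of 1] this[of "-1"] show ?thesis
        using pos by (simp add: field_simps abs_le_iff)
    qed
  qed
next
  assume b: "kbound M U c"
  have "(\<integral>z. f (fst z) * U (fst z) (snd z) * g (snd z) \<partial>(M \<Otimes>\<^sub>M M)) \<le> c"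
    if "sqint M f" "sqint M g" "L2_norm M f = 1" "L2_norm M g = 1" for f g
    using b[unfolded kbound_def, rule_format, OF that(1,2)] that(3,4) by (simp add: abs_le_iff)
  then show "kernel_norm M U \<le> ereal c"
    unfolding kernel_norm_def by (intro Sup_least) (auto simp: sqint_def)
qed

section \<open>Measure preserving maps and conditional expectation\<close>

lemma distr_pair_same:
  assumes "sigma_finite_measure Y" "T \<in> measurable Z Y" "distr Z Y T = Y"
  shows "distr (Z \<Otimes>\<^sub>M Z) (Y \<Otimes>\<^sub>M Y) (\<lambda>z. (T (fst z), T (snd z))) = Y \<Otimes>\<^sub>M Y"
  using pair_measure_distr[of T Z Y T Z Y] assms by (simp add: split_beta')

lemma sqker_vimage:
  assumes Y: "sigma_finite_measure Y" and T[measurable]: "T \<in> measurable Z Y" and d: "distr Z Y T = Y"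
    and U: "U \<in> borel_measurable (Y \<Otimes>\<^sub>M Y)"
  shows "sqint (Z \<Otimes>\<^sub>M Z) (\<lambda>z. U (T (fst z), T (snd z))) \<longleftrightarrow> sqint (Y \<Otimes>\<^sub>M Y) U"
    and "L2_norm (Z \<Otimes>\<^sub>M Z) (\<lambda>z. U (T (fst z), T (snd z))) = L2_norm (Y \<Otimes>\<^sub>M Y) U"
  using sqint_distr[of "\<lambda>z. (T (fst z), T (snd z))" "Z \<Otimes>\<^sub>M Z" "Y \<Otimes>\<^sub>M Y" U] U
  by (simp_all add: distr_pair_same[OF Y T d])

lemma sqint_vimage:
  assumes T[measurable]: "T \<in> measurable Z Y" and d: "distr Z Y T = Y" and f: "f \<in> borel_measurable Y"
  shows "sqint Z (\<lambda>z. f (T z)) \<longleftrightarrow> sqint Y f"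
    and "L2_norm Z (\<lambda>z. f (T z)) = L2_norm Y f"
  using sqint_distr[OF T f] d by simp_all

text \<open>The easy direction: test functions on \<open>Y\<close> are composed with
  \<open>T\<close>, with unchanged norms. It is used to descend from a glued space to the coupling
  of the outer spaces.\<close>

lemma kbound_image:
  assumes Y: "sigma_finite_measure Y" and T[measurable]: "T \<in> measurable Z Y" and d: "distr Z Y T = Y"
    and U: "sqker Y U" and b: "kbound Z (\<lambda>x y. U (T x) (T y)) c"
  shows "kbound Y U c"
  unfolding kbound_def
proof (intro allI impI)
  fix f g assume fg: "sqint Y f" "sqint Y g"
  note [measurable] = fg[THEN sqint_measurable] U[THEN sqint_measurable]
  have "(\<integral>z. f (fst z) * U (fst z) (snd z) * g (snd z) \<partial>(Y \<Otimes>\<^sub>M Y))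
      = (\<integral>z. f (fst z) * U (fst z) (snd z) * g (snd z) \<partial>(distr (Z \<Otimes>\<^sub>M Z) (Y \<Otimes>\<^sub>M Y) (\<lambda>z. (T (fst z), T (snd z)))))"
    by (simp add: distr_pair_same[OF Y T d])
  also have "\<dots> = (\<integral>z. f (T (fst z)) * U (T (fst z)) (T (snd z)) * g (T (snd z)) \<partial>(Z \<Otimes>\<^sub>M Z))"
    by (subst integral_distr) auto
  finally show "\<bar>\<integral>z. f (fst z) * U (fst z) (snd z) * g (snd z) \<partial>(Y \<Otimes>\<^sub>M Y)\<bar>
      \<le> c * (L2_norm Y f * L2_norm Y g)"
    using b[unfolded kbound_def, rule_format, of "\<lambda>z. f (T z)" "\<lambda>z. g (T z)"] fg
    by (simp add: sqint_vimage[OF T d])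
qed

text \<open>
  The \<open>L\<^sup>2\<close> bound for the density \<open>h\<close>: testing with a truncation \<open>\<phi>\<close> of \<open>h\<close> gives
  \<open>\<integral>\<phi>\<^sup>2 \<le> \<integral>h \<phi> = \<integral>f (\<phi> \<circ> T) \<le> (\<integral>f\<^sup>2 + \<integral>\<phi>\<^sup>2) / 2\<close>.
\<close>

lemma conditional_expectation_nonneg:
  fixes f :: "'z \<Rightarrow> real"
  assumes Y: "sigma_finite_measure Y" and T[measurable]: "T \<in> measurable Z Y" and d: "distr Z Y T = Y"
    and f: "sqint Z f" and pos: "\<And>x. 0 \<le> f x"
  shows "\<exists>h. sqint Y h \<and> (\<forall>\<phi>. sqint Y \<phi> \<longrightarrow> (\<integral>z. f z * \<phi> (T z) \<partial>Z) = (\<integral>y. h y * \<phi> y \<partial>Y))"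
proof -
  interpret sigma_finite_measure Y by fact
  have [measurable]: "f \<in> borel_measurable Z" using f by (rule sqint_measurable)
  \<comment> \<open>\<open>N\<close> is the image under \<open>T\<close> of the measure with density
    \<open>f\<close>. Its Radon-Nikodym density \<open>h0\<close> is at first only extended-valued;
    that it is finite almost everywhere comes out of the L2 bound.\<close>
  define N where "N = distr (density Z f) Y T"
  have N: "integral\<^sup>N N \<phi> = (\<integral>\<^sup>+z. ennreal (f z) * \<phi> (T z) \<partial>Z)" if [measurable]: "\<phi> \<in> borel_measurable Y" for \<phi>
    unfolding N_def by (subst nn_integral_distr) (auto simp: nn_integral_density)
  have "absolutely_continuous Y N"
    unfolding absolutely_continuous_def
  proof
    fix A assume "A \<in> null_sets Y"
    then have A: "A \<in> sets Y" "emeasure Y A = 0" by auto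
    have "AE y in distr Z Y T. y \<notin> A"
      unfolding d using A by (intro AE_not_in) auto
    then have ae: "AE z in Z. T z \<notin> A"
      by (rule AE_distrD[OF T])
    have "emeasure N A = integral\<^sup>N N (indicator A)"
      using A(1) by (simp add: N_def)
    also have "\<dots> = (\<integral>\<^sup>+z. ennreal (f z) * indicator A (T z) \<partial>Z)"
      using A by (intro N) auto
    also have "\<dots> = (\<integral>\<^sup>+z. 0 \<partial>Z)"
      using ae by (intro nn_integral_cong_AE) (auto elim!: eventually_mono)
    finally show "A \<in> null_sets N"
      using A(1) by (auto simp: N_def)
  qed
  then obtain h0 where [measurable]: "h0 \<in> borel_measurable Y" and h0: "density Y h0 = N"
    using Radon_Nikodym[of N] by (auto simp: N_def)
  have key: "(\<integral>\<^sup>+y. h0 y * \<phi> y \<partial>Y) = (\<integral>\<^sup>+z. ennreal (f z) * \<phi> (T z) \<partial>Z)"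
    if [measurable]: "\<phi> \<in> borel_measurable Y" for \<phi>
    using N[OF that] by (simp add: h0[symmetric] nn_integral_density)
  obtain C :: "nat \<Rightarrow> _ set" where C: "range C \<subseteq> sets Y" "(\<Union>i. C i) = space Y"
    "\<And>i. emeasure Y (C i) \<noteq> \<infinity>" "incseq C"
    using sigma_finite_incseq by blast
  have [measurable]: "C n \<in> sets Y" for n using C(1) by auto
  \<comment> \<open>Cut off in height and in support, so that the integral of the square is finite
    and can be cancelled from \<open>b + b \<le> b + a\<close> below.\<close>
  define \<phi> where "\<phi> n y = min (h0 y) (of_nat n) * indicator (C n) y" for n y
  have [measurable]: "\<phi> n \<in> borel_measurable Y" for n
    unfolding \<phi>_def by measurable
  define a where "a = (\<integral>\<^sup>+z. ennreal ((f z)\<^sup>2) \<partial>Z)"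
  have a: "a < \<infinity>"
    unfolding a_def using sqint_integrable[OF f] by (simp add: integrable_iff_bounded)
  have b: "(\<integral>\<^sup>+y. (\<phi> n y)\<^sup>2 \<partial>Y) \<le> a" for n
  proof -
    define b where "b = (\<integral>\<^sup>+y. (\<phi> n y)\<^sup>2 \<partial>Y)"
    have "b \<le> (\<integral>\<^sup>+y. (of_nat n)\<^sup>2 * indicator (C n) y \<partial>Y)"
      unfolding b_def by (intro nn_integral_mono)
        (auto simp: \<phi>_def indicator_def power2_eq_square intro!: mult_mono)
    also have "\<dots> < \<infinity>"
      using C(3)[of n] by (simp add: nn_integral_cmult_indicator ennreal_mult_less_top less_top power_less_top_ennreal of_nat_less_top)
    finally have fin: "b < \<infinity>" .
    have amgm: "2 * (ennreal u * v) \<le> ennreal (u\<^sup>2) + v\<^sup>2" if "0 \<le> u" for u v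
    proof (cases v)
      case (real r)
      have "2 * (u * r) \<le> u\<^sup>2 + r\<^sup>2"
        using sum_squares_bound[of u r] by simp
      then have "ennreal (2 * (u * r)) \<le> ennreal (u\<^sup>2 + r\<^sup>2)"
        by (rule ennreal_leI)
      then show ?thesis
        using real that by (simp add: ennreal_mult ennreal_power)
    qed simp
    have "2 * b \<le> 2 * (\<integral>\<^sup>+y. h0 y * \<phi> n y \<partial>Y)"
      unfolding b_def by (intro mult_left_mono nn_integral_mono)
        (auto simp: \<phi>_def indicator_def power2_eq_square intro!: mult_mono)
    also have "\<dots> = (\<integral>\<^sup>+z. 2 * (ennreal (f z) * \<phi> n (T z)) \<partial>Z)"
      by (subst key) (auto simp: nn_integral_cmult)
    also have "\<dots> \<le> (\<integral>\<^sup>+z. ennreal ((f z)\<^sup>2) + (\<phi> n (T z))\<^sup>2 \<partial>Z)"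
      by (intro nn_integral_mono amgm pos)
    also have "\<dots> = a + (\<integral>\<^sup>+z. (\<phi> n (T z))\<^sup>2 \<partial>Z)"
      unfolding a_def by (rule nn_integral_add) auto
    also have "(\<integral>\<^sup>+z. (\<phi> n (T z))\<^sup>2 \<partial>Z) = integral\<^sup>N (distr Z Y T) (\<lambda>y. (\<phi> n y)\<^sup>2)"
      by (subst nn_integral_distr) auto
    also have "\<dots> = b" by (simp add: d b_def)
    finally have "b + b \<le> b + a"
      by (simp add: mult_2 add.commute)
    then show ?thesis
      using fin by (auto simp: ennreal_add_left_cancel_le b_def)
  qed
  have inc: "incseq (\<lambda>n y. (\<phi> n y)\<^sup>2)"
  proof (intro incseq_SucI le_funI power_mono)
    fix n y
    have "indicator (C n) y \<le> (indicator (C (Suc n)) y :: ennreal)"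
      using incseqD[OF C(4), of n "Suc n"] by (auto simp: indicator_def)
    then show "\<phi> n y \<le> \<phi> (Suc n) y"
      unfolding \<phi>_def by (intro mult_mono min.mono) auto
  qed simp
  have sup: "(h0 y)\<^sup>2 \<le> (SUP n. (\<phi> n y)\<^sup>2)" if "y \<in> space Y" for y
  proof -
    obtain m where m: "y \<in> C m" using C(2) \<open>y \<in> space Y\<close> by auto
    have yC: "y \<in> C n" if "m \<le> n" for n
      using incseqD[OF C(4) that] m by auto
    show ?thesis
    proof (cases "h0 y")
      case (real r)
      obtain k :: nat where "r \<le> real k" using real_arch_simple by blast
      then have "h0 y \<le> of_nat (max m k)"
        unfolding real by (simp add: ennreal_of_nat_eq_real_of_nat max_def real)
      then have "\<phi> (max m k) y = h0 y"
        using yC[of "max m k"] by (simp add: \<phi>_def min_absorb1)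
      then show ?thesis by (metis SUP_upper UNIV_I)
    next
      case top
      have "of_nat n \<le> (SUP n. (\<phi> n y)\<^sup>2)" for n
      proof -
        have "(of_nat n :: ennreal) \<le> of_nat ((max m n)\<^sup>2)"
          by (rule of_nat_mono) (metis max.cobounded2 order_trans self_le_power zero_less_numeral le0 le_square power2_eq_square)
        also have "\<dots> = (\<phi> (max m n) y)\<^sup>2"
          using yC[of "max m n"] top by (simp add: \<phi>_def)
        finally show ?thesis by (meson SUP_upper2 UNIV_I)
      qed
      then have "(SUP n. (of_nat n :: ennreal)) \<le> (SUP n. (\<phi> n y)\<^sup>2)"
        by (intro SUP_least)
      then have "(SUP n. (\<phi> n y)\<^sup>2) = top"
        by (simp only: ennreal_SUP_of_nat_eq_top top_unique)
      then show ?thesis by (simp only: top_greatest)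
    qed
  qed
  have "(\<integral>\<^sup>+y. (h0 y)\<^sup>2 \<partial>Y) \<le> (\<integral>\<^sup>+y. (SUP n. (\<phi> n y)\<^sup>2) \<partial>Y)"
    by (intro nn_integral_mono sup)
  also have "\<dots> = (SUP n. \<integral>\<^sup>+y. (\<phi> n y)\<^sup>2 \<partial>Y)"
    using inc by (rule nn_integral_monotone_convergence_SUP) auto
  also have "\<dots> \<le> a"
    by (intro SUP_least b)
  finally have h0a: "(\<integral>\<^sup>+y. (h0 y)\<^sup>2 \<partial>Y) \<le> a" .
  then have "(\<integral>\<^sup>+y. (h0 y)\<^sup>2 \<partial>Y) \<noteq> \<infinity>"
    using a by (auto simp: top_unique)
  then have "AE y in Y. (h0 y)\<^sup>2 \<noteq> \<infinity>"
    by (intro nn_integral_PInf_AE) auto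
  then have h0fin: "AE y in Y. h0 y = ennreal (enn2real (h0 y))"
    by eventually_elim (auto simp: ennreal_enn2real_if power2_eq_square)
  define h where "h y = enn2real (h0 y)" for y
  have [measurable]: "h \<in> borel_measurable Y" unfolding h_def by measurable
  have h_pos: "0 \<le> h y" for y by (simp add: h_def)
  have "(\<integral>\<^sup>+y. ennreal ((h y)\<^sup>2) \<partial>Y) = (\<integral>\<^sup>+y. (h0 y)\<^sup>2 \<partial>Y)"
    using h0fin by (intro nn_integral_cong_AE) (auto simp: h_def ennreal_power[symmetric] elim!: eventually_mono)
  with h0a a have "(\<integral>\<^sup>+y. ennreal ((h y)\<^sup>2) \<partial>Y) < \<infinity>" by auto
  then have hsq: "sqint Y h"
    by (auto simp: sqint_def integrable_iff_bounded)
  have nonneg: "(\<integral>z. f z * \<phi> (T z) \<partial>Z) = (\<integral>y. h y * \<phi> y \<partial>Y)"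
    if [measurable]: "\<phi> \<in> borel_measurable Y" and \<phi>: "\<And>y. 0 \<le> \<phi> y" for \<phi>
  proof -
    have "(\<integral>\<^sup>+z. ennreal (f z * \<phi> (T z)) \<partial>Z) = (\<integral>\<^sup>+y. h0 y * ennreal (\<phi> y) \<partial>Y)"
      by (subst key) (auto simp: ennreal_mult pos \<phi>)
    also have "\<dots> = (\<integral>\<^sup>+y. ennreal (h y * \<phi> y) \<partial>Y)"
      using h0fin by (intro nn_integral_cong_AE) (auto simp: h_def ennreal_mult \<phi> elim!: eventually_mono)
    finally show ?thesis
      by (simp add: integral_eq_nn_integral pos \<phi> h_pos)
  qed
  have "(\<integral>z. f z * \<phi> (T z) \<partial>Z) = (\<integral>y. h y * \<phi> y \<partial>Y)" if \<phi>: "sqint Y \<phi>" for \<phi>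
  proof -
    have [measurable]: "\<phi> \<in> borel_measurable Y" using \<phi> by (rule sqint_measurable)
    define p q where "p y = max (\<phi> y) 0" and "q y = max (- \<phi> y) 0" for y
    have [measurable]: "p \<in> borel_measurable Y" "q \<in> borel_measurable Y"
      unfolding p_def q_def by measurable
    have pq: "sqint Y p" "sqint Y q"
      by (auto intro!: sqint_bound(1)[OF \<phi>] simp: p_def q_def)
    then have pqT: "sqint Z (\<lambda>z. p (T z))" "sqint Z (\<lambda>z. q (T z))"
      by (simp_all add: sqint_vimage[OF T d])
    have pq0: "0 \<le> p y" "0 \<le> q y" for y by (auto simp: p_def q_def)
    have "\<phi> y = p y - q y" for y by (auto simp: p_def q_def)
    then show ?thesis
      using nonneg[of p, OF _ pq0(1)] nonneg[of q, OF _ pq0(2)] sqint_mult_integrable[OF f pqT(1)] sqint_mult_integrable[OF f pqT(2)]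
        sqint_mult_integrable[OF hsq pq(1)] sqint_mult_integrable[OF hsq pq(2)]
      by (simp add: right_diff_distrib)
  qed
  with hsq show ?thesis by blast
qed

lemma conditional_expectation:
  fixes f :: "'z \<Rightarrow> real"
  assumes Y: "sigma_finite_measure Y" and T[measurable]: "T \<in> measurable Z Y" and d: "distr Z Y T = Y"
    and f: "sqint Z f"
  obtains h where "sqint Y h" "L2_norm Y h \<le> L2_norm Z f"
    "\<And>\<phi>. sqint Y \<phi> \<Longrightarrow> (\<integral>z. f z * \<phi> (T z) \<partial>Z) = (\<integral>y. h y * \<phi> y \<partial>Y)"
proof -
  have [measurable]: "f \<in> borel_measurable Z" using f by (rule sqint_measurable)
  define p q where "p y = max (f y) 0" and "q y = max (- f y) 0" for y
  have [measurable]: "p \<in> borel_measurable Z" "q \<in> borel_measurable Z"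
    unfolding p_def q_def by measurable
  have pq: "sqint Z p" "sqint Z q"
    by (auto intro!: sqint_bound(1)[OF f] simp: p_def q_def)
  have pos: "0 \<le> p z" "0 \<le> q z" for z by (auto simp: p_def q_def)
  obtain h1 where h1: "sqint Y h1" "\<And>\<phi>. sqint Y \<phi> \<Longrightarrow> (\<integral>z. p z * \<phi> (T z) \<partial>Z) = (\<integral>y. h1 y * \<phi> y \<partial>Y)"
    using conditional_expectation_nonneg[OF Y T d pq(1) pos(1)] by blast
  obtain h2 where h2: "sqint Y h2" "\<And>\<phi>. sqint Y \<phi> \<Longrightarrow> (\<integral>z. q z * \<phi> (T z) \<partial>Z) = (\<integral>y. h2 y * \<phi> y \<partial>Y)"
    using conditional_expectation_nonneg[OF Y T d pq(2) pos(2)] by blast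
  define h where "h y = h1 y - h2 y" for y
  have h: "sqint Y h" unfolding h_def using h1 h2 by (intro sqint_diff)
  have id: "(\<integral>z. f z * \<phi> (T z) \<partial>Z) = (\<integral>y. h y * \<phi> y \<partial>Y)" if \<phi>: "sqint Y \<phi>" for \<phi>
  proof -
    have \<phi>T: "sqint Z (\<lambda>z. \<phi> (T z))"
      using \<phi> by (simp add: sqint_vimage[OF T d] sqint_measurable)
    have "f z = p z - q z" for z by (auto simp: p_def q_def)
    then show ?thesis
      using h1(2)[OF \<phi>] h2(2)[OF \<phi>] sqint_mult_integrable[OF pq(1) \<phi>T] sqint_mult_integrable[OF pq(2) \<phi>T]
        sqint_mult_integrable[OF h1(1) \<phi>] sqint_mult_integrable[OF h2(1) \<phi>]
      by (simp add: left_diff_distrib h_def)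
  qed
  have hT: "sqint Z (\<lambda>z. h (T z))" "L2_norm Z (\<lambda>z. h (T z)) = L2_norm Y h"
    using h by (simp_all add: sqint_vimage[OF T d] sqint_measurable)
  \<comment> \<open>The two nonnegative parts give square integrability of \<open>h\<close>; the
    contraction with constant 1 comes from testing \<open>f\<close> with \<open>h\<close>
    itself.\<close>
  have "(L2_norm Y h)\<^sup>2 = (\<integral>z. f z * h (T z) \<partial>Z)"
    using id[OF h] by (simp only: L2_norm_power2) (simp add: power2_eq_square)
  also have "\<dots> \<le> L2_norm Z f * L2_norm Y h"
    using L2_cauchy_schwarz[OF f hT(1)] hT(2) by simp
  finally have "L2_norm Y h * L2_norm Y h \<le> L2_norm Z f * L2_norm Y h"
    by (simp add: power2_eq_square)
  then have "L2_norm Y h \<le> L2_norm Z f"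
    using L2_norm_nonneg[of Y h] L2_norm_nonneg[of Z f] by (metis mult_le_cancel_right order.antisym linorder_not_le)
  from that[OF h this id] show thesis .
qed

text \<open>The Hilbert-Schmidt operator of \<open>U\<close>, estimated by Cauchy-Schwarz in each
  section. The second claim allows almost every section of \<open>U\<close> as a test function in
  \<open>conditional_expectation\<close>.\<close>

lemma sqint_kernel_apply:
  assumes Y: "sigma_finite_measure Y" and U: "sqker Y U" and f: "sqint Y f"
  shows "sqint Y (\<lambda>y. \<integral>x. f x * U x y \<partial>Y)" and "AE y in Y. sqint Y (\<lambda>x. U x y)"
proof -
  interpret sigma_finite_measure Y by fact
  interpret pair_sigma_finite Y Y ..
  have Um: "(\<lambda>z. U (fst z) (snd z)) \<in> borel_measurable (Y \<Otimes>\<^sub>M Y)" using U by (rule sqint_measurable)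
  have fm[measurable]: "f \<in> borel_measurable Y" using f by (rule sqint_measurable)
  have [measurable]: "(\<lambda>z. U (snd z) (fst z)) \<in> borel_measurable (Y \<Otimes>\<^sub>M Y)"
    using measurable_compose[OF measurable_pair_swap' Um] by (simp add: split_beta')
  have i: "integrable (Y \<Otimes>\<^sub>M Y) (\<lambda>(x, y). (U x y)\<^sup>2)"
    using U by (simp add: sqint_def split_beta')
  have ae: "AE y in Y. integrable Y (\<lambda>x. (U x y)\<^sup>2)"
    using AE_integrable_snd[OF i] by simp
  have sec: "(\<lambda>x. U x y) \<in> borel_measurable Y" if "y \<in> space Y" for y
    using measurable_compose[OF measurable_Pair2'[OF that] Um] by simp
  show ae': "AE y in Y. sqint Y (\<lambda>x. U x y)"
    using ae AE_space by eventually_elim (auto simp: sqint_def sec)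
  let ?F = "\<lambda>y. \<integral>x. f x * U x y \<partial>Y"
  have Fm: "?F \<in> borel_measurable Y" by measurable
  have int: "integrable Y (\<lambda>y. (L2_norm Y f)\<^sup>2 * (\<integral>x. (U x y)\<^sup>2 \<partial>Y))"
    using integrable_snd[OF i] by simp
  have "AE y in Y. (?F y)\<^sup>2 \<le> (L2_norm Y f)\<^sup>2 * (\<integral>x. (U x y)\<^sup>2 \<partial>Y)"
    using ae'
  proof eventually_elim
    fix y assume s: "sqint Y (\<lambda>x. U x y)"
    have "\<bar>?F y\<bar>\<^sup>2 \<le> (L2_norm Y f * L2_norm Y (\<lambda>x. U x y))\<^sup>2"
      by (rule power_mono[OF L2_cauchy_schwarz[OF f s]]) simp
    then show "(?F y)\<^sup>2 \<le> (L2_norm Y f)\<^sup>2 * (\<integral>x. (U x y)\<^sup>2 \<partial>Y)"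
      by (simp add: power_mult_distrib L2_norm_power2)
  qed
  then have "integrable Y (\<lambda>y. (?F y)\<^sup>2)"
    using Fm by (intro Bochner_Integration.integrable_bound[OF int]) (auto elim!: eventually_mono)
  with Fm show "sqint Y ?F" by (simp add: sqint_def)
qed

text \<open>\<open>conditional_expectation\<close> treats one variable, so Fubini is applied in two
  rounds: \<open>f\<close> is replaced by \<open>hf\<close> against the sections of \<open>U\<close>
  at \<open>T w\<close>, and then \<open>g\<close> by \<open>hg\<close> against \<open>F\<close>.
  The norms of \<open>hf\<close> and \<open>hg\<close> are no larger than those of \<open>f\<close>
  and \<open>g\<close>.\<close>

lemma kbound_vimage:
  assumes Y: "sigma_finite_measure Y" and T[measurable]: "T \<in> measurable Z Y" and d: "distr Z Y T = Y"
    and U: "sqker Y U" and b: "kbound Y U c" and c: "0 \<le> c"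
  shows "kbound Z (\<lambda>x y. U (T x) (T y)) c"
  unfolding kbound_def
proof (intro allI impI)
  fix f g assume f: "sqint Z f" and g: "sqint Z g"
  interpret Y: sigma_finite_measure Y by fact
  have Z: "sigma_finite_measure Z"
    using Y d T by (metis sigma_finite_measure_distr)
  interpret Z: sigma_finite_measure Z by fact
  interpret ZZ: pair_sigma_finite Z Z ..
  interpret YY: pair_sigma_finite Y Y ..
  obtain hf where hf: "sqint Y hf" "L2_norm Y hf \<le> L2_norm Z f"
    "\<And>\<phi>. sqint Y \<phi> \<Longrightarrow> (\<integral>z. f z * \<phi> (T z) \<partial>Z) = (\<integral>y. hf y * \<phi> y \<partial>Y)"
    using conditional_expectation[OF Y T d f] by blast
  obtain hg where hg: "sqint Y hg" "L2_norm Y hg \<le> L2_norm Z g"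
    "\<And>\<phi>. sqint Y \<phi> \<Longrightarrow> (\<integral>z. g z * \<phi> (T z) \<partial>Z) = (\<integral>y. hg y * \<phi> y \<partial>Y)"
    using conditional_expectation[OF Y T d g] by blast
  define F where "F y = (\<integral>x. hf x * U x y \<partial>Y)" for y
  have F: "sqint Y F" and ae: "AE y in Y. sqint Y (\<lambda>x. U x y)"
    using sqint_kernel_apply[OF Y U hf(1)] by (simp_all add: F_def[abs_def])
  have UT: "sqker Z (\<lambda>x y. U (T x) (T y))"
    using sqker_vimage(1)[OF Y T d sqint_measurable[OF U]] U by simp
  \<comment> \<open>A null set of \<open>Y\<close> has a null preimage because \<open>T\<close>
    preserves the measure.\<close>
  have aeT: "AE w in Z. sqint Y (\<lambda>x. U x (T w))"
    using ae by (subst (asm) d[symmetric]) (rule AE_distrD[OF T])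
  have i1: "integrable (Z \<Otimes>\<^sub>M Z) (\<lambda>(x, y). f x * U (T x) (T y) * g y)"
    using kform_integrable[OF Z UT f g] by (simp add: split_beta')
  have i2: "integrable (Y \<Otimes>\<^sub>M Y) (\<lambda>(x, y). hf x * U x y * hg y)"
    using kform_integrable[OF Y U hf(1) hg(1)] by (simp add: split_beta')
  note [measurable] = F[THEN sqint_measurable] g[THEN sqint_measurable]
  have "(\<integral>z. f (fst z) * U (T (fst z)) (T (snd z)) * g (snd z) \<partial>(Z \<Otimes>\<^sub>M Z))
      = (\<integral>w. (\<integral>z. f z * U (T z) (T w) * g w \<partial>Z) \<partial>Z)"
    using ZZ.integral_snd[OF i1] by (simp add: split_beta')
  also have "\<dots> = (\<integral>w. g w * F (T w) \<partial>Z)"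
  proof (rule integral_cong_AE)
    show "(\<lambda>w. \<integral>z. f z * U (T z) (T w) * g w \<partial>Z) \<in> borel_measurable Z"
      using ZZ.integrable_snd[OF i1] by (rule borel_measurable_integrable)
    show "AE w in Z. (\<integral>z. f z * U (T z) (T w) * g w \<partial>Z) = g w * F (T w)"
      using aeT
    proof eventually_elim
      fix w assume "sqint Y (\<lambda>x. U x (T w))"
      from hf(3)[OF this] show "(\<integral>z. f z * U (T z) (T w) * g w \<partial>Z) = g w * F (T w)"
        by (simp add: F_def)
    qed
  qed measurable
  also have "\<dots> = (\<integral>y. hg y * F y \<partial>Y)"
    by (rule hg(3)[OF F])
  also have "\<dots> = (\<integral>y. (\<integral>x. hf x * U x y * hg y \<partial>Y) \<partial>Y)"
    by (simp add: F_def mult.commute)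
  also have "\<dots> = (\<integral>z. hf (fst z) * U (fst z) (snd z) * hg (snd z) \<partial>(Y \<Otimes>\<^sub>M Y))"
    using YY.integral_snd[OF i2] by (simp add: split_beta')
  finally have "\<bar>\<integral>z. f (fst z) * U (T (fst z)) (T (snd z)) * g (snd z) \<partial>(Z \<Otimes>\<^sub>M Z)\<bar>
      \<le> c * (L2_norm Y hf * L2_norm Y hg)"
    using b hf(1) hg(1) by (simp add: kbound_def)
  also have "\<dots> \<le> c * (L2_norm Z f * L2_norm Z g)"
    using hf(2) hg(2) c by (intro mult_left_mono mult_mono) auto
  finally show "\<bar>\<integral>z. f (fst z) * U (T (fst z)) (T (snd z)) * g (snd z) \<partial>(Z \<Otimes>\<^sub>M Z)\<bar>
      \<le> c * (L2_norm Z f * L2_norm Z g)" .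
qed

section \<open>Couplings\<close>

text \<open>
  Lay finite pieces of masses \<open>m\<^sub>0, m\<^sub>1, \<dots>\<close> end to end on the half line; \<open>h i\<close> is the share
  that falls into the interval \<open>[i, i + 1)\<close>.
\<close>

lemma unit_slices:
  assumes M: "sigma_finite_measure M" and B: "B \<in> sets M" "emeasure M B = \<infinity>"
  obtains h :: "nat \<Rightarrow> 'a \<Rightarrow> ennreal" where "\<And>i. h i \<in> borel_measurable M"
    "\<And>i x. h i x \<noteq> 0 \<Longrightarrow> x \<in> B"
    "AE x in M. (\<Sum>i. h i x) = indicator B x" "\<And>i. (\<integral>\<^sup>+x. h i x \<partial>M) = 1"
proof -
  interpret sigma_finite_measure M by fact
  obtain C :: "nat \<Rightarrow> 'a set" where C: "range C \<subseteq> sets M" "(\<Union>i. C i) = space M"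
    "\<And>i. emeasure M (C i) \<noteq> \<infinity>" "disjoint_family C"
    using sigma_finite_disjoint by blast
  have Cm: "C k \<in> sets M" for k using C(1) by auto
  define A where "A k = C k \<inter> B" for k
  have Am[measurable]: "A k \<in> sets M" for k using Cm B by (auto simp: A_def)
  have disj: "disjoint_family A"
    using C(4) by (auto simp: A_def disjoint_family_on_def)
  have AB: "(\<Union>k. A k) = B"
    using C(2) sets.sets_into_space[OF B(1)] by (auto simp: A_def)
  have Afin: "emeasure M (A k) \<noteq> \<infinity>" for k
  proof -
    have "emeasure M (A k) \<le> emeasure M (C k)"
      using Cm by (intro emeasure_mono) (auto simp: A_def)
    then show ?thesis using C(3)[of k] by (auto simp: top_unique)
  qed
  define m where "m k = measure M (A k)" for k
  have m: "emeasure M (A k) = ennreal (m k)" for k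
    using Afin[of k] by (simp add: m_def emeasure_eq_ennreal_measure)
  have m0: "0 \<le> m k" for k by (simp add: m_def)
  define s where "s k = sum m {..<k}" for k
  have s_Suc: "s (Suc k) = s k + m k" for k by (simp add: s_def)
  have s_inc: "s k \<le> s (Suc k)" for k using m0[of k] by (simp add: s_Suc)
  have s_mono: "incseq s" using s_inc by (rule incseq_SucI)
  \<comment> \<open>Here the infinite mass of \<open>B\<close> enters: the pieces cover the whole
    half line, so every unit interval is filled.\<close>
  have s_unbounded: "\<exists>k. r \<le> s k" for r :: real
  proof (rule ccontr)
    assume "\<nexists>k. r \<le> s k"
    then have r: "s k \<le> r" for k by (simp add: not_le less_imp_le)
    have "emeasure M B = (\<Sum>k. emeasure M (A k))"
      unfolding AB[symmetric] using Am disj by (intro suminf_emeasure[symmetric]) auto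
    also have "\<dots> = (SUP n. \<Sum>k<n. ennreal (m k))"
      by (simp add: m suminf_eq_SUP)
    also have "\<dots> \<le> ennreal r"
      using r m0 by (intro SUP_least) (simp add: sum_ennreal s_def ennreal_leI)
    finally show False using B(2) by (simp add: top_unique)
  qed
  \<comment> \<open>The length of the part of piece \<open>k\<close>, the interval from
    \<open>s k\<close> to \<open>s (Suc k)\<close>, that lies between \<open>i\<close> and
    \<open>i + 1\<close>. Written as a second difference, it telescopes in \<open>k\<close> as well
    as in \<open>i\<close>.\<close>
  define t where "t i k = (min (s (Suc k)) (real i + 1) - min (s k) (real i + 1))
      - (min (s (Suc k)) (real i) - min (s k) (real i))" for i k
  have t0: "0 \<le> t i k" for i k
    using s_inc[of k] by (simp add: t_def min_def)
  have s_ev: "eventually (\<lambda>k. r \<le> s k) sequentially" for r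
    using s_unbounded[of r] incseqD[OF s_mono] by (auto simp: eventually_sequentially intro: order_trans)
  have t_sums_k: "t i sums 1" for i
  proof -
    have "(\<lambda>k. min (s k) (real i + 1) - min (s k) (real i)) \<longlonglongrightarrow> 1"
      by (rule tendsto_eventually) (use s_ev[of "real i + 1"] in eventually_elim, auto)
    from telescope_sums[OF this] show ?thesis
      by (simp add: t_def[abs_def] s_def[of 0] algebra_simps)
  qed
  have t_sums_i: "(\<lambda>i. t i k) sums m k" for k
  proof -
    have s0: "0 \<le> s k" "0 \<le> s (Suc k)" using m0 unfolding s_def by (intro sum_nonneg; simp)+
    have "(\<lambda>i. min (s (Suc k)) (real i) - min (s k) (real i)) \<longlonglongrightarrow> m k"
    proof (rule tendsto_eventually)
      have "eventually (\<lambda>i. s (Suc k) \<le> real i) sequentially"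
        by (rule eventually_sequentiallyI[of "nat \<lceil>s (Suc k)\<rceil>"]) linarith
      then show "eventually (\<lambda>i. min (s (Suc k)) (real i) - min (s k) (real i) = m k) sequentially"
        by eventually_elim (use s_inc[of k] in \<open>auto simp: s_Suc min_def\<close>)
    qed
    from telescope_sums[OF this] show ?thesis
      using s0 by (simp add: t_def[abs_def] min_absorb2 algebra_simps)
  qed
  \<comment> \<open>The share \<open>t i k\<close> is spread evenly over \<open>A k\<close>. On a
    piece of mass 0 the quotient is 0 by the convention for division, so the slices do not add up to
    1 there; such pieces are dropped as null sets.\<close>
  define h where "h i x = (\<Sum>k. ennreal (t i k / m k) * indicator (A k) x)" for i x
  have pick: "(\<Sum>j. g j * indicator (A j) x) = (g k :: ennreal)" if "x \<in> A k" for g k x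
  proof -
    have "(\<Sum>j. g j * indicator (A j) x) = (\<Sum>j\<in>{k}. g j * indicator (A j) x)"
      using disj that by (intro suminf_finite) (auto simp: disjoint_family_on_def indicator_def)
    then show ?thesis using that by simp
  qed
  show thesis
  proof
    show "h i \<in> borel_measurable M" for i
      unfolding h_def by measurable
    show "x \<in> B" if "h i x \<noteq> 0" for i x
    proof (rule ccontr)
      assume "x \<notin> B"
      then have "x \<notin> A k" for k by (auto simp: A_def)
      then have "h i x = 0" by (simp add: h_def)
      with that show False by simp
    qed
    have "AE x in M. \<forall>k. m k = 0 \<longrightarrow> x \<notin> A k"
      unfolding AE_all_countable
    proof
      fix k show "AE x in M. m k = 0 \<longrightarrow> x \<notin> A k"
        by (cases "m k = 0") (use m[of k] in \<open>auto intro!: AE_not_in\<close>)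
    qed
    then show "AE x in M. (\<Sum>i. h i x) = indicator B x"
    proof eventually_elim
      fix x assume x: "\<forall>k. m k = 0 \<longrightarrow> x \<notin> A k"
      show "(\<Sum>i. h i x) = indicator B x"
      proof (cases "x \<in> B")
        case True
        then obtain k where k: "x \<in> A k" using AB by blast
        with x m0[of k] have mk: "0 < m k" by (cases "m k = 0") auto
        have "(\<Sum>i. h i x) = (\<Sum>i. ennreal (t i k / m k))"
          by (simp add: h_def pick[OF k])
        also have "\<dots> = ennreal (m k / m k)"
          using t0 mk sums_divide[OF t_sums_i[of k], of "m k"] by (intro suminf_ennreal_eq) (auto simp del: divide_self_if)
        finally show ?thesis using True mk by simp
      next
        case False
        then have "x \<notin> A k" for k by (auto simp: A_def)
        then show ?thesis using False by (simp add: h_def)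
      qed
    qed
    show "(\<integral>\<^sup>+x. h i x \<partial>M) = 1" for i
    proof -
      have piece: "ennreal (t i k / m k) * emeasure M (A k) = ennreal (t i k)" for k
      proof (cases "m k = 0")
        case True
        then have "s (Suc k) = s k" by (simp add: s_Suc)
        then show ?thesis using True by (simp add: t_def)
      next
        case False
        then show ?thesis using m0[of k] t0 by (simp add: m ennreal_mult[symmetric])
      qed
      have "(\<integral>\<^sup>+x. h i x \<partial>M) = (\<Sum>k. ennreal (t i k / m k) * emeasure M (A k))"
        unfolding h_def by (subst nn_integral_suminf) (auto simp: nn_integral_cmult_indicator)
      also have "\<dots> = (\<Sum>k. ennreal (t i k))"
        by (simp only: piece)
      also have "(\<Sum>k. ennreal (t i k)) = ennreal 1"
        using t0 t_sums_k by (intro suminf_ennreal_eq) auto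
      finally show ?thesis by simp
    qed
  qed
qed

text \<open>Three cases, since dividing by the mass of the cell makes sense only if it is neither 0
  nor infinite. On infinite cells the i-th slices of both sides are multiplied; each has integral 1,
  so integrating out one variable leaves the sum of the slices in the other.\<close>

lemma coupling_density_on_cells:
  fixes M :: "'a measure" and N :: "'b measure"
  assumes M: "sigma_finite_measure M" and N: "sigma_finite_measure N"
    and B: "B \<in> sets M" and B': "B' \<in> sets N" and eq: "emeasure M B = emeasure N B'"
  shows "\<exists>e :: 'a \<times> 'b \<Rightarrow> ennreal. e \<in> borel_measurable (M \<Otimes>\<^sub>M N) \<and>
     (\<forall>x y. e (x, y) \<noteq> 0 \<longrightarrow> x \<in> B \<and> y \<in> B') \<and>
     (AE x in M. (\<integral>\<^sup>+y. e (x, y) \<partial>N) = indicator B x) \<and>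
     (AE y in N. (\<integral>\<^sup>+x. e (x, y) \<partial>M) = indicator B' y)"
proof -
  consider "emeasure M B = 0" | "emeasure M B \<noteq> 0" "emeasure M B \<noteq> \<infinity>" | "emeasure M B = \<infinity>" by blast
  then show ?thesis
  proof cases
    case 1
    have "AE x in M. x \<notin> B" "AE y in N. y \<notin> B'"
      using 1 eq B B' by (auto intro!: AE_not_in)
    then show ?thesis
      by (intro exI[of _ "\<lambda>_. 0"]) (auto elim!: eventually_mono)
  next
    case 2
    define r where "r = inverse (emeasure M B)"
    have r: "r * emeasure M B = 1" "r * emeasure N B' = 1"
      using 2 eq by (simp_all add: r_def ennreal_inverse_mult mult.commute ennreal_divide_self[unfolded divide_ennreal_def] less_top)
    have 1: "(\<integral>\<^sup>+y. r * (indicator B x * indicator B' y) \<partial>N) = indicator B x" for x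
      using B' r(2) by (cases "x \<in> B") (simp_all add: nn_integral_cmult)
    have 2: "(\<integral>\<^sup>+x. r * (indicator B x * indicator B' y) \<partial>M) = indicator B' y" for y
      using B r(1) by (cases "y \<in> B'") (simp_all add: nn_integral_cmult)
    have "(\<lambda>z. r * (indicator B (fst z) * indicator B' (snd z))) \<in> borel_measurable (M \<Otimes>\<^sub>M N)"
      using B B' by measurable
    with 1 2 show ?thesis
      by (intro exI[of _ "\<lambda>z. r * (indicator B (fst z) * indicator B' (snd z))"])
         (auto simp: indicator_def split: if_splits)
  next
    case 3
    obtain h :: "nat \<Rightarrow> 'a \<Rightarrow> ennreal" where h[measurable]: "\<And>i. h i \<in> borel_measurable M" and hB: "\<And>i x. h i x \<noteq> 0 \<Longrightarrow> x \<in> B"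
      and hs: "AE x in M. (\<Sum>i. h i x) = indicator B x" and hi: "\<And>i. (\<integral>\<^sup>+x. h i x \<partial>M) = 1"
      using unit_slices[OF M B 3] by blast
    obtain g :: "nat \<Rightarrow> 'b \<Rightarrow> ennreal" where g[measurable]: "\<And>i. g i \<in> borel_measurable N" and gB: "\<And>i x. g i x \<noteq> 0 \<Longrightarrow> x \<in> B'"
      and gs: "AE x in N. (\<Sum>i. g i x) = indicator B' x" and gi: "\<And>i. (\<integral>\<^sup>+x. g i x \<partial>N) = 1"
      using unit_slices[OF N B' 3[unfolded eq]] by blast
    define e where "e z = (\<Sum>i. h i (fst z) * g i (snd z))" for z
    have em: "e \<in> borel_measurable (M \<Otimes>\<^sub>M N)"
      unfolding e_def by measurable
    have 1: "(\<integral>\<^sup>+y. e (x, y) \<partial>N) = (\<Sum>i. h i x)" for x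
      unfolding e_def by (subst nn_integral_suminf) (auto simp: nn_integral_cmult gi)
    have 2: "(\<integral>\<^sup>+x. e (x, y) \<partial>M) = (\<Sum>i. g i y)" for y
      unfolding e_def by (subst nn_integral_suminf) (auto simp: nn_integral_multc hi)
    have 3: "x \<in> B \<and> y \<in> B'" if "e (x, y) \<noteq> 0" for x y
    proof (rule ccontr)
      assume "\<not> (x \<in> B \<and> y \<in> B')"
      then have "h i x * g i y = 0" for i using hB[of i x] gB[of i y] by auto
      then have "e (x, y) = 0" by (simp only: e_def fst_conv snd_conv suminf_zero)
      with that show False by simp
    qed
    show ?thesis using em 1 2 3 hs gs by (intro exI[of _ e]) auto
  qed
qed

text \<open>The coupling has the sum of the densities of the single cells as density with respect to
  the product measure. Its partial integrals are sums of cell indicators, hence 1, and it is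
  positive only where the two cell numbers agree. No disintegration is involved.\<close>

lemma coupling_over_cells:
  fixes M :: "'a measure" and N :: "'b measure"
  assumes M: "sigma_finite_measure M" and N: "sigma_finite_measure N"
    and c[measurable]: "c \<in> measurable M (count_space UNIV)" and c'[measurable]: "c' \<in> measurable N (count_space UNIV)"
    and eq: "\<And>k::nat. emeasure M {x\<in>space M. c x = k} = emeasure N {y\<in>space N. c' y = k}"
  obtains P where "P \<in> couplings M N" "AE z in P. c (fst z) = c' (snd z)"
proof -
  interpret M: sigma_finite_measure M by fact
  interpret N: sigma_finite_measure N by fact
  interpret MN: pair_sigma_finite M N ..
  have "\<forall>k. \<exists>e. e \<in> borel_measurable (M \<Otimes>\<^sub>M N) \<and>
     (\<forall>x y. e (x, y) \<noteq> 0 \<longrightarrow> x \<in> {x\<in>space M. c x = k} \<and> y \<in> {y\<in>space N. c' y = k}) \<and>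
     (AE x in M. (\<integral>\<^sup>+y. e (x, y) \<partial>N) = indicator {x\<in>space M. c x = k} x) \<and>
     (AE y in N. (\<integral>\<^sup>+x. e (x, y) \<partial>M) = indicator {y\<in>space N. c' y = k} y)"
    by (intro allI coupling_density_on_cells[OF M N _ _ eq]) auto
  from choice[OF this] obtain e :: "nat \<Rightarrow> _ \<Rightarrow> ennreal" where *: "\<forall>k. e k \<in> borel_measurable (M \<Otimes>\<^sub>M N) \<and>
     (\<forall>x y. e k (x, y) \<noteq> 0 \<longrightarrow> x \<in> {x\<in>space M. c x = k} \<and> y \<in> {y\<in>space N. c' y = k}) \<and>
     (AE x in M. (\<integral>\<^sup>+y. e k (x, y) \<partial>N) = indicator {x\<in>space M. c x = k} x) \<and>
     (AE y in N. (\<integral>\<^sup>+x. e k (x, y) \<partial>M) = indicator {y\<in>space N. c' y = k} y)" ..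
  have e[measurable]: "e k \<in> borel_measurable (M \<Otimes>\<^sub>M N)"
    and supp: "e k (x, y) \<noteq> 0 \<Longrightarrow> c x = k \<and> c' y = k"
    and e1: "AE x in M. (\<integral>\<^sup>+y. e k (x, y) \<partial>N) = indicator {x\<in>space M. c x = k} x"
    and e2: "AE y in N. (\<integral>\<^sup>+x. e k (x, y) \<partial>M) = indicator {y\<in>space N. c' y = k} y" for k x y
    using *[rule_format, of k] by blast+
  define E where "E z = (\<Sum>k. e k z)" for z
  have E[measurable]: "E \<in> borel_measurable (M \<Otimes>\<^sub>M N)" unfolding E_def by measurable
  have total: "(\<Sum>k. indicator {x\<in>space L. f x = k} x) = (1 :: ennreal)" if "x \<in> space L" for L :: "'x measure" and f :: "'x \<Rightarrow> nat" and x
  proof -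
    have "(\<Sum>k. indicator {x\<in>space L. f x = k} x) = (\<Sum>k\<in>{f x}. indicator {x\<in>space L. f x = k} x :: ennreal)"
      by (rule suminf_finite) auto
    then show ?thesis using that by simp
  qed
  have E1: "AE x in M. (\<integral>\<^sup>+y. E (x, y) \<partial>N) = 1"
  proof -
    have "AE x in M. \<forall>k. (\<integral>\<^sup>+y. e k (x, y) \<partial>N) = indicator {x\<in>space M. c x = k} x"
      using e1 by (simp add: AE_all_countable)
    then show ?thesis
      using AE_space
    proof eventually_elim
      fix x assume x: "\<forall>k. (\<integral>\<^sup>+y. e k (x, y) \<partial>N) = indicator {x\<in>space M. c x = k} x" "x \<in> space M"
      have "(\<integral>\<^sup>+y. E (x, y) \<partial>N) = (\<Sum>k. \<integral>\<^sup>+y. e k (x, y) \<partial>N)"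
        unfolding E_def using x(2) by (subst nn_integral_suminf) auto
      also have "\<dots> = (\<Sum>k. indicator {x\<in>space M. c x = k} x)"
        using x(1) by simp
      also have "\<dots> = 1" using x(2) by (rule total)
      finally show "(\<integral>\<^sup>+y. E (x, y) \<partial>N) = 1" .
    qed
  qed
  have E2: "AE y in N. (\<integral>\<^sup>+x. E (x, y) \<partial>M) = 1"
  proof -
    have "AE x in N. \<forall>k. (\<integral>\<^sup>+y. e k (y, x) \<partial>M) = indicator {x\<in>space N. c' x = k} x"
      using e2 by (simp add: AE_all_countable)
    then show ?thesis
      using AE_space
    proof eventually_elim
      fix x assume x: "\<forall>k. (\<integral>\<^sup>+y. e k (y, x) \<partial>M) = indicator {x\<in>space N. c' x = k} x" "x \<in> space N"
      have "(\<integral>\<^sup>+y. E (y, x) \<partial>M) = (\<Sum>k. \<integral>\<^sup>+y. e k (y, x) \<partial>M)"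
        unfolding E_def using x(2) by (subst nn_integral_suminf) auto
      also have "\<dots> = (\<Sum>k. indicator {x\<in>space N. c' x = k} x)"
        using x(1) by simp
      also have "\<dots> = 1" using x(2) by (rule total)
      finally show "(\<integral>\<^sup>+y. E (y, x) \<partial>M) = 1" .
    qed
  qed
  define P where "P = density (M \<Otimes>\<^sub>M N) E"
  have sets_P[measurable_cong]: "sets P = sets (M \<Otimes>\<^sub>M N)" by (simp add: P_def)
  have "distr P M fst = M"
  proof (rule measure_eqI)
    fix A assume "A \<in> sets (distr P M fst)"
    then have A[measurable]: "A \<in> sets M" by simp
    have "emeasure (distr P M fst) A = (\<integral>\<^sup>+z. indicator A (fst z) \<partial>P)"
      by (subst nn_integral_indicator[symmetric], simp, subst nn_integral_distr) auto
    also have "\<dots> = (\<integral>\<^sup>+z. E z * indicator A (fst z) \<partial>(M \<Otimes>\<^sub>M N))"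
      unfolding P_def by (subst nn_integral_density) auto
    also have "\<dots> = (\<integral>\<^sup>+x. \<integral>\<^sup>+y. E (x, y) * indicator A x \<partial>N \<partial>M)"
      by (subst N.nn_integral_fst[symmetric]) auto
    also have "\<dots> = (\<integral>\<^sup>+x. (\<integral>\<^sup>+y. E (x, y) \<partial>N) * indicator A x \<partial>M)"
      by (intro nn_integral_cong nn_integral_multc) auto
    also have "\<dots> = (\<integral>\<^sup>+x. indicator A x \<partial>M)"
      using E1 by (intro nn_integral_cong_AE) (auto elim!: eventually_mono)
    finally show "emeasure (distr P M fst) A = emeasure M A" by simp
  qed simp
  moreover have "distr P N snd = N"
  proof (rule measure_eqI)
    fix A assume "A \<in> sets (distr P N snd)"
    then have A[measurable]: "A \<in> sets N" by simp
    have "emeasure (distr P N snd) A = (\<integral>\<^sup>+z. indicator A (snd z) \<partial>P)"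
      by (subst nn_integral_indicator[symmetric], simp, subst nn_integral_distr) auto
    also have "\<dots> = (\<integral>\<^sup>+z. E z * indicator A (snd z) \<partial>(M \<Otimes>\<^sub>M N))"
      unfolding P_def by (subst nn_integral_density) auto
    also have "\<dots> = (\<integral>\<^sup>+y. \<integral>\<^sup>+x. E (x, y) * indicator A y \<partial>M \<partial>N)"
      by (subst MN.nn_integral_snd[symmetric]) (auto simp: split_beta')
    also have "\<dots> = (\<integral>\<^sup>+y. (\<integral>\<^sup>+x. E (x, y) \<partial>M) * indicator A y \<partial>N)"
      by (intro nn_integral_cong nn_integral_multc) auto
    also have "\<dots> = (\<integral>\<^sup>+y. indicator A y \<partial>N)"
      using E2 by (intro nn_integral_cong_AE) (auto elim!: eventually_mono)
    finally show "emeasure (distr P N snd) A = emeasure N A" by simp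
  qed simp
  ultimately have "P \<in> couplings M N"
    by (simp add: couplings_def sets_P)
  moreover have "AE z in P. c (fst z) = c' (snd z)"
  proof -
    have "c (fst z) = c' (snd z)" if "0 < E z" for z
    proof (rule ccontr)
      assume ne: "c (fst z) \<noteq> c' (snd z)"
      have "e k z = 0" for k
        using supp[of k "fst z" "snd z"] ne by (metis prod.collapse)
      then have "E z = 0" by (simp add: E_def)
      with that show False by simp
    qed
    then show ?thesis
      unfolding P_def by (subst AE_density) auto
  qed
  ultimately show thesis by (rule that)
qed

section \<open>The metric for a fixed coupling\<close>

text \<open>The condition \<open>d22 \<le> c\<close> with the roots cleared, see
  \<open>d22_le_iff\<close>. Kernel, marginal and number are separate arguments, so that bounds can
  be added and transported without graphexes that realise them.\<close>

definition dbound :: "'a measure \<Rightarrow> ('a \<Rightarrow> 'a \<Rightarrow> real) \<Rightarrow> ('a \<Rightarrow> real) \<Rightarrow> real \<Rightarrow> real \<Rightarrow> bool" where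
  "dbound Z U D r c \<longleftrightarrow> 0 \<le> c \<and> kbound Z U c \<and> L2_norm Z D \<le> c\<^sup>2 \<and> \<bar>r\<bar> \<le> c ^ 3"

text \<open>The triangle inequality for kernel bounds, L2 norms and absolute values, combined with
  superadditivity of squares and cubes.\<close>

lemma dbound_add:
  assumes Z: "sigma_finite_measure Z" and U: "sqker Z U" "sqker Z U'" and D: "sqint Z D" "sqint Z D'"
    and b: "dbound Z U D r c" "dbound Z U' D' r' c'"
  shows "dbound Z (\<lambda>x y. U x y + U' x y) (\<lambda>x. D x + D' x) (r + r') (c + c')"
proof -
  have c: "0 \<le> c" "0 \<le> c'" using b by (auto simp: dbound_def)
  have "c\<^sup>2 + c'\<^sup>2 \<le> (c + c')\<^sup>2"
    using c by (simp add: power2_sum)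
  moreover have "c ^ 3 + c' ^ 3 \<le> (c + c') ^ 3"
  proof -
    have "(c + c') ^ 3 = c ^ 3 + c' ^ 3 + 3 * (c * c * c') + 3 * (c * c' * c')"
      by (simp add: power3_eq_cube algebra_simps)
    then show ?thesis using c by simp
  qed
  ultimately show ?thesis
    using b kbound_add[OF Z U, of c c'] L2_norm_add_le[OF D] by (auto simp: dbound_def)
qed

lemma dbound_uminus: "dbound Z U D r c \<Longrightarrow> dbound Z (\<lambda>x y. - U x y) (\<lambda>x. - D x) (- r) c"
  by (simp add: dbound_def kbound_uminus L2_norm_def)

lemma dbound_vimage:
  assumes Y: "sigma_finite_measure Y" and T: "T \<in> measurable Z Y" and d: "distr Z Y T = Y"
    and U: "sqker Y U" and D: "sqint Y D" and b: "dbound Y U D r c"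
  shows "dbound Z (\<lambda>x y. U (T x) (T y)) (\<lambda>x. D (T x)) r c"
  using kbound_vimage[OF Y T d U, of c] sqint_vimage(2)[OF T d sqint_measurable[OF D]] b
  by (simp add: dbound_def)

lemma dbound_image:
  assumes Y: "sigma_finite_measure Y" and T: "T \<in> measurable Z Y" and d: "distr Z Y T = Y"
    and U: "sqker Y U" and D: "sqint Y D" and b: "dbound Z (\<lambda>x y. U (T x) (T y)) (\<lambda>x. D (T x)) r c"
  shows "dbound Y U D r c"
  using kbound_image[OF Y T d U, of c] sqint_vimage(2)[OF T d sqint_measurable[OF D]] b
  by (simp add: dbound_def)

text \<open>The properties of a graphex on which the estimates rest, in a form that passes to
  trivial extensions (\<open>trivial_extension_good\<close>). Measurability of \<open>gS\<close>
  enters in the change of variables for \<open>rho\<close>.\<close>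

definition good_graphex :: "'a graphex \<Rightarrow> bool" where
  "good_graphex G \<longleftrightarrow> sigma_finite_measure (gspace G) \<and> sqker (gspace G) (gW G) \<and>
     gS G \<in> borel_measurable (gspace G) \<and> sqint (gspace G) (marginal G)"

lemma good_graphex_L1_L2:
  assumes "signed_graphex G" "graphex_L1_L2 G"
  shows "good_graphex G"
proof -
  let ?M = "gspace G"
  have M: "sigma_finite_measure ?M" and Wm: "(\<lambda>z. gW G (fst z) (snd z)) \<in> borel_measurable (?M \<Otimes>\<^sub>M ?M)"
    and Sm[measurable]: "gS G \<in> borel_measurable ?M"
    using assms(1) by (auto simp: signed_graphex_def split_beta')
  have W: "sqker ?M (gW G)"
    using assms(2) Wm by (auto simp: graphex_L1_L2_def in_L1_L2_def sqint_def split_beta')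
  interpret sigma_finite_measure ?M by fact
  have [measurable]: "case_prod (gW G) \<in> borel_measurable (?M \<Otimes>\<^sub>M ?M)"
    using Wm by (simp add: split_beta')
  have Dm[measurable]: "marginal G \<in> borel_measurable ?M"
    unfolding marginal_def[abs_def] by measurable
  \<comment> \<open>The marginal of the absolute graphex dominates. The estimate holds at every
    \<open>x\<close>, since the integral of a non-integrable section is 0 by convention.\<close>
  have le: "\<bar>marginal G x\<bar> \<le> \<bar>marginal (abs_graphex G) x\<bar>" for x
  proof -
    have "\<bar>marginal G x\<bar> \<le> \<bar>\<integral>y. gW G x y \<partial>?M\<bar> + \<bar>gS G x\<bar>"
      by (simp add: marginal_def abs_triangle_ineq)
    also have "\<dots> \<le> marginal (abs_graphex G) x"
      by (simp add: marginal_def abs_graphex_def)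
    finally show ?thesis by simp
  qed
  have "integrable ?M (\<lambda>x. (marginal (abs_graphex G) x)\<^sup>2)"
    using assms(2) by (simp add: graphex_L1_L2_def in_L1_L2_def)
  then have "integrable ?M (\<lambda>x. (marginal G x)\<^sup>2)"
    by (rule Bochner_Integration.integrable_bound) (use le in \<open>auto simp: abs_le_square_iff\<close>)
  with Dm M W Sm show ?thesis by (simp add: good_graphex_def sqint_def)
qed

lemma
  assumes G: "good_graphex G" and p[measurable]: "p \<in> measurable P (gspace G)" and d: "distr P (gspace G) p = gspace G"
  shows marginal_pullback: "z \<in> space P \<Longrightarrow> marginal (pullback p P G) z = marginal G (p z)"
    and rho_pullback: "rho (pullback p P G) = rho G"
proof -
  let ?M = "gspace G"
  have M: "sigma_finite_measure ?M" and W: "sqker ?M (gW G)" and [measurable]: "gS G \<in> borel_measurable ?M"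
    using G by (auto simp: good_graphex_def)
  note Wm[measurable] = W[THEN sqint_measurable]
  show "marginal (pullback p P G) z = marginal G (p z)" if z: "z \<in> space P"
  proof -
    have pz: "p z \<in> space ?M" using p z by (rule measurable_space)
    have "gW G (p z) \<in> borel_measurable ?M"
      using measurable_compose[OF measurable_Pair1'[OF pz] Wm] by simp
    then have "(\<integral>w. gW G (p z) (p w) \<partial>P) = (\<integral>y. gW G (p z) y \<partial>(distr P ?M p))"
      by (subst integral_distr) auto
    then show ?thesis by (simp add: marginal_def pullback_def d)
  qed
  have "(\<integral>z. gW G (p (fst z)) (p (snd z)) \<partial>(P \<Otimes>\<^sub>M P))
      = (\<integral>z. gW G (fst z) (snd z) \<partial>(distr (P \<Otimes>\<^sub>M P) (?M \<Otimes>\<^sub>M ?M) (\<lambda>z. (p (fst z), p (snd z)))))"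
    by (subst integral_distr) auto
  moreover have "(\<integral>z. gS G (p z) \<partial>P) = (\<integral>x. gS G x \<partial>(distr P ?M p))"
    by (subst integral_distr) auto
  ultimately show "rho (pullback p P G) = rho G"
    by (simp add: rho_def pullback_def distr_pair_same[OF M p d] d)
qed

section \<open>Couplings and near-optimal values of the infimum\<close>

lemma couplingsD:
  assumes "P \<in> couplings M N"
  shows "fst \<in> measurable P M" "snd \<in> measurable P N" "distr P M fst = M" "distr P N snd = N" "sets P = sets (M \<Otimes>\<^sub>M N)"
proof -
  show s: "sets P = sets (M \<Otimes>\<^sub>M N)" and "distr P M fst = M" "distr P N snd = N"
    using assms by (auto simp: couplings_def)
  show "fst \<in> measurable P M" "snd \<in> measurable P N"
    by (simp_all add: measurable_cong_sets[OF s refl])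
qed

text \<open>A measure with a sigma-finite image is sigma-finite: preimages of an exhaustion
  exhaust.\<close>

lemma couplings_sigma_finite:
  assumes "P \<in> couplings M N" "sigma_finite_measure M"
  shows "sigma_finite_measure P"
  using couplingsD[OF assms(1)] assms(2) by (metis sigma_finite_measure_distr)

abbreviation dW :: "'a graphex \<Rightarrow> 'b graphex \<Rightarrow> 'a \<times> 'b \<Rightarrow> 'a \<times> 'b \<Rightarrow> real" where
  "dW G H z w \<equiv> gW G (fst z) (fst w) - gW H (snd z) (snd w)"

abbreviation dD :: "'a graphex \<Rightarrow> 'b graphex \<Rightarrow> 'a \<times> 'b \<Rightarrow> real" where
  "dD G H z \<equiv> marginal G (fst z) - marginal H (snd z)"

lemma good_sqint_vimage:
  assumes G: "good_graphex G" and p: "p \<in> measurable P (gspace G)" and d: "distr P (gspace G) p = gspace G"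
  shows "sqker P (\<lambda>x y. gW G (p x) (p y))" "sqint P (\<lambda>x. marginal G (p x))"
proof -
  have M: "sigma_finite_measure (gspace G)" and W: "sqker (gspace G) (gW G)" and D: "sqint (gspace G) (marginal G)"
    using G by (auto simp: good_graphex_def)
  show "sqker P (\<lambda>x y. gW G (p x) (p y))"
    using sqker_vimage(1)[OF M p d sqint_measurable[OF W]] W by simp
  show "sqint P (\<lambda>x. marginal G (p x))"
    using sqint_vimage(1)[OF p d sqint_measurable[OF D]] D by simp
qed

lemma sqint_dW_dD:
  assumes G: "good_graphex G" and H: "good_graphex H" and P: "P \<in> couplings (gspace G) (gspace H)"
  shows "sqker P (dW G H)" "sqint P (dD G H)"
proof -
  note c = couplingsD[OF P]
  show "sqker P (dW G H)" "sqint P (dD G H)"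
    using good_sqint_vimage[OF G c(1,3)] good_sqint_vimage[OF H c(2,4)] by (auto intro: sqint_diff)
qed

lemma d22_le_iff:
  assumes G: "good_graphex G" and H: "good_graphex H" and P: "P \<in> couplings (gspace G) (gspace H)" and "0 \<le> c"
  shows "d22 (pullback fst P G) (pullback snd P H) \<le> ereal c \<longleftrightarrow> dbound P (dW G H) (dD G H) (rho G - rho H) c"
proof -
  note c = couplingsD[OF P]
  have sP: "sigma_finite_measure P"
    using P G by (auto simp: good_graphex_def intro: couplings_sigma_finite)
  have "L2_norm P (\<lambda>z. marginal (pullback fst P G) z - marginal (pullback snd P H) z) = L2_norm P (dD G H)"
    by (rule sqint_cong(2)) (simp add: marginal_pullback[OF G c(1,3)] marginal_pullback[OF H c(2,4)])
  moreover have "kernel_norm P (dW G H) \<le> ereal c \<longleftrightarrow> kbound P (dW G H) c"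
    by (rule kernel_norm_le_iff[OF sP sqint_dW_dD(1)[OF G H P] \<open>0 \<le> c\<close>])
  moreover have "sqrt x \<le> c \<longleftrightarrow> x \<le> c\<^sup>2" for x
    using \<open>0 \<le> c\<close> by (metis abs_of_nonneg real_sqrt_abs real_sqrt_le_iff)
  moreover have "root 3 x \<le> c \<longleftrightarrow> x \<le> c ^ 3" for x
    using \<open>0 \<le> c\<close> real_root_le_iff[of 3 x "c ^ 3"] real_root_power_cancel[of 3 c] by simp
  ultimately show ?thesis
    using \<open>0 \<le> c\<close>
    by (simp add: d22_def dbound_def rho_pullback[OF G c(1,3)] rho_pullback[OF H c(2,4)])
       (simp add: pullback_def)
qed

lemma d22_nonneg: "0 \<le> d22 G H"
  by (simp add: d22_def le_max_iff_disj)

lemma delta22_tilde_nonneg: "0 \<le> delta22_tilde G H"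
  unfolding delta22_tilde_def by (intro INF_greatest d22_nonneg)

lemma delta22_tilde_le:
  assumes "good_graphex G" "good_graphex H" "P \<in> couplings (gspace G) (gspace H)"
    and "dbound P (dW G H) (dD G H) (rho G - rho H) c"
  shows "delta22_tilde G H \<le> ereal c"
proof -
  have "0 \<le> c" using assms(4) by (simp add: dbound_def)
  with assms show ?thesis
    unfolding delta22_tilde_def by (intro INF_lower2[OF assms(3)]) (simp add: d22_le_iff)
qed

text \<open>The inequality is strict because the infimum over couplings need not be
  attained.\<close>

lemma delta22_tilde_lessD:
  assumes "good_graphex G" "good_graphex H" and l: "delta22_tilde G H < ereal c"
  obtains P where "P \<in> couplings (gspace G) (gspace H)" "dbound P (dW G H) (dD G H) (rho G - rho H) c"
proof -
  have "0 \<le> c"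
    using l delta22_tilde_nonneg[of G H] by (metis ereal_less_eq(5) less_imp_le order_trans)
  from l obtain P where P: "P \<in> couplings (gspace G) (gspace H)"
    "d22 (pullback fst P G) (pullback snd P H) < ereal c"
    unfolding delta22_tilde_def INF_less_iff by blast
  with \<open>0 \<le> c\<close> assms show thesis
    by (intro that[OF P(1)]) (simp add: d22_le_iff[symmetric] less_imp_le)
qed

section \<open>Gluing of couplings and the triangle inequality\<close>

lemma AE_pair_both:
  assumes M: "sigma_finite_measure M" and ae: "AE x in M. Q x"
  shows "AE z in M \<Otimes>\<^sub>M M. Q (fst z) \<and> Q (snd z)"
proof -
  interpret sigma_finite_measure M by fact
  from ae obtain N where N: "{x \<in> space M. \<not> Q x} \<subseteq> N" "N \<in> null_sets M"
    by (auto simp: eventually_ae_filter)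
  have "AE z in M \<Otimes>\<^sub>M M. z \<notin> N \<times> space M" "AE z in M \<Otimes>\<^sub>M M. z \<notin> space M \<times> N"
    by (rule AE_not_in, rule times_in_null_sets1[OF N(2)], simp)
       (rule AE_not_in, rule times_in_null_sets2[OF _ N(2)], simp)
  then show ?thesis
    using AE_space by eventually_elim (use N(1) in \<open>auto simp: space_pair_measure\<close>)
qed

text \<open>Where the cell numbers agree, the two step functions take the same value and cancel.
  What remains are two errors of size \<open>\<epsilon>\<close>, together at most
  \<open>2 * \<epsilon>\<close>; this is compared with \<open>\<eta>\<close> for the kernel and with
  \<open>\<eta>\<^sup>2\<close> for the marginal, whose norm stands under a square root in
  \<open>d22\<close>.\<close>

lemma dbound_cells:
  assumes M: "sigma_finite_measure M" and P: "P \<in> couplings M N" and N: "sigma_finite_measure N"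
    and W: "sqker M W" "sqker N W'" and D: "sqint M D" "sqint N D'"
    and ae: "AE z in P. c (fst z) = c' (snd z)"
    and Wc: "L2_close (M \<Otimes>\<^sub>M M) \<epsilon> (\<lambda>z. W (fst z) (snd z)) (\<lambda>z. U (c (fst z)) (c (snd z)))"
    and Wc': "L2_close (N \<Otimes>\<^sub>M N) \<epsilon> (\<lambda>z. W' (fst z) (snd z)) (\<lambda>z. U (c' (fst z)) (c' (snd z)))"
    and Dc: "L2_close M \<epsilon> D (\<lambda>z. V (c z))" and Dc': "L2_close N \<epsilon> D' (\<lambda>z. V (c' z))"
    and \<eta>: "2 * \<epsilon> \<le> \<eta>" "2 * \<epsilon> \<le> \<eta>\<^sup>2" "0 \<le> \<eta>"
  shows "dbound P (\<lambda>z w. W (fst z) (fst w) - W' (snd z) (snd w)) (\<lambda>z. D (fst z) - D' (snd z)) 0 \<eta>"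
proof -
  note cp = couplingsD[OF P]
  have sP: "sigma_finite_measure P" using P M by (rule couplings_sigma_finite)
  define A where "A p = W (fst p) (snd p) - U (c (fst p)) (c (snd p))" for p
  define B where "B p = W' (fst p) (snd p) - U (c' (fst p)) (c' (snd p))" for p
  have AB: "sqint (M \<Otimes>\<^sub>M M) A" "L2_norm (M \<Otimes>\<^sub>M M) A \<le> \<epsilon>" "sqint (N \<Otimes>\<^sub>M N) B" "L2_norm (N \<Otimes>\<^sub>M N) B \<le> \<epsilon>"
    using Wc Wc' by (auto simp: L2_close_def A_def[abs_def] B_def[abs_def])
  note vA = sqker_vimage[OF M cp(1,3) sqint_measurable[OF AB(1)]]
  note vB = sqker_vimage[OF N cp(2,4) sqint_measurable[OF AB(3)]]
  have sW: "sqker P (\<lambda>z w. W (fst z) (fst w))" "sqker P (\<lambda>z w. W' (snd z) (snd w))"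
    using sqker_vimage(1)[OF M cp(1,3) sqint_measurable[OF W(1)]]
      sqker_vimage(1)[OF N cp(2,4) sqint_measurable[OF W(2)]] W by simp_all
  have "L2_norm (P \<Otimes>\<^sub>M P) (\<lambda>z. W (fst (fst z)) (fst (snd z)) - W' (snd (fst z)) (snd (snd z)))
      = L2_norm (P \<Otimes>\<^sub>M P) (\<lambda>z. A (fst (fst z), fst (snd z)) - B (snd (fst z), snd (snd z)))"
  proof (rule L2_norm_cong_AE)
    show "AE z in P \<Otimes>\<^sub>M P. W (fst (fst z)) (fst (snd z)) - W' (snd (fst z)) (snd (snd z))
        = A (fst (fst z), fst (snd z)) - B (snd (fst z), snd (snd z))"
      using AE_pair_both[OF sP ae] by eventually_elim (simp add: A_def B_def)
    show "(\<lambda>z. A (fst (fst z), fst (snd z)) - B (snd (fst z), snd (snd z))) \<in> borel_measurable (P \<Otimes>\<^sub>M P)"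
      using vA(1) vB(1) AB by (auto intro: sqint_measurable)
    show "(\<lambda>z. W (fst (fst z)) (fst (snd z)) - W' (snd (fst z)) (snd (snd z))) \<in> borel_measurable (P \<Otimes>\<^sub>M P)"
      using sW by (auto intro: sqint_measurable)
  qed
  also have "\<dots> \<le> 2 * \<epsilon>"
    using L2_norm_diff_le[of "P \<Otimes>\<^sub>M P" "\<lambda>z. A (fst (fst z), fst (snd z))" "\<lambda>z. B (snd (fst z), snd (snd z))"] vA vB AB
    by simp
  finally have kb: "kbound P (\<lambda>z w. W (fst z) (fst w) - W' (snd z) (snd w)) \<eta>"
    using sqint_diff[OF sW] \<eta> by (intro kbound_L2[OF sP]) auto
  define A' where "A' p = D p - V (c p)" for p
  define B' where "B' p = D' p - V (c' p)" for p
  have AB': "sqint M A'" "L2_norm M A' \<le> \<epsilon>" "sqint N B'" "L2_norm N B' \<le> \<epsilon>"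
    using Dc Dc' by (auto simp: L2_close_def A'_def[abs_def] B'_def[abs_def])
  note vA' = sqint_vimage[OF cp(1,3) sqint_measurable[OF AB'(1)]]
  note vB' = sqint_vimage[OF cp(2,4) sqint_measurable[OF AB'(3)]]
  have sD: "sqint P (\<lambda>z. D (fst z))" "sqint P (\<lambda>z. D' (snd z))"
    using sqint_vimage(1)[OF cp(1,3) sqint_measurable[OF D(1)]]
      sqint_vimage(1)[OF cp(2,4) sqint_measurable[OF D(2)]] D by simp_all
  have "L2_norm P (\<lambda>z. D (fst z) - D' (snd z)) = L2_norm P (\<lambda>z. A' (fst z) - B' (snd z))"
  proof (rule L2_norm_cong_AE)
    show "AE z in P. D (fst z) - D' (snd z) = A' (fst z) - B' (snd z)"
      using ae by eventually_elim (simp add: A'_def B'_def)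
    show "(\<lambda>z. A' (fst z) - B' (snd z)) \<in> borel_measurable P"
      using vA'(1) vB'(1) AB' by (auto intro: sqint_measurable)
    show "(\<lambda>z. D (fst z) - D' (snd z)) \<in> borel_measurable P"
      using sD by (auto intro: sqint_measurable)
  qed
  also have "\<dots> \<le> 2 * \<epsilon>"
    using L2_norm_diff_le[of P "\<lambda>z. A' (fst z)" "\<lambda>z. B' (snd z)"] vA' vB' AB' by simp
  finally have "L2_norm P (\<lambda>z. D (fst z) - D' (snd z)) \<le> \<eta>\<^sup>2"
    using \<eta> by simp
  with kb show ?thesis using \<eta> by (simp add: dbound_def)
qed

lemma L2_close_vimage2:
  assumes M: "sigma_finite_measure M" and p: "p \<in> measurable P M" and d: "distr P M p = M"
    and "L2_close (M \<Otimes>\<^sub>M M) \<epsilon> (\<lambda>z. W (fst z) (snd z)) (\<lambda>z. U (c (fst z)) (c (snd z)))"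
  shows "L2_close (P \<Otimes>\<^sub>M P) \<epsilon> (\<lambda>z. W (p (fst z)) (p (snd z))) (\<lambda>z. U (c (p (fst z))) (c (p (snd z))))"
  using sqker_vimage[OF M p d, of "\<lambda>z. W (fst z) (snd z) - U (c (fst z)) (c (snd z))"] assms(4)
  by (auto simp: L2_close_def sqint_measurable)

lemma L2_close_vimage:
  assumes p: "p \<in> measurable P M" and d: "distr P M p = M" and "L2_close M \<epsilon> D (\<lambda>z. V (c z))"
  shows "L2_close P \<epsilon> (\<lambda>z. D (p z)) (\<lambda>z. V (c (p z)))"
  using sqint_vimage[OF p d, of "\<lambda>z. D z - V (c z)"] assms(3)
  by (auto simp: L2_close_def sqint_measurable)

text \<open>
  General measurable spaces admit no gluing of couplings along \<open>gspace G2\<close>; gluing along the cells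
  of a step approximation of \<open>G2\<close> is enough.
\<close>

lemma glue_couplings:
  assumes G: "good_graphex G1" "good_graphex G2" "good_graphex G3"
    and P: "P \<in> couplings (gspace G1) (gspace G2)" "dbound P (dW G1 G2) (dD G1 G2) (rho G1 - rho G2) a"
    and Q: "Q \<in> couplings (gspace G2) (gspace G3)" "dbound Q (dW G2 G3) (dD G2 G3) (rho G2 - rho G3) b"
    and "\<eta> > 0"
  obtains R where "R \<in> couplings (gspace G1) (gspace G3)"
    "dbound R (dW G1 G3) (dD G1 G3) (rho G1 - rho G3) (a + \<eta> + b)"
proof -
  define M1 M2 M3 where "M1 = gspace G1" and "M2 = gspace G2" and "M3 = gspace G3"
  note M_def = M1_def M2_def M3_def
  have s: "sigma_finite_measure M1" "sigma_finite_measure M2" "sigma_finite_measure M3"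
    and W2: "sqker M2 (gW G2)" and D2: "sqint M2 (marginal G2)"
    using G by (auto simp: good_graphex_def M_def)
  define \<epsilon> where "\<epsilon> = min (\<eta> / 2) (\<eta>\<^sup>2 / 2)"
  have \<epsilon>: "\<epsilon> > 0" "2 * \<epsilon> \<le> \<eta>" "2 * \<epsilon> \<le> \<eta>\<^sup>2" using \<open>\<eta> > 0\<close> by (auto simp: \<epsilon>_def)
  obtain \<kappa> U V where \<kappa>: "cell_map M2 \<kappa>"
    and WU: "L2_close (M2 \<Otimes>\<^sub>M M2) \<epsilon> (\<lambda>z. gW G2 (fst z) (snd z)) (\<lambda>z. U (\<kappa> (fst z)) (\<kappa> (snd z)))"
    and DV: "L2_close M2 \<epsilon> (marginal G2) (\<lambda>x. V (\<kappa> x))"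
    by (rule step_approximation[OF s(2) W2 D2 \<epsilon>(1)]) (rule that)
  note [measurable] = \<kappa>[THEN cell_map_measurable]
  note cP = couplingsD[OF P(1), folded M_def] and cQ = couplingsD[OF Q(1), folded M_def]
  have sP: "sigma_finite_measure P" and sQ: "sigma_finite_measure Q"
    using couplings_sigma_finite P(1) Q(1) s by (auto simp: M_def)
  note [measurable] = cP(1,2) cQ(1,2)
  \<comment> \<open>Both couplings project to the same measure on the second space, so cells pulled
    back from it have equal mass.\<close>
  have cells: "emeasure P {z\<in>space P. \<kappa> (snd z) = k} = emeasure Q {z\<in>space Q. \<kappa> (fst z) = k}" for k
  proof -
    have "emeasure P {z\<in>space P. \<kappa> (snd z) = k} = emeasure (distr P M2 snd) {x\<in>space M2. \<kappa> x = k}"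
      using measurable_space[OF cP(2)] by (subst emeasure_distr) (auto intro!: arg_cong[where f="emeasure P"])
    moreover have "emeasure Q {z\<in>space Q. \<kappa> (fst z) = k} = emeasure (distr Q M2 fst) {x\<in>space M2. \<kappa> x = k}"
      using measurable_space[OF cQ(1)] by (subst emeasure_distr) (auto intro!: arg_cong[where f="emeasure Q"])
    ultimately show ?thesis by (simp add: cP(4) cQ(3))
  qed
  \<comment> \<open>\<open>Z\<close> couples the couplings: its points consist of a pair from
    \<open>P\<close> and a pair from \<open>Q\<close>. The two middle points lie in the same cell
    but may differ.\<close>
  obtain Z where Z: "Z \<in> couplings P Q" and ae: "AE z in Z. \<kappa> (snd (fst z)) = \<kappa> (fst (snd z))"
  proof -
    have "(\<lambda>z. \<kappa> (snd z)) \<in> measurable P (count_space UNIV)" "(\<lambda>z. \<kappa> (fst z)) \<in> measurable Q (count_space UNIV)"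
      by measurable
    from coupling_over_cells[OF sP sQ this cells] that show thesis by blast
  qed
  note cZ = couplingsD[OF Z]
  have sZ: "sigma_finite_measure Z" using Z sP by (rule couplings_sigma_finite)
  note [measurable] = cZ(1,2)
  \<comment> \<open>Both middle points are forgotten.\<close>
  define T where "T z = (fst (fst z), snd (snd z))" for z :: "('a \<times> 'b) \<times> 'b \<times> 'c"
  have T[measurable]: "T \<in> measurable Z (M1 \<Otimes>\<^sub>M M3)" unfolding T_def by measurable
  define R where "R = distr Z (M1 \<Otimes>\<^sub>M M3) T"
  have "distr R M1 fst = M1"
  proof -
    have "distr R M1 fst = distr Z M1 (\<lambda>z. fst (fst z))"
      unfolding R_def by (subst distr_distr) (auto simp: T_def comp_def)
    also have "\<dots> = distr (distr Z P fst) M1 fst"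
      by (subst distr_distr) (auto simp: comp_def)
    finally show ?thesis by (simp add: cZ cP)
  qed
  moreover have "distr R M3 snd = M3"
  proof -
    have "distr R M3 snd = distr Z M3 (\<lambda>z. snd (snd z))"
      unfolding R_def by (subst distr_distr) (auto simp: T_def comp_def)
    also have "\<dots> = distr (distr Z Q snd) M3 snd"
      by (subst distr_distr) (auto simp: comp_def)
    finally show ?thesis by (simp add: cZ cQ)
  qed
  ultimately have R: "R \<in> couplings M1 M3"
    by (simp add: couplings_def R_def)
  have TR: "T \<in> measurable Z R" "distr Z R T = R"
  proof -
    show "T \<in> measurable Z R" using T by (simp add: R_def)
    show "distr Z R T = R" unfolding R_def by (rule distr_cong) auto
  qed
  \<comment> \<open>Going up from \<open>P\<close> and \<open>Q\<close> to \<open>Z\<close> relies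
    on conditional expectation; coming down to \<open>R\<close> at the end only restricts the test
    functions.\<close>
  have "dbound Z (\<lambda>z w. dW G1 G2 (fst z) (fst w)) (\<lambda>z. dD G1 G2 (fst z)) (rho G1 - rho G2) a"
    by (rule dbound_vimage[OF sP cZ(1,3) sqint_dW_dD[OF G(1,2) P(1)] P(2)])
  moreover have "dbound Z (\<lambda>z w. dW G2 G3 (snd z) (snd w)) (\<lambda>z. dD G2 G3 (snd z)) (rho G2 - rho G3) b"
    by (rule dbound_vimage[OF sQ cZ(2,4) sqint_dW_dD[OF G(2,3) Q(1)] Q(2)])
  \<comment> \<open>The cost of the imperfect gluing: the second graphex is compared with itself at
    two different points of one cell.\<close>
  moreover have "dbound Z (\<lambda>z w. gW G2 (snd (fst z)) (snd (fst w)) - gW G2 (fst (snd z)) (fst (snd w)))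
      (\<lambda>z. marginal G2 (snd (fst z)) - marginal G2 (fst (snd z))) 0 \<eta>"
    using \<open>\<eta> > 0\<close> \<epsilon> L2_close_vimage2[where W="gW G2" and U=U and c=\<kappa>, OF s(2) cP(2,4) WU]
      L2_close_vimage2[where W="gW G2" and U=U and c=\<kappa>, OF s(2) cQ(1,3) WU]
      L2_close_vimage[where V=V and c=\<kappa>, OF cP(2,4) DV] L2_close_vimage[where V=V and c=\<kappa>, OF cQ(1,3) DV]
      good_sqint_vimage[OF G(2) cP(2,4)[unfolded M_def]] good_sqint_vimage[OF G(2) cQ(1,3)[unfolded M_def]]
    by (intro dbound_cells[OF sP Z sQ _ _ _ _ ae]) auto
  moreover have "sqker Z (\<lambda>z w. dW G1 G2 (fst z) (fst w))" "sqint Z (\<lambda>z. dD G1 G2 (fst z))"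
    using sqker_vimage(1)[OF sP cZ(1,3) sqint_measurable[OF sqint_dW_dD(1)[OF G(1,2) P(1)]]]
      sqint_vimage(1)[OF cZ(1,3) sqint_measurable[OF sqint_dW_dD(2)[OF G(1,2) P(1)]]]
      sqint_dW_dD[OF G(1,2) P(1)] by simp_all
  moreover have "sqker Z (\<lambda>z w. dW G2 G3 (snd z) (snd w))" "sqint Z (\<lambda>z. dD G2 G3 (snd z))"
    using sqker_vimage(1)[OF sQ cZ(2,4) sqint_measurable[OF sqint_dW_dD(1)[OF G(2,3) Q(1)]]]
      sqint_vimage(1)[OF cZ(2,4) sqint_measurable[OF sqint_dW_dD(2)[OF G(2,3) Q(1)]]]
      sqint_dW_dD[OF G(2,3) Q(1)] by simp_all
  moreover have "sqker Z (\<lambda>z w. gW G2 (snd (fst z)) (snd (fst w)) - gW G2 (fst (snd z)) (fst (snd w)))"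
    "sqint Z (\<lambda>z. marginal G2 (snd (fst z)) - marginal G2 (fst (snd z)))"
  proof -
    note 1 = good_sqint_vimage[OF G(2) cP(2,4)[unfolded M_def]]
    note 2 = good_sqint_vimage[OF G(2) cQ(1,3)[unfolded M_def]]
    show "sqker Z (\<lambda>z w. gW G2 (snd (fst z)) (snd (fst w)) - gW G2 (fst (snd z)) (fst (snd w)))"
      using sqker_vimage(1)[OF sP cZ(1,3) sqint_measurable[OF 1(1)]]
        sqker_vimage(1)[OF sQ cZ(2,4) sqint_measurable[OF 2(1)]] 1 2 by (intro sqint_diff) auto
    show "sqint Z (\<lambda>z. marginal G2 (snd (fst z)) - marginal G2 (fst (snd z)))"
      using sqint_vimage(1)[OF cZ(1,3) sqint_measurable[OF 1(2)]]
        sqint_vimage(1)[OF cZ(2,4) sqint_measurable[OF 2(2)]] 1 2 by (intro sqint_diff) auto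
  qed
  \<comment> \<open>The three differences telescope, and what is left depends on the outer points
    only, that is on the image under \<open>T\<close>.\<close>
  ultimately have "dbound Z (\<lambda>z w. dW G1 G2 (fst z) (fst w) + (gW G2 (snd (fst z)) (snd (fst w)) - gW G2 (fst (snd z)) (fst (snd w)))
         + dW G2 G3 (snd z) (snd w))
      (\<lambda>z. dD G1 G2 (fst z) + (marginal G2 (snd (fst z)) - marginal G2 (fst (snd z))) + dD G2 G3 (snd z))
      (rho G1 - rho G2 + 0 + (rho G2 - rho G3)) (a + \<eta> + b)"
    by (intro dbound_add sZ sqint_add)
  then have "dbound Z (\<lambda>z w. dW G1 G3 (T z) (T w)) (\<lambda>z. dD G1 G3 (T z)) (rho G1 - rho G3) (a + \<eta> + b)"
    by (simp add: T_def)
  moreover have sR: "sigma_finite_measure R" using R s(1) by (rule couplings_sigma_finite)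
  ultimately have "dbound R (dW G1 G3) (dD G1 G3) (rho G1 - rho G3) (a + \<eta> + b)"
    using sqint_dW_dD[OF G(1,3) R[unfolded M_def]] by (intro dbound_image[OF sR TR])
  with R show thesis by (intro that) (auto simp: M_def)
qed

lemma delta22_tilde_triangle:
  assumes G: "good_graphex G1" "good_graphex G2" "good_graphex G3"
  shows "delta22_tilde G1 G3 \<le> delta22_tilde G1 G2 + delta22_tilde G2 G3"
proof (cases "delta22_tilde G1 G2 = \<infinity> \<or> delta22_tilde G2 G3 = \<infinity>")
  case True
  then show ?thesis by auto
next
  case False
  then obtain p q where pq: "delta22_tilde G1 G2 = ereal p" "delta22_tilde G2 G3 = ereal q"
    using delta22_tilde_nonneg[of G1 G2] delta22_tilde_nonneg[of G2 G3]
    by (cases "delta22_tilde G1 G2"; cases "delta22_tilde G2 G3") auto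
  show ?thesis
  proof (rule ereal_le_epsilon2)
    fix e :: real assume "e > 0"
    \<comment> \<open>One third for each of the two nearly optimal couplings and one third for the
      gluing.\<close>
    then have e3: "e / 3 > 0" by simp
    have "delta22_tilde G1 G2 < ereal (p + e / 3)" "delta22_tilde G2 G3 < ereal (q + e / 3)"
      using e3 by (simp_all add: pq)
    note less = this
    obtain P where
      P: "P \<in> couplings (gspace G1) (gspace G2)" "dbound P (dW G1 G2) (dD G1 G2) (rho G1 - rho G2) (p + e / 3)"
      by (rule delta22_tilde_lessD[OF G(1,2) less(1)])
    obtain Q where
      Q: "Q \<in> couplings (gspace G2) (gspace G3)" "dbound Q (dW G2 G3) (dD G2 G3) (rho G2 - rho G3) (q + e / 3)"
      by (rule delta22_tilde_lessD[OF G(2,3) less(2)])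
    from glue_couplings[OF G P Q e3] obtain R where "R \<in> couplings (gspace G1) (gspace G3)"
      "dbound R (dW G1 G3) (dD G1 G3) (rho G1 - rho G3) (p + e / 3 + e / 3 + (q + e / 3))" by blast
    from delta22_tilde_le[OF G(1,3) this]
    show "delta22_tilde G1 G3 \<le> delta22_tilde G1 G2 + delta22_tilde G2 G3 + ereal e"
      by (simp add: pq ac_simps)
  qed
qed

text \<open>Swapping coordinates carries couplings to couplings and changes the sign of every
  difference. A real \<open>c\<close> strictly between the two values is chosen because
  \<open>dbound\<close> takes real bounds.\<close>

lemma delta22_tilde_commute_le:
  assumes G: "good_graphex G" "good_graphex H"
  shows "delta22_tilde H G \<le> delta22_tilde G H"
proof (rule ccontr)
  assume "\<not> ?thesis"
  then have "delta22_tilde G H < delta22_tilde H G" by simp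
  then obtain c where c: "delta22_tilde G H < ereal c" "ereal c < delta22_tilde H G"
    using ereal_dense2 by blast
  obtain P where P: "P \<in> couplings (gspace G) (gspace H)" "dbound P (dW G H) (dD G H) (rho G - rho H) c"
    using delta22_tilde_lessD[OF G c(1)] by blast
  note cP = couplingsD[OF P(1)]
  note [measurable] = cP(1,2)
  have s: "sigma_finite_measure (gspace H)" using G by (simp add: good_graphex_def)
  define T where "T z = (snd z, fst z)" for z :: "'a \<times> 'b"
  have T[measurable]: "T \<in> measurable P (gspace H \<Otimes>\<^sub>M gspace G)" unfolding T_def by measurable
  define R where "R = distr P (gspace H \<Otimes>\<^sub>M gspace G) T"
  have "distr R (gspace H) fst = gspace H" "distr R (gspace G) snd = gspace G"
    unfolding R_def using cP(3,4) by (simp_all add: distr_distr T_def comp_def)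
  then have R: "R \<in> couplings (gspace H) (gspace G)"
    by (simp add: couplings_def R_def)
  have TR: "T \<in> measurable P R" "distr P R T = R"
  proof -
    show "T \<in> measurable P R" using T by (simp add: R_def)
    show "distr P R T = R" unfolding R_def by (rule distr_cong) auto
  qed
  have sR: "sigma_finite_measure R" using R s by (rule couplings_sigma_finite)
  have "dbound P (\<lambda>z w. dW H G (T z) (T w)) (\<lambda>z. dD H G (T z)) (rho H - rho G) c"
    using dbound_uminus[OF P(2)] by (simp add: T_def)
  then have "dbound R (dW H G) (dD H G) (rho H - rho G) c"
    by (rule dbound_image[OF sR TR sqint_dW_dD[OF G(2,1) R]])
  from delta22_tilde_le[OF G(2,1) R this] c(2) show False by simp
qed

section \<open>Trivial extensions\<close>

text \<open>This density is the restriction of \<open>N\<close> to \<open>A\<close>, kept on the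
  sigma-algebra of \<open>N\<close>. The image of the smaller space under the embedding appears in
  this form, and functions extended by 0 cannot tell it from \<open>N\<close>.\<close>

lemma
  assumes A[measurable]: "A \<in> sets N" and F[measurable]: "F \<in> borel_measurable N"
    and off: "\<And>y. y \<in> space N \<Longrightarrow> y \<notin> A \<Longrightarrow> F y = (0::real)"
  shows sqint_density_indicator: "sqint (density N (indicator A)) F \<longleftrightarrow> sqint N F"
    and L2_norm_density_indicator: "L2_norm (density N (indicator A)) F = L2_norm N F"
    and integral_density_indicator: "(\<integral>y. F y \<partial>density N (indicator A)) = (\<integral>y. F y \<partial>N)"
proof -
  have d: "density N (indicator A) = density N (\<lambda>y. ennreal (indicator A y :: real))"
    by (simp add: ennreal_indicator)
  have i: "indicator A y * F y = F y" "indicator A y * (F y)\<^sup>2 = (F y)\<^sup>2" if "y \<in> space N" for y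
    using off[OF that] by (auto simp: indicator_def)
  have "integrable (density N (indicator A)) (\<lambda>y. (F y)\<^sup>2) \<longleftrightarrow> integrable N (\<lambda>y. indicator A y * (F y)\<^sup>2)"
    unfolding d by (subst integrable_density) auto
  also have "\<dots> \<longleftrightarrow> integrable N (\<lambda>y. (F y)\<^sup>2)"
    by (rule Bochner_Integration.integrable_cong) (simp_all only: i)
  finally show "sqint (density N (indicator A)) F \<longleftrightarrow> sqint N F"
    by (simp add: sqint_def)
  have "(\<integral>y. (F y)\<^sup>2 \<partial>density N (indicator A)) = (\<integral>y. indicator A y * (F y)\<^sup>2 \<partial>N)"
    unfolding d by (subst integral_density) auto
  also have "\<dots> = (\<integral>y. (F y)\<^sup>2 \<partial>N)"
    by (rule Bochner_Integration.integral_cong) (simp_all only: i)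
  finally show "L2_norm (density N (indicator A)) F = L2_norm N F"
    by (simp add: L2_norm_def)
  have "(\<integral>y. F y \<partial>density N (indicator A)) = (\<integral>y. indicator A y * F y \<partial>N)"
    unfolding d by (subst integral_density) auto
  also have "\<dots> = (\<integral>y. F y \<partial>N)"
    by (rule Bochner_Integration.integral_cong) (simp_all only: i)
  finally show "(\<integral>y. F y \<partial>density N (indicator A)) = (\<integral>y. F y \<partial>N)" .
qed

locale space_embedding =
  fixes M :: "'a measure" and N :: "'b measure" and \<iota> :: "'a \<Rightarrow> 'b"
  assumes sigma_finite_M: "sigma_finite_measure M" and sigma_finite_N: "sigma_finite_measure N"
    and inj: "inj_on \<iota> (space M)"
    and image_sets[measurable]: "\<iota> ` space M \<in> sets N"
    and sets_eq: "(\<lambda>A. \<iota> ` A) ` sets M = {B \<in> sets N. B \<subseteq> \<iota> ` space M}"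
    and emeasure_image: "\<And>A. A \<in> sets M \<Longrightarrow> emeasure M A = emeasure N (\<iota> ` A)"
begin

lemma image_in_sets: "A \<in> sets M \<Longrightarrow> \<iota> ` A \<in> sets N"
  using sets_eq by blast

lemma measurable_embedding[measurable]: "\<iota> \<in> measurable M N"
proof (rule measurableI)
  show "\<iota> x \<in> space N" if "x \<in> space M" for x
    using sets.sets_into_space[OF image_sets] that by auto
  fix B assume B: "B \<in> sets N"
  have "B \<inter> \<iota> ` space M \<in> {B \<in> sets N. B \<subseteq> \<iota> ` space M}"
    using B image_sets by auto
  then obtain A where A: "A \<in> sets M" "B \<inter> \<iota> ` space M = \<iota> ` A"
    unfolding sets_eq[symmetric] by blast
  have "\<iota> -` B \<inter> space M = A"
  proof -
    have "A \<subseteq> space M" using A(1) by (rule sets.sets_into_space)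
    then show ?thesis
      using A(2) inj by (auto simp: inj_on_def image_iff set_eq_iff) (metis (no_types, lifting) subsetD)+
  qed
  with A show "\<iota> -` B \<inter> space M \<in> sets M" by simp
qed

lemma distr_embedding: "distr M N \<iota> = density N (indicator (\<iota> ` space M))"
proof (rule measure_eqI)
  fix B assume "B \<in> sets (distr M N \<iota>)"
  then have B[measurable]: "B \<in> sets N" by simp
  have "emeasure (distr M N \<iota>) B = emeasure N (\<iota> ` (\<iota> -` B \<inter> space M))"
    by (simp add: emeasure_distr emeasure_image)
  also have "\<iota> ` (\<iota> -` B \<inter> space M) = \<iota> ` space M \<inter> B" by auto
  also have "emeasure N \<dots> = emeasure (density N (indicator (\<iota> ` space M))) B"
    by (simp add: emeasure_density indicator_inter_arith[symmetric])
  finally show "emeasure (distr M N \<iota>) B = emeasure (density N (indicator (\<iota> ` space M))) B" .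
qed simp

text \<open>Images of sigma-finite measures can fail to be sigma-finite; here the image has a
  finite-valued density with respect to \<open>N\<close>.\<close>

lemma sigma_finite_distr_embedding: "sigma_finite_measure (distr M N \<iota>)"
proof -
  interpret N: sigma_finite_measure N by (rule sigma_finite_N)
  show ?thesis
    unfolding distr_embedding by (subst N.sigma_finite_iff_density_finite) (auto simp: indicator_def)
qed

lemma distr_embedding_pair:
  "distr (M \<Otimes>\<^sub>M M) (N \<Otimes>\<^sub>M N) (\<lambda>z. (\<iota> (fst z), \<iota> (snd z)))
    = density (N \<Otimes>\<^sub>M N) (indicator (\<iota> ` space M \<times> \<iota> ` space M))"
proof -
  interpret N: sigma_finite_measure N by (rule sigma_finite_N)
  have "distr (M \<Otimes>\<^sub>M M) (N \<Otimes>\<^sub>M N) (\<lambda>z. (\<iota> (fst z), \<iota> (snd z))) = distr M N \<iota> \<Otimes>\<^sub>M distr M N \<iota>"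
    using pair_measure_distr[OF measurable_embedding measurable_embedding sigma_finite_distr_embedding]
    by (simp add: split_beta')
  also have "\<dots> = density (N \<Otimes>\<^sub>M N) (\<lambda>(x, y). indicator (\<iota> ` space M) x * indicator (\<iota> ` space M) y)"
    using sigma_finite_distr_embedding unfolding distr_embedding
    by (intro pair_measure_density) (auto intro: sigma_finite_N)
  also have "(\<lambda>(x, y). indicator (\<iota> ` space M) x * indicator (\<iota> ` space M) y :: ennreal)
      = indicator (\<iota> ` space M \<times> \<iota> ` space M)"
    by (auto simp: indicator_def fun_eq_iff)
  finally show ?thesis .
qed

lemma measurable_extend:
  assumes f[measurable]: "f \<in> measurable M K" and g: "\<And>x. x \<in> space M \<Longrightarrow> g (\<iota> x) = f x"
    and off: "\<And>y. y \<in> space N \<Longrightarrow> y \<notin> \<iota> ` space M \<Longrightarrow> g y = z" and z: "z \<in> space K"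
  shows "g \<in> measurable N K"
proof (rule measurableI)
  show "g y \<in> space K" if "y \<in> space N" for y
    using off[OF that] z g measurable_space[OF f] by (cases "y \<in> \<iota> ` space M") auto
  fix A assume [measurable]: "A \<in> sets K"
  have "g -` A \<inter> space N = \<iota> ` (f -` A \<inter> space M) \<union> (if z \<in> A then space N - \<iota> ` space M else {})"
  proof (rule set_eqI)
    fix y
    show "y \<in> g -` A \<inter> space N \<longleftrightarrow> y \<in> \<iota> ` (f -` A \<inter> space M) \<union> (if z \<in> A then space N - \<iota> ` space M else {})"
    proof (cases "y \<in> \<iota> ` space M")
      case True
      then obtain x where x: "x \<in> space M" "y = \<iota> x" by blast
      then have "y \<in> space N" using sets.sets_into_space[OF image_sets] by blast
      moreover have "\<iota> x \<in> \<iota> ` (f -` A \<inter> space M) \<longleftrightarrow> f x \<in> A"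
        using inj_on_image_mem_iff[OF inj x(1), of "f -` A \<inter> space M"] x(1) by auto
      ultimately show ?thesis using g[OF x(1)] x True by auto
    next
      case False
      then show ?thesis using off[of y] by auto
    qed
  qed
  also have "\<dots> \<in> sets N"
    using image_in_sets[of "f -` A \<inter> space M"] by auto
  finally show "g -` A \<inter> space N \<in> sets N" .
qed

text \<open>Preimages in the product cannot be described cell by cell as in one variable. Instead
  \<open>F\<close> is written as an indicator times \<open>f\<close> composed with a measurable
  retraction in each coordinate.\<close>

lemma measurable_extend_pair:
  fixes F :: "'b \<times> 'b \<Rightarrow> real"
  assumes f: "f \<in> borel_measurable (M \<Otimes>\<^sub>M M)"
    and F: "\<And>x y. x \<in> space M \<Longrightarrow> y \<in> space M \<Longrightarrow> F (\<iota> x, \<iota> y) = f (x, y)"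
    and off: "\<And>z. z \<in> space (N \<Otimes>\<^sub>M N) \<Longrightarrow> z \<notin> \<iota> ` space M \<times> \<iota> ` space M \<Longrightarrow> F z = 0"
  shows "F \<in> borel_measurable (N \<Otimes>\<^sub>M N)"
proof (cases "space M = {}")
  case True
  then show ?thesis
    using off by (subst measurable_cong[where g="\<lambda>_. 0"]) auto
next
  case False
  then obtain x0 where x0: "x0 \<in> space M" by blast
  \<comment> \<open>A retraction of \<open>N\<close> onto \<open>M\<close>. The value
    \<open>x0\<close> outside the image is arbitrary, since the indicator removes it; its existence
    requires \<open>M\<close> nonempty.\<close>
  define r where "r y = (if y \<in> \<iota> ` space M then inv_into (space M) \<iota> y else x0)" for y
  have r: "r (\<iota> x) = x" if "x \<in> space M" for x
    using that inj by (simp add: r_def inv_into_f_f)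
  have [measurable]: "r \<in> measurable N M"
    by (rule measurable_extend[where f="\<lambda>x. x"]) (use r x0 in \<open>auto simp: r_def\<close>)
  have "(\<lambda>z. indicator (\<iota> ` space M \<times> \<iota> ` space M) z * f (r (fst z), r (snd z))) \<in> borel_measurable (N \<Otimes>\<^sub>M N)"
    using f by measurable
  moreover have "indicator (\<iota> ` space M \<times> \<iota> ` space M) z * f (r (fst z), r (snd z)) = F z"
    if "z \<in> space (N \<Otimes>\<^sub>M N)" for z
  proof (cases "z \<in> \<iota> ` space M \<times> \<iota> ` space M")
    case True
    then obtain x y where "z = (\<iota> x, \<iota> y)" "x \<in> space M" "y \<in> space M" by auto
    then show ?thesis using F r by simp
  qed (simp add: off that)
  ultimately show ?thesis by (subst measurable_cong[symmetric]) auto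
qed

lemma sqint_extend:
  assumes F: "F \<in> borel_measurable N" and off: "\<And>y. y \<in> space N \<Longrightarrow> y \<notin> \<iota> ` space M \<Longrightarrow> F y = 0"
  shows "sqint N F \<longleftrightarrow> sqint M (\<lambda>x. F (\<iota> x))" "L2_norm N F = L2_norm M (\<lambda>x. F (\<iota> x))"
    "(\<integral>y. F y \<partial>N) = (\<integral>x. F (\<iota> x) \<partial>M)"
  using sqint_density_indicator[OF image_sets F off] L2_norm_density_indicator[OF image_sets F off]
    integral_density_indicator[OF image_sets F off]
    sqint_distr[OF measurable_embedding F] integral_distr[OF measurable_embedding F]
  by (simp_all add: distr_embedding)

lemma sqint_extend_pair:
  assumes F: "F \<in> borel_measurable (N \<Otimes>\<^sub>M N)"
    and off: "\<And>z. z \<in> space (N \<Otimes>\<^sub>M N) \<Longrightarrow> z \<notin> \<iota> ` space M \<times> \<iota> ` space M \<Longrightarrow> F z = 0"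
  shows "sqint (N \<Otimes>\<^sub>M N) F \<longleftrightarrow> sqint (M \<Otimes>\<^sub>M M) (\<lambda>z. F (\<iota> (fst z), \<iota> (snd z)))"
    "L2_norm (N \<Otimes>\<^sub>M N) F = L2_norm (M \<Otimes>\<^sub>M M) (\<lambda>z. F (\<iota> (fst z), \<iota> (snd z)))"
    "(\<integral>y. F y \<partial>(N \<Otimes>\<^sub>M N)) = (\<integral>z. F (\<iota> (fst z), \<iota> (snd z)) \<partial>(M \<Otimes>\<^sub>M M))"
proof -
  have E: "\<iota> ` space M \<times> \<iota> ` space M \<in> sets (N \<Otimes>\<^sub>M N)" by measurable
  have \<iota>2: "(\<lambda>z. (\<iota> (fst z), \<iota> (snd z))) \<in> measurable (M \<Otimes>\<^sub>M M) (N \<Otimes>\<^sub>M N)" by measurable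
  show "sqint (N \<Otimes>\<^sub>M N) F \<longleftrightarrow> sqint (M \<Otimes>\<^sub>M M) (\<lambda>z. F (\<iota> (fst z), \<iota> (snd z)))"
    "L2_norm (N \<Otimes>\<^sub>M N) F = L2_norm (M \<Otimes>\<^sub>M M) (\<lambda>z. F (\<iota> (fst z), \<iota> (snd z)))"
    "(\<integral>y. F y \<partial>(N \<Otimes>\<^sub>M N)) = (\<integral>z. F (\<iota> (fst z), \<iota> (snd z)) \<partial>(M \<Otimes>\<^sub>M M))"
    using sqint_density_indicator[OF E F off] L2_norm_density_indicator[OF E F off]
      integral_density_indicator[OF E F off] sqint_distr[OF \<iota>2 F] integral_distr[OF \<iota>2 F]
    by (simp_all add: distr_embedding_pair)
qed

end

section \<open>Graphexes on trivial extensions\<close>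

lemma trivial_extension_embedding:
  assumes "good_graphex G" "trivial_extension \<iota> G H"
  shows "space_embedding (gspace G) (gspace H) \<iota>"
  using assms by (auto simp: trivial_extension_def good_graphex_def space_embedding_def)

lemma trivial_extension_good:
  assumes G: "good_graphex G" and H: "trivial_extension \<iota> G H"
  shows "good_graphex H" and "rho H = rho G"
    and "\<And>x. x \<in> space (gspace G) \<Longrightarrow> marginal H (\<iota> x) = marginal G x"
    and "\<And>y. y \<in> space (gspace H) \<Longrightarrow> y \<notin> \<iota> ` space (gspace G) \<Longrightarrow> marginal H y = 0"
proof -
  define M N where "M = gspace G" and "N = gspace H"
  interpret space_embedding M N \<iota>
    unfolding M_def N_def by (rule trivial_extension_embedding[OF G H])
  have W: "sqker M (gW G)" and S[measurable]: "gS G \<in> borel_measurable M" and D: "sqint M (marginal G)"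
    using G by (auto simp: good_graphex_def M_def)
  have in_N: "\<iota> x \<in> space N" if "x \<in> space M" for x
    using measurable_space[OF measurable_embedding that] .
  have HW: "gW H (\<iota> x) (\<iota> y) = gW G x y" if "x \<in> space M" "y \<in> space M" for x y
    using H that by (auto simp: trivial_extension_def M_def)
  have HW0: "gW H x y = 0" if "x \<in> space N" "y \<in> space N" "x \<notin> \<iota> ` space M \<or> y \<notin> \<iota> ` space M" for x y
    using H that by (auto simp: trivial_extension_def M_def N_def)
  have HS: "gS H (\<iota> x) = gS G x" if "x \<in> space M" for x
    using H that by (auto simp: trivial_extension_def M_def)
  have HS0: "gS H x = 0" if "x \<in> space N" "x \<notin> \<iota> ` space M" for x
    using H that by (auto simp: trivial_extension_def M_def N_def)
  have HI: "gI H = gI G" using H by (simp add: trivial_extension_def)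
  have Woff: "gW H (fst z) (snd z) = 0" if "z \<in> space (N \<Otimes>\<^sub>M N)" "z \<notin> \<iota> ` space M \<times> \<iota> ` space M" for z
    using that HW0 by (cases z) (auto simp: space_pair_measure)
  have Wm: "(\<lambda>z. gW H (fst z) (snd z)) \<in> borel_measurable (N \<Otimes>\<^sub>M N)"
    by (rule measurable_extend_pair[OF sqint_measurable[OF W] _ Woff]) (simp_all add: HW)
  note Wx = sqint_extend_pair[OF Wm Woff]
  have HWG: "gW H (fst (\<iota> (fst z), \<iota> (snd z))) (snd (\<iota> (fst z), \<iota> (snd z))) = gW G (fst z) (snd z)"
    if "z \<in> space (M \<Otimes>\<^sub>M M)" for z
    using that HW by (auto simp: space_pair_measure)
  have HWs: "sqker N (gW H)"
  proof -
    have "sqint (M \<Otimes>\<^sub>M M) (\<lambda>z. gW H (fst (\<iota> (fst z), \<iota> (snd z))) (snd (\<iota> (fst z), \<iota> (snd z))))"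
      by (subst sqint_cong(1)) (rule HWG, assumption, rule W)
    then show ?thesis using Wx(1) by simp
  qed
  have Sm[measurable]: "gS H \<in> borel_measurable N"
    by (rule measurable_extend[OF S HS HS0]) auto
  have "(\<integral>z. gW H (fst z) (snd z) \<partial>(N \<Otimes>\<^sub>M N)) = (\<integral>z. gW H (\<iota> (fst z)) (\<iota> (snd z)) \<partial>(M \<Otimes>\<^sub>M M))"
    using Wx(3) by simp
  also have "\<dots> = (\<integral>z. gW G (fst z) (snd z) \<partial>(M \<Otimes>\<^sub>M M))"
    by (rule Bochner_Integration.integral_cong[OF refl]) (use HWG in simp)
  finally have "(\<integral>z. gW H (fst z) (snd z) \<partial>(N \<Otimes>\<^sub>M N)) = (\<integral>z. gW G (fst z) (snd z) \<partial>(M \<Otimes>\<^sub>M M))" .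
  moreover have "(\<integral>y. gS H y \<partial>N) = (\<integral>x. gS G x \<partial>M)"
    by (subst sqint_extend(3)[OF Sm HS0], assumption+) (rule Bochner_Integration.integral_cong[OF refl], rule HS)
  ultimately show "rho H = rho G"
    by (simp add: rho_def HI M_def N_def)
  have mG: "marginal H (\<iota> x) = marginal G x" if x: "x \<in> space M" for x
  proof -
    have m: "gW H (\<iota> x) \<in> borel_measurable N"
      using measurable_compose[OF measurable_Pair1'[OF in_N[OF x]] Wm] by simp
    have "(\<integral>y. gW H (\<iota> x) y \<partial>N) = (\<integral>y. gW H (\<iota> x) (\<iota> y) \<partial>M)"
      using HW0 in_N[OF x] by (intro sqint_extend(3)[OF m]) auto
    also have "\<dots> = (\<integral>y. gW G x y \<partial>M)"
      by (rule Bochner_Integration.integral_cong) (simp_all add: HW x)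
    finally show ?thesis using HS x by (simp add: marginal_def M_def N_def)
  qed
  then show "\<And>x. x \<in> space (gspace G) \<Longrightarrow> marginal H (\<iota> x) = marginal G x" by (simp add: M_def)
  have m0: "marginal H y = 0" if y: "y \<in> space N" "y \<notin> \<iota> ` space M" for y
  proof -
    have "(\<integral>w. gW H y w \<partial>N) = (\<integral>w. 0 \<partial>N)"
      by (rule Bochner_Integration.integral_cong) (use HW0 y in auto)
    then show ?thesis using HS0 y by (simp add: marginal_def N_def)
  qed
  then show "\<And>y. y \<in> space (gspace H) \<Longrightarrow> y \<notin> \<iota> ` space (gspace G) \<Longrightarrow> marginal H y = 0"
    by (simp add: M_def N_def)
  have Dm: "marginal H \<in> borel_measurable N"
    by (rule measurable_extend[OF sqint_measurable[OF D] mG m0]) auto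
  have "sqint N (marginal H)"
  proof -
    have "sqint M (\<lambda>x. marginal H (\<iota> x))"
      by (subst sqint_cong(1)) (rule mG, assumption, rule D)
    then show ?thesis using sqint_extend(1)[OF Dm m0] by simp
  qed
  with HWs Sm sigma_finite_N show "good_graphex H"
    by (simp add: good_graphex_def N_def)
qed

text \<open>New points go to cell 0, where the step function vanishes just as the extended kernel
  and marginal do. The approximation error is therefore unchanged by the extension.\<close>

definition extend_cells :: "'a measure \<Rightarrow> ('a \<Rightarrow> 'b) \<Rightarrow> ('a \<Rightarrow> nat) \<Rightarrow> 'b \<Rightarrow> nat" where
  "extend_cells M \<iota> \<kappa> y = (if y \<in> \<iota> ` space M then \<kappa> (inv_into (space M) \<iota> y) else 0)"

lemma extend_cells:
  assumes G: "good_graphex G" and H: "trivial_extension \<iota> G H"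
    and \<kappa>: "cell_map (gspace G) \<kappa>" and U: "\<And>k. U 0 k = 0" "\<And>k. U k 0 = 0" "V 0 = 0"
    and WU: "L2_close (gspace G \<Otimes>\<^sub>M gspace G) \<epsilon> (\<lambda>z. gW G (fst z) (snd z)) (\<lambda>z. U (\<kappa> (fst z)) (\<kappa> (snd z)))"
    and DV: "L2_close (gspace G) \<epsilon> (marginal G) (\<lambda>x. V (\<kappa> x))"
  defines "c \<equiv> extend_cells (gspace G) \<iota> \<kappa>"
  shows "c \<in> measurable (gspace H) (count_space UNIV)"
    and "L2_close (gspace H \<Otimes>\<^sub>M gspace H) \<epsilon> (\<lambda>z. gW H (fst z) (snd z)) (\<lambda>z. U (c (fst z)) (c (snd z)))"
    and "L2_close (gspace H) \<epsilon> (marginal H) (\<lambda>x. V (c x))"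
    and "\<And>k. k \<noteq> 0 \<Longrightarrow> emeasure (gspace H) {y\<in>space (gspace H). c y = k} = emeasure (gspace G) {x\<in>space (gspace G). \<kappa> x = k}"
    and "emeasure (gspace H) {y\<in>space (gspace H). c y \<noteq> 0} < \<infinity>"
proof -
  define M N where "M = gspace G" and "N = gspace H"
  interpret space_embedding M N \<iota>
    unfolding M_def N_def by (rule trivial_extension_embedding[OF G H])
  note ext = trivial_extension_good[OF G H, folded M_def N_def]
  have [measurable]: "\<kappa> \<in> measurable M (count_space UNIV)"
    using \<kappa> by (simp add: cell_map_def M_def)
  have in_N: "\<iota> x \<in> space N" if "x \<in> space M" for x
    using measurable_space[OF measurable_embedding that] .
  have c\<iota>: "c (\<iota> x) = \<kappa> x" if "x \<in> space M" for x
    using that inj by (simp add: c_def extend_cells_def M_def[symmetric])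
  have c0: "c y = 0" if "y \<notin> \<iota> ` space M" for y
    using that by (simp add: c_def extend_cells_def M_def[symmetric])
  show "c \<in> measurable (gspace H) (count_space UNIV)"
    unfolding N_def[symmetric] by (rule measurable_extend[where f=\<kappa> and z=0]) (auto simp: c\<iota> c0)
  \<comment> \<open>A set of cells without cell 0 lies inside the image, where masses are those of
    the original space.\<close>
  have preimage: "{y\<in>space N. c y \<in> K} = \<iota> ` {x\<in>space M. \<kappa> x \<in> K}" if "0 \<notin> K" for K
  proof -
    have "y \<in> \<iota> ` {x\<in>space M. \<kappa> x \<in> K}" if "y \<in> space N" "c y \<in> K" for y
    proof -
      have "y \<in> \<iota> ` space M" using c0[of y] that \<open>0 \<notin> K\<close> by metis
      then show ?thesis using that(2) c\<iota> by auto
    qed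
    then show ?thesis using c\<iota> in_N by auto
  qed
  have em: "emeasure N {y\<in>space N. c y \<in> K} = emeasure M {x\<in>space M. \<kappa> x \<in> K}" if "0 \<notin> K" for K
    unfolding preimage[OF that] by (rule emeasure_image[symmetric]) measurable
  show "emeasure (gspace H) {y\<in>space (gspace H). c y = k} = emeasure (gspace G) {x\<in>space (gspace G). \<kappa> x = k}"
    if "k \<noteq> 0" for k
    using em[of "{k}"] that by (simp add: M_def N_def)
  show "emeasure (gspace H) {y\<in>space (gspace H). c y \<noteq> 0} < \<infinity>"
    using em[of "- {0}"] \<kappa> by (simp add: M_def N_def cell_map_def)
  define F where "F z = gW H (fst z) (snd z) - U (c (fst z)) (c (snd z))" for z
  have HW: "gW H (\<iota> x) (\<iota> y) = gW G x y" if "x \<in> space M" "y \<in> space M" for x y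
    using H that by (auto simp: trivial_extension_def M_def)
  have F\<iota>: "F (\<iota> (fst z), \<iota> (snd z)) = gW G (fst z) (snd z) - U (\<kappa> (fst z)) (\<kappa> (snd z))"
    if "z \<in> space (M \<Otimes>\<^sub>M M)" for z
    using that by (auto simp: F_def HW c\<iota> space_pair_measure)
  have F0: "F z = 0" if "z \<in> space (N \<Otimes>\<^sub>M N)" "z \<notin> \<iota> ` space M \<times> \<iota> ` space M" for z
    using that H c0 U by (cases z) (auto simp: F_def space_pair_measure trivial_extension_def M_def N_def)
  have WU': "sqint (M \<Otimes>\<^sub>M M) (\<lambda>z. gW G (fst z) (snd z) - U (\<kappa> (fst z)) (\<kappa> (snd z)))"
    "L2_norm (M \<Otimes>\<^sub>M M) (\<lambda>z. gW G (fst z) (snd z) - U (\<kappa> (fst z)) (\<kappa> (snd z))) \<le> \<epsilon>"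
    using WU by (auto simp: L2_close_def M_def)
  have Fm: "F \<in> borel_measurable (N \<Otimes>\<^sub>M N)"
    by (rule measurable_extend_pair[OF sqint_measurable[OF WU'(1)] _ F0])
       (auto simp: F_def HW c\<iota>)
  show "L2_close (gspace H \<Otimes>\<^sub>M gspace H) \<epsilon> (\<lambda>z. gW H (fst z) (snd z)) (\<lambda>z. U (c (fst z)) (c (snd z)))"
  proof -
    have "sqint (M \<Otimes>\<^sub>M M) (\<lambda>z. F (\<iota> (fst z), \<iota> (snd z)))
        \<longleftrightarrow> sqint (M \<Otimes>\<^sub>M M) (\<lambda>z. gW G (fst z) (snd z) - U (\<kappa> (fst z)) (\<kappa> (snd z)))"
      by (rule sqint_cong(1)) (rule F\<iota>)
    moreover have "L2_norm (M \<Otimes>\<^sub>M M) (\<lambda>z. F (\<iota> (fst z), \<iota> (snd z)))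
        = L2_norm (M \<Otimes>\<^sub>M M) (\<lambda>z. gW G (fst z) (snd z) - U (\<kappa> (fst z)) (\<kappa> (snd z)))"
      by (rule sqint_cong(2)) (rule F\<iota>)
    ultimately show ?thesis
      unfolding L2_close_def N_def[symmetric] F_def[symmetric]
      using sqint_extend_pair(1,2)[OF Fm F0] WU' by simp
  qed
  define F' where "F' y = marginal H y - V (c y)" for y
  have F'\<iota>: "F' (\<iota> x) = marginal G x - V (\<kappa> x)" if "x \<in> space M" for x
    using that by (simp add: F'_def ext(3) c\<iota>)
  have F'0: "F' y = 0" if "y \<in> space N" "y \<notin> \<iota> ` space M" for y
    using that by (simp add: F'_def ext(4) c0 U)
  have DV': "sqint M (\<lambda>x. marginal G x - V (\<kappa> x))" "L2_norm M (\<lambda>x. marginal G x - V (\<kappa> x)) \<le> \<epsilon>"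
    using DV by (auto simp: L2_close_def M_def)
  have F'm: "F' \<in> borel_measurable N"
    by (rule measurable_extend[OF sqint_measurable[OF DV'(1)] F'\<iota> F'0]) auto
  show "L2_close (gspace H) \<epsilon> (marginal H) (\<lambda>x. V (c x))"
  proof -
    have "sqint M (\<lambda>x. F' (\<iota> x)) \<longleftrightarrow> sqint M (\<lambda>x. marginal G x - V (\<kappa> x))"
      by (rule sqint_cong(1)) (rule F'\<iota>)
    moreover have "L2_norm M (\<lambda>x. F' (\<iota> x)) = L2_norm M (\<lambda>x. marginal G x - V (\<kappa> x))"
      by (rule sqint_cong(2)) (rule F'\<iota>)
    ultimately show ?thesis
      unfolding L2_close_def N_def[symmetric] F'_def[symmetric]
      using sqint_extend(1,2)[OF F'm F'0] DV' by simp
  qed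
qed

text \<open>The value 0 arises as an infimum: each accuracy has its own cells and its own
  coupling.\<close>

lemma delta22_tilde_extensions_eq_0:
  assumes G: "good_graphex G" and H: "infinite_trivial_extension \<iota> G H" and H': "infinite_trivial_extension \<iota>' G H'"
  shows "delta22_tilde H H' = 0"
proof -
  have t: "trivial_extension \<iota> G H" "trivial_extension \<iota>' G H'"
    and inf: "emeasure (gspace H) (space (gspace H)) = \<infinity>" "emeasure (gspace H') (space (gspace H')) = \<infinity>"
    using H H' by (auto simp: infinite_trivial_extension_def)
  note e = trivial_extension_good[OF G t(1)] and e' = trivial_extension_good[OF G t(2)]
  have s: "sigma_finite_measure (gspace G)" and W: "sqker (gspace G) (gW G)" and D: "sqint (gspace G) (marginal G)"
    using G by (auto simp: good_graphex_def)
  have sH: "sigma_finite_measure (gspace H)" "sqker (gspace H) (gW H)" "sqint (gspace H) (marginal H)"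
    and sH': "sigma_finite_measure (gspace H')" "sqker (gspace H') (gW H')" "sqint (gspace H') (marginal H')"
    using e(1) e'(1) by (auto simp: good_graphex_def)
  have "delta22_tilde H H' \<le> 0"
  proof (rule ereal_le_epsilon2)
    fix \<eta> :: real assume "\<eta> > 0"
    define \<epsilon> where "\<epsilon> = min (\<eta> / 2) (\<eta>\<^sup>2 / 2)"
    have \<epsilon>: "\<epsilon> > 0" "2 * \<epsilon> \<le> \<eta>" "2 * \<epsilon> \<le> \<eta>\<^sup>2" using \<open>\<eta> > 0\<close> by (auto simp: \<epsilon>_def)
    obtain \<kappa> U V where \<kappa>: "cell_map (gspace G) \<kappa>" and U: "\<And>k. U 0 k = 0" "\<And>k. U k 0 = 0" "V 0 = 0"
      and WU: "L2_close (gspace G \<Otimes>\<^sub>M gspace G) \<epsilon> (\<lambda>z. gW G (fst z) (snd z)) (\<lambda>z. U (\<kappa> (fst z)) (\<kappa> (snd z)))"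
      and DV: "L2_close (gspace G) \<epsilon> (marginal G) (\<lambda>x. V (\<kappa> x))"
      by (rule step_approximation[OF s W D \<epsilon>(1)]) (rule that)
    define c c' where "c = extend_cells (gspace G) \<iota> \<kappa>" and "c' = extend_cells (gspace G) \<iota>' \<kappa>"
    note x = extend_cells[where U=U and V=V, OF G t(1) \<kappa> U WU DV, folded c_def]
    note x' = extend_cells[where U=U and V=V, OF G t(2) \<kappa> U WU DV, folded c'_def]
    \<comment> \<open>Here infinite total mass enters: the other cells have finite mass together, so
      cell 0 has infinite mass in both extensions, whatever its mass in \<open>G\<close>.\<close>
    have zero: "emeasure N {y\<in>space N. f y = 0} = \<infinity>"
      if "emeasure N (space N) = \<infinity>" "f \<in> measurable N (count_space UNIV)" "emeasure N {y\<in>space N. f y \<noteq> 0} < \<infinity>"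
      for N :: "'z measure" and f :: "'z \<Rightarrow> nat"
    proof -
      note [measurable] = that(2)
      have "emeasure N (space N) \<le> emeasure N ({y\<in>space N. f y = 0} \<union> {y\<in>space N. f y \<noteq> 0})"
        by (rule emeasure_mono) auto
      also have "\<dots> \<le> emeasure N {y\<in>space N. f y = 0} + emeasure N {y\<in>space N. f y \<noteq> 0}"
        by (rule emeasure_subadditive) auto
      finally have "emeasure N {y\<in>space N. f y = 0} + emeasure N {y\<in>space N. f y \<noteq> 0} = \<infinity>"
        using that(1) by (simp add: top_unique)
      with that(3) show ?thesis by (auto simp: ennreal_add_eq_top)
    qed
    have "emeasure (gspace H) {y\<in>space (gspace H). c y = k} = emeasure (gspace H') {y\<in>space (gspace H'). c' y = k}" for k
      using x(4)[of k] x'(4)[of k] zero[OF inf(1) x(1,5)] zero[OF inf(2) x'(1,5)]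
      by (cases "k = 0") simp_all
    then obtain P where P: "P \<in> couplings (gspace H) (gspace H')" and ae: "AE z in P. c (fst z) = c' (snd z)"
      by (rule coupling_over_cells[OF sH(1) sH'(1) x(1) x'(1)])
    have "dbound P (dW H H') (dD H H') 0 \<eta>"
      using \<epsilon> \<open>\<eta> > 0\<close>
      by (intro dbound_cells[OF sH(1) P sH'(1) sH(2) sH'(2) sH(3) sH'(3) ae x(2) x'(2) x(3) x'(3)]) auto
    then have "delta22_tilde H H' \<le> ereal \<eta>"
      using e(2) e'(2) by (intro delta22_tilde_le[OF e(1) e'(1) P]) simp
    then show "delta22_tilde H H' \<le> 0 + ereal \<eta>" by simp
  qed
  with delta22_tilde_nonneg[of H H'] show ?thesis by (rule antisym[rotated])
qed

text \<open>Any one coupling bounds the infimum, and on it all three quantities are finite.\<close>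

lemma delta22_tilde_finite:
  assumes G: "good_graphex G" "good_graphex H"
    and inf: "emeasure (gspace G) (space (gspace G)) = emeasure (gspace H) (space (gspace H))"
  shows "delta22_tilde G H < \<infinity>"
proof -
  have s: "sigma_finite_measure (gspace G)" "sigma_finite_measure (gspace H)"
    using G by (auto simp: good_graphex_def)
  \<comment> \<open>A constant cell map makes the whole space a single cell, so equal total masses
    already yield a coupling.\<close>
  have "emeasure (gspace G) {x\<in>space (gspace G). (0::nat) = k} = emeasure (gspace H) {x\<in>space (gspace H). 0 = k}" for k
    using inf by (cases "k = 0") auto
  then obtain P where P: "P \<in> couplings (gspace G) (gspace H)"
    by (rule coupling_over_cells[OF s measurable_const measurable_const, rotated 2]) auto
  have sP: "sigma_finite_measure P" using P s(1) by (rule couplings_sigma_finite)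
  define a b d where "a = L2_norm (P \<Otimes>\<^sub>M P) (\<lambda>z. dW G H (fst z) (snd z))" and "b = L2_norm P (dD G H)"
    and "d = \<bar>rho G - rho H\<bar>"
  \<comment> \<open>The summand 1 gives \<open>1 \<le> c\<close>, so that \<open>c\<close> lies
    below its square and its cube and one number bounds all three quantities.\<close>
  define c where "c = 1 + a + b + d"
  have nn: "0 \<le> a" "0 \<le> b" "0 \<le> d" by (simp_all add: a_def b_def d_def)
  then have c1: "1 \<le> c" by (simp add: c_def)
  have "c \<le> c\<^sup>2" "c \<le> c ^ 3"
    using c1 by (simp_all add: self_le_power)
  then have "dbound P (dW G H) (dD G H) (rho G - rho H) c"
    unfolding dbound_def using nn c1 kbound_L2[OF sP sqint_dW_dD(1)[OF G P], of c]
    by (auto simp: c_def a_def[symmetric] b_def[symmetric] d_def[symmetric])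
  from delta22_tilde_le[OF G P this] show ?thesis by (auto intro: le_less_trans)
qed

text \<open>Without an extension on the sum type the condition in the definite description of
  \<open>delta22\<close> would hold vacuously for every \<open>d\<close>. The space is the disjoint
  sum of \<open>M\<close> and the counting measure on the naturals.\<close>

lemma infinite_trivial_extension_exists:
  fixes G :: "'a graphex"
  assumes "sigma_finite_measure (gspace G)"
  shows "\<exists>(\<iota> :: 'a \<Rightarrow> 'a + nat) H. infinite_trivial_extension \<iota> G H"
proof -
  define M where "M = gspace G"
  interpret sigma_finite_measure M using assms by (simp add: M_def)
  define \<Omega> where "\<Omega> = Inl ` space M \<union> range (Inr :: nat \<Rightarrow> 'a + nat)"
  \<comment> \<open>Every set of atoms is measurable, so only the part in the original space is
    constrained.\<close>
  define \<A> where "\<A> = {B. B \<subseteq> \<Omega> \<and> Inl -` B \<in> sets M}"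
  define f where "f B = emeasure M (Inl -` B) + emeasure (count_space UNIV) (Inr -` B)" for B :: "('a + nat) set"
  have sa: "sigma_algebra \<Omega> \<A>"
  proof (rule sigma_algebra.intro)
    show "sigma_algebra_axioms \<A>"
      by (rule sigma_algebra_axioms.intro) (auto simp: \<A>_def vimage_Union)
    show "algebra \<Omega> \<A>"
      unfolding algebra_iff_Un
    proof (intro conjI ballI)
      show "\<A> \<subseteq> Pow \<Omega>" "{} \<in> \<A>" by (auto simp: \<A>_def)
      fix B assume B: "B \<in> \<A>"
      have "Inl -` (\<Omega> - B) = space M - Inl -` B" by (auto simp: \<Omega>_def)
      then show "\<Omega> - B \<in> \<A>" using B by (auto simp: \<A>_def)
    qed (auto simp: \<A>_def)
  qed
  have f: "positive \<A> f" "countably_additive \<A> f"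
  proof -
    show "positive \<A> f" by (simp add: positive_def f_def)
    show "countably_additive \<A> f"
      unfolding countably_additive_def
    proof (intro allI impI)
      fix A :: "nat \<Rightarrow> ('a + nat) set" assume A: "range A \<subseteq> \<A>" "disjoint_family A"
      have d: "disjoint_family (\<lambda>i. Inl -` A i)" "disjoint_family (\<lambda>i. Inr -` A i)"
        using A(2) by (auto simp: disjoint_family_on_def)
      have "range (\<lambda>i. Inl -` A i) \<subseteq> sets M" using A(1) by (auto simp: \<A>_def)
      then have "(\<Sum>i. emeasure M (Inl -` A i)) = emeasure M (\<Union>i. Inl -` A i)"
        using d(1) by (rule suminf_emeasure)
      moreover have "(\<Sum>i. emeasure (count_space UNIV) (Inr -` A i)) = emeasure (count_space UNIV) (\<Union>i. Inr -` A i)"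
        using d(2) by (intro suminf_emeasure) auto
      ultimately show "(\<Sum>i. f (A i)) = f (\<Union> (range A))"
        by (simp add: f_def suminf_add[symmetric] vimage_UN)
    qed
  qed
  define N where "N = measure_of \<Omega> \<A> f"
  have sub: "\<A> \<subseteq> Pow \<Omega>" by (auto simp: \<A>_def)
  have space_N: "space N = \<Omega>" using sub by (simp add: N_def space_measure_of)
  have sets_N: "sets N = \<A>" using sub by (simp add: N_def sets_measure_of sigma_algebra.sigma_sets_eq[OF sa])
  have em_N: "emeasure N B = f B" if "B \<in> \<A>" for B
    unfolding N_def by (rule emeasure_measure_of_sigma[OF sa f that])
  have \<Omega>: "\<Omega> \<in> \<A>"
  proof -
    have "Inl -` \<Omega> = space M" by (auto simp: \<Omega>_def)
    then show ?thesis by (simp add: \<A>_def)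
  qed
  have inl: "Inl ` B \<in> \<A>" "f (Inl ` B) = emeasure M B" if "B \<in> sets M" for B
  proof -
    have "Inl -` ((Inl :: 'a \<Rightarrow> 'a + nat) ` B) = B" "Inr -` ((Inl :: 'a \<Rightarrow> 'a + nat) ` B) = {}"
      by auto
    then show "Inl ` B \<in> \<A>" "f (Inl ` B) = emeasure M B"
      using that sets.sets_into_space[OF that] by (auto simp: \<A>_def f_def \<Omega>_def)
  qed
  have sf: "sigma_finite_measure N"
  proof
    obtain F where F: "countable F" "F \<subseteq> sets M" "\<Union> F = space M" "\<forall>a\<in>F. emeasure M a \<noteq> \<infinity>"
      using sigma_finite_countable by blast
    have inr: "{Inr n} \<in> \<A>" "f {Inr n} = 1" for n
    proof -
      have "Inl -` {Inr n :: 'a + nat} = {}" "Inr -` {Inr n :: 'a + nat} = {n}" by auto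
      then show "{Inr n} \<in> \<A>" "f {Inr n} = 1" by (auto simp: \<A>_def f_def \<Omega>_def)
    qed
    show "\<exists>A. countable A \<and> A \<subseteq> sets N \<and> \<Union> A = space N \<and> (\<forall>a\<in>A. emeasure N a \<noteq> \<infinity>)"
    proof (intro exI conjI)
      show "countable ((\<lambda>B. Inl ` B) ` F \<union> range (\<lambda>n. {Inr n :: 'a + nat}))"
        using F(1) by auto
      show "(\<lambda>B. Inl ` B) ` F \<union> range (\<lambda>n. {Inr n}) \<subseteq> sets N"
        using F(2) inl(1) inr(1) by (auto simp: sets_N)
      show "\<Union> ((\<lambda>B. Inl ` B) ` F \<union> range (\<lambda>n. {Inr n})) = space N"
        by (simp add: space_N \<Omega>_def F(3)[symmetric] image_Union[symmetric] UNION_singleton_eq_range)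
      show "\<forall>a\<in>(\<lambda>B. Inl ` B) ` F \<union> range (\<lambda>n. {Inr n}). emeasure N a \<noteq> \<infinity>"
        using F(2,4) inl inr by (auto simp: em_N)
    qed
  qed
  have eq: "(\<lambda>A. Inl ` A) ` sets M = {B \<in> sets N. B \<subseteq> Inl ` space M}"
  proof (intro set_eqI iffI)
    fix B :: "('a + nat) set" assume "B \<in> (\<lambda>A. Inl ` A) ` sets M"
    then obtain A where A: "A \<in> sets M" "B = Inl ` A" by blast
    then show "B \<in> {B \<in> sets N. B \<subseteq> Inl ` space M}"
      using inl(1)[OF A(1)] image_mono[OF sets.sets_into_space[OF A(1)]] by (simp add: sets_N)
  next
    fix B :: "('a + nat) set" assume B: "B \<in> {B \<in> sets N. B \<subseteq> Inl ` space M}"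
    then have "B = Inl ` (Inl -` B)" by auto
    moreover have "Inl -` B \<in> sets M" using B by (simp add: sets_N \<A>_def)
    ultimately show "B \<in> (\<lambda>A. Inl ` A) ` sets M" by blast
  qed
  have inf: "emeasure N (space N) = \<infinity>"
  proof -
    have "Inr -` \<Omega> = UNIV" by (auto simp: \<Omega>_def)
    then show ?thesis using em_N[OF \<Omega>] by (simp add: space_N f_def)
  qed
  define H where "H = \<lparr>gspace = N,
     gW = (\<lambda>x y. case (x, y) of (Inl a, Inl b) \<Rightarrow> gW G a b | _ \<Rightarrow> 0),
     gS = (\<lambda>x. case x of Inl a \<Rightarrow> gS G a | Inr _ \<Rightarrow> 0), gI = gI G\<rparr>"
  have "infinite_trivial_extension Inl G H"
    unfolding infinite_trivial_extension_def trivial_extension_def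
    using sf eq inf inl M_def[symmetric]
    by (auto simp: H_def sets_N em_N space_N \<Omega>_def split: sum.split)
  then show ?thesis by blast
qed

text \<open>One extension is exchanged at a time, each at distance 0 from its replacement. The
  opposite inequality is the same statement with the two pairs exchanged.\<close>

lemma delta22_tilde_extension_le:
  assumes G: "good_graphex G" "good_graphex H"
    and e: "infinite_trivial_extension \<iota>1 G G'" "infinite_trivial_extension \<iota>2 H H'"
      "infinite_trivial_extension \<kappa>1 G G''" "infinite_trivial_extension \<kappa>2 H H''"
  shows "delta22_tilde G' H' \<le> delta22_tilde G'' H''"
proof -
  have g: "good_graphex G'" "good_graphex G''" "good_graphex H'" "good_graphex H''"
    using trivial_extension_good(1) G e unfolding infinite_trivial_extension_def by blast+
  have "delta22_tilde G' H' \<le> delta22_tilde G' G'' + delta22_tilde G'' H'"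
    by (rule delta22_tilde_triangle[OF g(1,2,3)])
  also have "\<dots> = delta22_tilde G'' H'"
    by (simp add: delta22_tilde_extensions_eq_0[OF G(1) e(1,3)])
  also have "\<dots> \<le> delta22_tilde G'' H'' + delta22_tilde H'' H'"
    by (rule delta22_tilde_triangle[OF g(2,4,3)])
  also have "\<dots> = delta22_tilde G'' H''"
    by (simp add: delta22_tilde_extensions_eq_0[OF G(2) e(4,2)])
  finally show ?thesis .
qed

lemma delta22_tilde_extension_eq:
  assumes "good_graphex G" "good_graphex H"
    and "infinite_trivial_extension \<iota>1 G G'" "infinite_trivial_extension \<iota>2 H H'"
      "infinite_trivial_extension \<kappa>1 G G''" "infinite_trivial_extension \<kappa>2 H H''"
  shows "delta22_tilde G' H' = delta22_tilde G'' H''"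
  using assms by (intro antisym delta22_tilde_extension_le)

text \<open>Links extensions on arbitrary types to \<open>delta22\<close>, which refers to sum types
  only. The auxiliary \<open>G0\<close> and \<open>H0\<close> on those types pin down the described
  value.\<close>

lemma delta22_eq:
  fixes G :: "'a graphex" and H :: "'b graphex"
  assumes G: "good_graphex G" "good_graphex H"
    and e: "infinite_trivial_extension \<iota>1 G G'" "infinite_trivial_extension \<iota>2 H H'"
  shows "delta22_tilde G' H' = delta22 G H"
proof -
  obtain \<kappa>1 :: "'a \<Rightarrow> 'a + nat" and G0 where 1: "infinite_trivial_extension \<kappa>1 G G0"
    using infinite_trivial_extension_exists[of G] G by (auto simp: good_graphex_def)
  obtain \<kappa>2 :: "'b \<Rightarrow> 'b + nat" and H0 where 2: "infinite_trivial_extension \<kappa>2 H H0"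
    using infinite_trivial_extension_exists[of H] G by (auto simp: good_graphex_def)
  have "delta22 G H = delta22_tilde G' H'"
    unfolding delta22_def
  proof (rule the_equality)
    show "\<forall>(\<iota> :: 'a \<Rightarrow> 'a + nat) (\<kappa> :: 'b \<Rightarrow> 'b + nat) Ga Ha.
        infinite_trivial_extension \<iota> G Ga \<and> infinite_trivial_extension \<kappa> H Ha \<longrightarrow>
        delta22_tilde Ga Ha = delta22_tilde G' H'"
      using delta22_tilde_extension_eq[OF G _ _ e] by blast
    fix d assume "\<forall>(\<iota> :: 'a \<Rightarrow> 'a + nat) (\<kappa> :: 'b \<Rightarrow> 'b + nat) Ga Ha.
        infinite_trivial_extension \<iota> G Ga \<and> infinite_trivial_extension \<kappa> H Ha \<longrightarrow> delta22_tilde Ga Ha = d"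
    then have "delta22_tilde G0 H0 = d" using 1 2 by blast
    then show "d = delta22_tilde G' H'"
      using delta22_tilde_extension_eq[OF G 1 2 e] by simp
  qed
  then show ?thesis by simp
qed

theorem theorem2p11:
  fixes W1 :: "'a graphex" and W2 :: "'b graphex" and W3 :: "'c graphex"
  assumes "signed_graphex W1" "graphex_L1_L2 W1"
    and "signed_graphex W2" "graphex_L1_L2 W2"
    and "signed_graphex W3" "graphex_L1_L2 W3"
  shows "(\<exists>(\<iota>1 :: 'a \<Rightarrow> 'a + nat) W1'. infinite_trivial_extension \<iota>1 W1 W1') \<and>
    (\<forall>(\<iota>1 :: 'a \<Rightarrow> 'd) (\<iota>2 :: 'b \<Rightarrow> 'e) (\<kappa>1 :: 'a \<Rightarrow> 'f) (\<kappa>2 :: 'b \<Rightarrow> 'g) W1' W2' W1'' W2''.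
       infinite_trivial_extension \<iota>1 W1 W1' \<and> infinite_trivial_extension \<iota>2 W2 W2' \<and>
       infinite_trivial_extension \<kappa>1 W1 W1'' \<and> infinite_trivial_extension \<kappa>2 W2 W2'' \<longrightarrow>
       delta22_tilde W1' W2' = delta22_tilde W1'' W2'') \<and>
    (\<forall>(\<iota>1 :: 'a \<Rightarrow> 'd) (\<iota>2 :: 'b \<Rightarrow> 'e) W1' W2'.
       infinite_trivial_extension \<iota>1 W1 W1' \<and> infinite_trivial_extension \<iota>2 W2 W2' \<longrightarrow>
       delta22_tilde W1' W2' = delta22 W1 W2) \<and>
    delta22 W1 W3 \<le> delta22 W1 W2 + delta22 W2 W3 \<and>
    0 \<le> delta22 W1 W2 \<and> delta22 W1 W2 < \<infinity> \<and>
    delta22 W1 W1 = 0 \<and>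
    delta22 W1 W2 = delta22 W2 W1"
proof -
  have g: "good_graphex W1" "good_graphex W2" "good_graphex W3"
    using assms good_graphex_L1_L2 by blast+
  obtain \<iota>1 :: "'a \<Rightarrow> 'a + nat" and V1 where e1: "infinite_trivial_extension \<iota>1 W1 V1"
    using infinite_trivial_extension_exists[of W1] g(1) by (auto simp: good_graphex_def)
  obtain \<iota>2 :: "'b \<Rightarrow> 'b + nat" and V2 where e2: "infinite_trivial_extension \<iota>2 W2 V2"
    using infinite_trivial_extension_exists[of W2] g(2) by (auto simp: good_graphex_def)
  obtain \<iota>3 :: "'c \<Rightarrow> 'c + nat" and V3 where e3: "infinite_trivial_extension \<iota>3 W3 V3"
    using infinite_trivial_extension_exists[of W3] g(3) by (auto simp: good_graphex_def)
  have v: "good_graphex V1" "good_graphex V2" "good_graphex V3"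
    using trivial_extension_good(1) g e1 e2 e3 unfolding infinite_trivial_extension_def by blast+
  \<comment> \<open>All distances are evaluated on one fixed extension of each graphex, so the
    pseudometric laws reduce to those of \<open>delta22_tilde\<close>.\<close>
  have d: "delta22 W1 W2 = delta22_tilde V1 V2" "delta22 W2 W3 = delta22_tilde V2 V3"
    "delta22 W1 W3 = delta22_tilde V1 V3" "delta22 W1 W1 = delta22_tilde V1 V1"
    "delta22 W2 W1 = delta22_tilde V2 V1"
    using delta22_eq[OF g(1,2) e1 e2] delta22_eq[OF g(2,3) e2 e3] delta22_eq[OF g(1,3) e1 e3]
      delta22_eq[OF g(1,1) e1 e1] delta22_eq[OF g(2,1) e2 e1] by simp_all
  show ?thesis
  proof (intro conjI)
    show "\<exists>(\<iota>1 :: 'a \<Rightarrow> 'a + nat) W1'. infinite_trivial_extension \<iota>1 W1 W1'"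
      using e1 by blast
    show "\<forall>(\<iota>1 :: 'a \<Rightarrow> 'd) (\<iota>2 :: 'b \<Rightarrow> 'e) (\<kappa>1 :: 'a \<Rightarrow> 'f) (\<kappa>2 :: 'b \<Rightarrow> 'g) W1' W2' W1'' W2''.
       infinite_trivial_extension \<iota>1 W1 W1' \<and> infinite_trivial_extension \<iota>2 W2 W2' \<and>
       infinite_trivial_extension \<kappa>1 W1 W1'' \<and> infinite_trivial_extension \<kappa>2 W2 W2'' \<longrightarrow>
       delta22_tilde W1' W2' = delta22_tilde W1'' W2''"
      using delta22_tilde_extension_eq[OF g(1,2)] by blast
    show "\<forall>(\<iota>1 :: 'a \<Rightarrow> 'd) (\<iota>2 :: 'b \<Rightarrow> 'e) W1' W2'.
       infinite_trivial_extension \<iota>1 W1 W1' \<and> infinite_trivial_extension \<iota>2 W2 W2' \<longrightarrow>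
       delta22_tilde W1' W2' = delta22 W1 W2"
      using delta22_eq[OF g(1,2)] by blast
    show "delta22 W1 W3 \<le> delta22 W1 W2 + delta22 W2 W3"
      unfolding d by (rule delta22_tilde_triangle[OF v])
    show "0 \<le> delta22 W1 W2"
      unfolding d by (rule delta22_tilde_nonneg)
    show "delta22 W1 W2 < \<infinity>"
      unfolding d using e1 e2 by (intro delta22_tilde_finite[OF v(1,2)]) (simp add: infinite_trivial_extension_def)
    show "delta22 W1 W1 = 0"
      unfolding d by (rule delta22_tilde_extensions_eq_0[OF g(1) e1 e1])
    show "delta22 W1 W2 = delta22 W2 W1"
      unfolding d using v by (intro antisym delta22_tilde_commute_le)
  qed
qed

end
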